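(* Let $X$ be a symmetric space on $[0,1]$. The following assertions are equivalent: 1) The system $\{r_ir_j\}_{1\le i<j<\infty}$ in $X$ is equivalent to the canonical basis of $\ell_2$, i.e. there is a constant $C>0$ depending only on $X$ such that for all real $(a_{i,j})_{1\le i<j<\infty}\in\ell_2$ $$C^{-1}\|(a_{i,j})\|_2\le\Big\|\sum_{1\le i<j<\infty}a_{i,j}r_ir_j\Big\|_X\le C\,\|(a_{i,j})\|_2 .$$ 2) There is a continuous embedding $H\subset X$. 3) The system $\{r_ir_j\}_{1\le i<j<\infty}$ is an unconditional basic sequence in $X$.
   Context: Rademacher functions: $r_k(t)=\operatorname{sign}\sin(2^{k-1}\pi t)$, $t\in[0,1]$, $k=1,2,\ldots$ (so $r_1=1$ a.e.). A symmetric space on $[0,1]$ is a nonzero Banach space $X$ of (classes of a.e. equal) real measurable functions on $[0,1]$ such that: if $y\in X$ and $|x|\le|y|$ a.e. with $x$ measurable, then $x\in X$ and $\|x\|_X\le\|y\|_X$; and if $y\in X$ and $|x|$, $|y|$ are equimeasurable, then $x\in X$ and $\|x\|_X=\|y\|_X$. One always has $L_\infty\subset X\subset L_1$ continuously. $H$ denotes the closure of $L_\infty[0,1]$ in the Orlicz space $L_M[0,1]$, $M(t)=e^t-1$, with the norm of $L_M$: $\|x\|_{L_M}=\inf\{\lambda>0:\int_0^1M(|x(t)|/\lambda)\,dt\le1\}$. $\|(a_{i,j})\|_2=\big(\sum_{1\le i<j<\infty}a_{i,j}^2\big)^{1/2}$. For $(a_{i,j})\in\ell_2$ the sum $\sum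 a_{i,j}r_ir_j$ is understood as the function to which the orthogonal series converges in $L_2[0,1]$; $\|f\|_X=+\infty$ if $f\notin X$. A sequence in a Banach space is a basic sequence if it is a (Schauder) basis of its closed linear span. It is an unconditional basic sequence if every rearrangement (permutation of the indices) of it is also a basic sequence. Unconditionality does not depend on how the countable system $\{r_ir_j\}_{i<j}$ is enumerated. *)

theory Defs
  imports "HOL-Analysis.Analysis"
begin

abbreviation unit_measure :: "real measure" where
  "unit_measure \<equiv> lebesgue_on {0..1}"

definition equimeasurable :: "(real \<Rightarrow> real) \<Rightarrow> (real \<Rightarrow> real) \<Rightarrow> bool" where
  "equimeasurable x y \<longleftrightarrow>
     (\<forall>s. emeasure unit_measure {t \<in> space unit_measure. x t > s}
        = emeasure unit_measure {t \<in> space unit_measure. y t > s})"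

(* A space of a.e.-classes is represented by the set X of all representatives together with
   a seminorm N on X that vanishes exactly on the functions that are 0 a.e.  The ideal axioms
   make X and N invariant under changes on null sets; values outside [0,1] are irrelevant. *)

locale symmetric_space =
  fixes X :: "(real \<Rightarrow> real) set" and N :: "(real \<Rightarrow> real) \<Rightarrow> real"
  assumes measurable: "X \<subseteq> borel_measurable unit_measure"
    and nonzero: "\<exists>x\<in>X. \<not> (AE t in unit_measure. x t = 0)"
    and add_mem: "\<And>x y. x \<in> X \<Longrightarrow> y \<in> X \<Longrightarrow> (\<lambda>t. x t + y t) \<in> X"
    and scale_mem: "\<And>c x. x \<in> X \<Longrightarrow> (\<lambda>t. c * x t) \<in> X"
    and norm_nonneg: "\<And>x. x \<in> X \<Longrightarrow> 0 \<le> N x"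
    and norm_eq_0_iff: "\<And>x. x \<in> X \<Longrightarrow> N x = 0 \<longleftrightarrow> (AE t in unit_measure. x t = 0)"
    and norm_triangle: "\<And>x y. x \<in> X \<Longrightarrow> y \<in> X \<Longrightarrow> N (\<lambda>t. x t + y t) \<le> N x + N y"
    and norm_scale: "\<And>c x. x \<in> X \<Longrightarrow> N (\<lambda>t. c * x t) = \<bar>c\<bar> * N x"
    and complete: "\<And>f :: nat \<Rightarrow> real \<Rightarrow> real. (\<And>n. f n \<in> X) \<Longrightarrow>
          (\<And>e. e > 0 \<Longrightarrow> \<exists>K. \<forall>m\<ge>K. \<forall>n\<ge>K. N (\<lambda>t. f m t - f n t) < e) \<Longrightarrow>
          \<exists>g\<in>X. (\<lambda>n. N (\<lambda>t. f n t - g t)) \<longlonglongrightarrow> 0"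
    and ideal_mem: "\<And>x y. y \<in> X \<Longrightarrow> x \<in> borel_measurable unit_measure \<Longrightarrow>
          (AE t in unit_measure. \<bar>x t\<bar> \<le> \<bar>y t\<bar>) \<Longrightarrow> x \<in> X"
    and ideal_norm: "\<And>x y. y \<in> X \<Longrightarrow> x \<in> borel_measurable unit_measure \<Longrightarrow>
          (AE t in unit_measure. \<bar>x t\<bar> \<le> \<bar>y t\<bar>) \<Longrightarrow> N x \<le> N y"
    and symmetric_mem: "\<And>x y. y \<in> X \<Longrightarrow> x \<in> borel_measurable unit_measure \<Longrightarrow>
          equimeasurable (\<lambda>t. \<bar>x t\<bar>) (\<lambda>t. \<bar>y t\<bar>) \<Longrightarrow> x \<in> X"
    and symmetric_norm: "\<And>x y. y \<in> X \<Longrightarrow> x \<in> borel_measurable unit_measure \<Longrightarrow>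
          equimeasurable (\<lambda>t. \<bar>x t\<bar>) (\<lambda>t. \<bar>y t\<bar>) \<Longrightarrow> N x = N y"

definition extended_norm :: "(real \<Rightarrow> real) set \<Rightarrow> ((real \<Rightarrow> real) \<Rightarrow> real) \<Rightarrow> (real \<Rightarrow> real) \<Rightarrow> ennreal" where
  "extended_norm X N f = (if f \<in> X then ennreal (N f) else \<infinity>)"

definition continuously_embedded ::
  "(real \<Rightarrow> real) set \<Rightarrow> ((real \<Rightarrow> real) \<Rightarrow> real) \<Rightarrow> (real \<Rightarrow> real) set \<Rightarrow> ((real \<Rightarrow> real) \<Rightarrow> real) \<Rightarrow> bool" where
  "continuously_embedded Y NY X NX \<longleftrightarrow> Y \<subseteq> X \<and> (\<exists>C>0. \<forall>x\<in>Y. NX x \<le> C * NY x)"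

definition L_infinity :: "(real \<Rightarrow> real) set" where
  "L_infinity = {x \<in> borel_measurable unit_measure. \<exists>C. AE t in unit_measure. \<bar>x t\<bar> \<le> C}"

definition orlicz_bounds :: "(real \<Rightarrow> real) \<Rightarrow> (real \<Rightarrow> real) \<Rightarrow> real set" where
  "orlicz_bounds M x = {l. l > 0 \<and> (\<integral>\<^sup>+ t. ennreal (M (\<bar>x t\<bar> / l)) \<partial>unit_measure) \<le> 1}"

definition orlicz_space :: "(real \<Rightarrow> real) \<Rightarrow> (real \<Rightarrow> real) set" where
  "orlicz_space M = {x \<in> borel_measurable unit_measure. orlicz_bounds M x \<noteq> {}}"

definition orlicz_norm :: "(real \<Rightarrow> real) \<Rightarrow> (real \<Rightarrow> real) \<Rightarrow> real" where
  "orlicz_norm M x = Inf (orlicz_bounds M x)"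

definition M_exp :: "real \<Rightarrow> real" where
  "M_exp t = exp t - 1"

definition H_space :: "(real \<Rightarrow> real) set" where
  "H_space = {x \<in> orlicz_space M_exp.
     \<forall>e>0. \<exists>y\<in>L_infinity. orlicz_norm M_exp (\<lambda>t. x t - y t) < e}"

(* Only indices k >= 1 are meant. *)
definition rademacher :: "nat \<Rightarrow> real \<Rightarrow> real" where
  "rademacher k t = sgn (sin (2 ^ (k - 1) * pi * t))"

definition chaos_index :: "(nat \<times> nat) set" where
  "chaos_index = {(i, j). 1 \<le> i \<and> i < j}"

definition chaos_fun :: "nat \<times> nat \<Rightarrow> real \<Rightarrow> real" where
  "chaos_fun p t = rademacher (fst p) t * rademacher (snd p) t"

definition chaos_ell2 :: "(nat \<times> nat \<Rightarrow> real) set" where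
  "chaos_ell2 = {a. (\<lambda>p. (a p)\<^sup>2) summable_on chaos_index}"

definition ell2_norm :: "(nat \<times> nat \<Rightarrow> real) \<Rightarrow> real" where
  "ell2_norm a = sqrt (\<Sum>\<^sub>\<infinity>p\<in>chaos_index. (a p)\<^sup>2)"

(* A representative of the L2-limit of the finite partial sums; it is unique up to null sets. *)
definition chaos_sum :: "(nat \<times> nat \<Rightarrow> real) \<Rightarrow> real \<Rightarrow> real" where
  "chaos_sum a = (SOME f. f \<in> borel_measurable unit_measure \<and>
     ((\<lambda>F. \<integral>\<^sup>+ t. ennreal (((\<Sum>p\<in>F. a p * chaos_fun p t) - f t)\<^sup>2) \<partial>unit_measure) \<longlongrightarrow> 0)
       (finite_subsets_at_top chaos_index))"

definition closed_span ::
  "(real \<Rightarrow> real) set \<Rightarrow> ((real \<Rightarrow> real) \<Rightarrow> real) \<Rightarrow> (nat \<Rightarrow> real \<Rightarrow> real) \<Rightarrow> (real \<Rightarrow> real) set" where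
  "closed_span X N e = {x \<in> X. \<forall>d>0. \<exists>n (c :: nat \<Rightarrow> real). N (\<lambda>t. x t - (\<Sum>k<n. c k * e k t)) < d}"

definition basic_sequence ::
  "(real \<Rightarrow> real) set \<Rightarrow> ((real \<Rightarrow> real) \<Rightarrow> real) \<Rightarrow> (nat \<Rightarrow> real \<Rightarrow> real) \<Rightarrow> bool" where
  "basic_sequence X N e \<longleftrightarrow> (\<forall>n. e n \<in> X) \<and>
     (\<forall>x\<in>closed_span X N e.
        \<exists>!c :: nat \<Rightarrow> real. (\<lambda>n. N (\<lambda>t. x t - (\<Sum>k<n. c k * e k t))) \<longlonglongrightarrow> 0)"

definition unconditional_basic_sequence ::
  "(real \<Rightarrow> real) set \<Rightarrow> ((real \<Rightarrow> real) \<Rightarrow> real) \<Rightarrow> (nat \<Rightarrow> real \<Rightarrow> real) \<Rightarrow> bool" where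
  "unconditional_basic_sequence X N e \<longleftrightarrow>
     (\<forall>\<pi> :: nat \<Rightarrow> nat. bij \<pi> \<longrightarrow> basic_sequence X N (\<lambda>n. e (\<pi> n)))"

lemma chaos_index_enumerable: "\<exists>\<phi> :: nat \<Rightarrow> nat \<times> nat. bij_betw \<phi> UNIV chaos_index"
proof -
  have "inj (\<lambda>n::nat. (1::nat, n + 2))"
    by (auto simp: inj_on_def)
  moreover have "range (\<lambda>n::nat. (1::nat, n + 2)) \<subseteq> chaos_index"
    by (auto simp: chaos_index_def)
  ultimately have "infinite chaos_index"
    by (meson finite_subset range_inj_infinite)
  then show ?thesis
    using bij_betw_from_nat_into[of chaos_index] by auto
qed

end

theory Submission
  imports Defs
begin

text \<open>
  Let \<open>f\<^sub>n = n\<^sup>-\<^sup>1 \<Sum> r\<^sub>i r\<^sub>j\<close>, the sum over \<open>i \<in> I\<close>, \<open>j \<in> J\<close> with disjoint blocks of size \<open>n = 4\<^sup>q\<close>. Everything hinges on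
  whether the norms of the \<open>f\<^sub>n\<close> in \<open>X\<close> are bounded. They have exponential lower tails
  \<open>P(f\<^sub>n \<ge> c s) \<ge> e\<^bsup>-C s\<^esup>\<close> for \<open>s \<le> n\<close>, because a Rademacher sum over \<open>n\<close> terms splits into independent
  sums over blocks; so if their norms are bounded, comparison of distribution functions bounds the norm in \<open>X\<close> of
  bounded functions by their norm in \<open>L\<^sub>M\<close>, and completeness gives \<open>H \<subseteq> X\<close>. Conversely, hypercontractivity
  bounds the \<open>L\<^sub>M\<close> norm of a chaos by the \<open>\<ell>\<^sub>2\<close> norm of its coefficients, and a Paley-Zygmund estimate gives
  the lower bound in every symmetric space; the two bounds also make the system an unconditional basic sequence.

  If the system is unconditional, a gliding hump argument bounds \<open>f\<^sub>n\<close> by a constant multiple of the norm of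
  \<open>g\<^sub>n = n\<^sup>-\<^sup>1 \<Sum> w\<^sub>i\<^sub>j r\<^sub>i r\<^sub>j\<close> with \<open>w\<close> a Hadamard matrix. Given the signs in one block, \<open>g\<^sub>n\<close> is a
  Rademacher sum with \<open>\<ell>\<^sub>2\<close> norm 1, so \<open>g\<^sub>n\<close> has Gaussian tails, and \<open>\<bar>g\<^sub>n\<bar> \<le> \<surd>n\<close>. Its norm is then controlled
  by the fundamental function of \<open>X\<close>, hence by the norms of \<open>f\<^sub>m\<close>, \<open>m < n\<close>, and a discrete Gronwall argument bounds
  all of them.
\<close>

section \<open>Rademacher functions\<close>

text \<open>Independence enters only through translations: moving t by
  \<open>1 / 2 ^ (i - 1)\<close> reverses r_i and fixes every later r_j. Averaging over r_i
  therefore needs only the translation invariance of Lebesgue measure, and the inductions on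
  expectations remove the smallest index first.

  The obstacle in the unconditional direction is that no norm in X is known in advance, so
  \<open>f_n\<close> can only be compared with its smaller copies. \<open>f_n\<close> itself reaches
  n, which is too high for such a comparison; the Hadamard signs reduce the maximum to sqrt n. For n
  = \<open>4 ^ q\<close> the layer of \<open>g_n\<close> at height \<open>2 ^ k\<close>, k < q, has
  measure at most 4 to the power -m with m = \<open>4 ^ (k - 1)\<close>, and on a set of at least
  this measure \<open>f_m\<close> reaches m. The layer thus costs at most
  \<open>2 ^ (k + 1) / m\<close> times the norm of \<open>f_m\<close>, that is, a weight
  \<open>4 / 2 ^ (k - 1)\<close>. These weights are summable, so the Gronwall constant does not
  depend on q. Powers of 4 are used because n is then the order of a Sylvester matrix and sqrt n is
  a power of 2.\<close>

abbreviation expectation :: "(real \<Rightarrow> real) \<Rightarrow> real" where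
  "expectation f \<equiv> integral\<^sup>L unit_measure f"

abbreviation prob :: "(real \<Rightarrow> bool) \<Rightarrow> real" where
  "prob P \<equiv> measure unit_measure {t \<in> {0..1}. P t}"

lemma finite_unit: "finite_measure unit_measure"
  by (intro finite_measure_lebesgue_on) auto

lemma space_unit [simp]: "space unit_measure = {0..1}"
  by simp

lemma measure_unit_space [simp]: "measure unit_measure {0..1} = 1"
  by (simp add: measure_restrict_space)

lemma emeasure_unit_eq: "emeasure unit_measure A = ennreal (measure unit_measure A)"
  using finite_unit by (simp add: finite_measure.emeasure_eq_measure)

lemma expectation_const [simp]: "expectation (\<lambda>_. c) = c"
  by (simp add: measure_restrict_space)

lemma simple_borel_unit:
  fixes f :: "real \<Rightarrow> real"
  assumes "simple_function borel f"
  shows "f \<in> borel_measurable unit_measure"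
proof -
  have "f \<in> borel_measurable borel"
    using assms by (rule borel_measurable_simple_function)
  then show ?thesis
    by (simp add: measurable_completion measurable_restrict_space1)
qed

lemma integrable_bounded_unit:
  fixes f :: "real \<Rightarrow> real"
  assumes "f \<in> borel_measurable unit_measure" "\<And>t. \<bar>f t\<bar> \<le> B"
  shows "integrable unit_measure f"
  using finite_unit assms
  by (intro finite_measure.integrable_const_bound[where B = B]) auto

lemma simple_bounded:
  fixes f :: "real \<Rightarrow> real"
  assumes "simple_function borel f"
  obtains B where "\<And>t. \<bar>f t\<bar> \<le> B"
proof -
  have "finite (range f)"
    using assms by (simp add: simple_function_def)
  then have "bounded (range f)"
    by (rule finite_imp_bounded)
  then show ?thesis
    using that by (auto simp: bounded_iff)
qed

lemma integrable_simple_unit: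
  fixes f :: "real \<Rightarrow> real"
  assumes "simple_function borel f"
  shows "integrable unit_measure f"
  using assms simple_bounded simple_borel_unit integrable_bounded_unit by metis

text \<open>The range is finite, so the preimage of every set is measurable and \<open>P\<close> may
  be arbitrary.\<close>

lemma measurable_pred_unit [measurable]:
  assumes "simple_function borel f"
  shows "{t \<in> {0..1}. P (f t)} \<in> sets unit_measure"
proof -
  have "f -` {x. P x} \<inter> space borel \<in> sets borel"
    using assms by (rule simple_functionD)
  then have "{t. P (f t)} \<in> sets borel"
    by (simp add: vimage_def)
  then have "{t. P (f t)} \<in> sets lebesgue"
    by auto
  then have "{0..1} \<inter> {t. P (f t)} \<in> sets unit_measure"
    by (auto simp: sets_restrict_space)
  then show ?thesis
    by (simp add: Int_def)
qed

lemma prob_eq_expectation: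
  assumes "simple_function borel f"
  shows "prob (\<lambda>t. P (f t)) = expectation (\<lambda>t. of_bool (P (f t)))"
proof -
  have "expectation (\<lambda>t. of_bool (P (f t))) = expectation (indicator {t \<in> {0..1}. P (f t)})"
    by (intro Bochner_Integration.integral_cong) (auto simp: indicator_def)
  moreover have "{t \<in> {0..1}. P (f t)} \<inter> {0..1} = {t \<in> {0..1}. P (f t)}"
    by auto
  ultimately show ?thesis
    using measurable_pred_unit[OF assms, of P] finite_unit
    by (simp only: integral_indicator space_unit) (simp add: emeasure_unit_eq)
qed

lemma expectation_lborel:
  fixes g :: "real \<Rightarrow> real"
  assumes "g \<in> borel_measurable borel"
  shows "expectation g = (\<integral>t. indicator {0..1} t * g t \<partial>lborel)"
proof -
  have "expectation g = (\<integral>t. indicator {0..1} t * g t \<partial>lebesgue)"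
    by (simp add: integral_restrict_space)
  also have "\<dots> = (\<integral>t. indicator {0..1} t * g t \<partial>lborel)"
    using assms by (intro integral_completion) auto
  finally show ?thesis .
qed

text \<open>The translation turns the window \<open>{0..1}\<close> into \<open>{h..1+h}\<close>, and
  periodicity brings the piece beyond 1 back to \<open>{0..h}\<close>. The detour through
  \<open>lborel\<close> makes the affine substitution available.\<close>

lemma expectation_shift:
  fixes g :: "real \<Rightarrow> real"
  assumes g: "simple_function borel g" and per: "\<And>t. g (t + 1) = g t" and h: "0 \<le> h" "h \<le> 1"
  shows "expectation (\<lambda>t. g (t + h)) = expectation g"
proof -
  have m [measurable]: "g \<in> borel_measurable borel"
    using g by (rule borel_measurable_simple_function)
  obtain B where B: "\<And>t. \<bar>g t\<bar> \<le> B"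
    using simple_bounded[OF g] by blast
  have int: "integrable lborel (\<lambda>t. indicator {a..b} t * g t)" for a b
  proof (rule Bochner_Integration.integrable_bound)
    show "integrable lborel (\<lambda>t. B * indicator {a..b} t :: real)"
      by (intro integrable_mult_right integrable_real_indicator) (auto simp: emeasure_lborel_Icc_eq)
    show "AE t in lborel. norm (indicator {a..b} t * g t) \<le> norm (B * indicator {a..b} t)"
      using B by (auto simp: indicator_def intro!: AE_I2 order_trans[OF B])
  qed simp
  have "expectation (\<lambda>t. g (t + h)) = (\<integral>t. indicator {0..1} t * g (t + h) \<partial>lborel)"
    by (intro expectation_lborel) simp
  also have "\<dots> = (\<integral>t. indicator {0..1} (t - h) * g t \<partial>lborel)"
    using lborel_integral_real_affine[of 1 "\<lambda>t. indicator {0..1} (t - h) * g t" h]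
    by (simp add: add.commute)
  also have "\<dots> = (\<integral>t. indicator {h..1} t * g t + indicator {1..1+h} t * g t \<partial>lborel)"
    using h AE_lborel_singleton[of "1::real"]
    by (intro integral_cong_AE) (auto simp: indicator_def)
  also have "\<dots> = (\<integral>t. indicator {h..1} t * g t \<partial>lborel) + (\<integral>t. indicator {1..1+h} t * g t \<partial>lborel)"
    by (intro Bochner_Integration.integral_add int)
  also have "(\<integral>t. indicator {1..1+h} t * g t \<partial>lborel) = (\<integral>t. indicator {0..h} t * g t \<partial>lborel)"
  proof -
    have "(\<integral>t. indicator {1..1+h} t * g t \<partial>lborel)
        = (\<integral>t. indicator {1..1+h} (1 + t) * g (1 + t) \<partial>lborel)"
      using lborel_integral_real_affine[of 1 "\<lambda>t. indicator {1..1+h} t * g t" 1] by simp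
    also have "\<dots> = (\<integral>t. indicator {0..h} t * g t \<partial>lborel)"
      by (intro Bochner_Integration.integral_cong)
         (auto simp: indicator_def per add.commute[of 1])
    finally show ?thesis .
  qed
  also have "(\<integral>t. indicator {h..1} t * g t \<partial>lborel) + (\<integral>t. indicator {0..h} t * g t \<partial>lborel)
      = (\<integral>t. indicator {h..1} t * g t + indicator {0..h} t * g t \<partial>lborel)"
    by (intro Bochner_Integration.integral_add[symmetric] int)
  also have "\<dots> = (\<integral>t. indicator {0..1} t * g t \<partial>lborel)"
    using h AE_lborel_singleton[of h]
    by (intro integral_cong_AE) (auto simp: indicator_def)
  also have "\<dots> = expectation g"
    by (intro expectation_lborel[symmetric]) simp
  finally show ?thesis .
qed

section \<open>Signs and translations of the Rademacher functions\<close>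

lemma rademacher_simple: "simple_function borel (rademacher k)"
proof -
  have "rademacher k \<in> borel_measurable borel"
    unfolding rademacher_def by measurable
  moreover have "finite (range (rademacher k))"
    by (rule finite_subset[of _ "{-1, 0, 1}"]) (auto simp: rademacher_def sgn_if)
  ultimately show ?thesis
    by (intro simple_function_borel_measurable) auto
qed

lemma abs_rademacher_le_1: "\<bar>rademacher k t\<bar> \<le> 1"
  by (simp add: rademacher_def sgn_if)

text \<open>The argument of the sine grows by exactly pi; for a later index, below, it grows by a
  multiple of 2 pi. These two facts carry all independence arguments.\<close>

lemma rademacher_shift_self:
  assumes "1 \<le> k"
  shows "rademacher k (t + 1 / 2 ^ (k - 1)) = - rademacher k t"
proof -
  have "2 ^ (k - 1) * pi * (t + 1 / 2 ^ (k - 1)) = 2 ^ (k - 1) * pi * t + pi"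
    by (simp add: field_simps)
  then show ?thesis
    by (simp add: rademacher_def sgn_minus)
qed

lemma rademacher_shift_later:
  assumes "1 \<le> i" "i < j"
  shows "rademacher j (t + 1 / 2 ^ (i - 1)) = rademacher j t"
proof -
  obtain d where d: "j - 1 = (i - 1) + Suc d"
    using assms by (metis add_Suc_right add_diff_inverse_nat diff_is_0_eq' diff_less_mono
        le_add1 le_add_diff_inverse less_eq_Suc_le less_imp_Suc_add plus_1_eq_Suc)
  have "2 ^ (j - 1) * pi * (t + 1 / 2 ^ (i - 1)) = 2 ^ (j - 1) * pi * t + 2 * pi * of_int (2 ^ d)"
    unfolding d by (simp add: field_simps power_add)
  then have "sin (2 ^ (j - 1) * pi * (t + 1 / 2 ^ (i - 1))) = sin (2 ^ (j - 1) * pi * t)"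
    using sin_int_2pin[of "2 ^ d"] cos_int_2pin[of "2 ^ d"] by (simp only: sin_add)
  then show ?thesis
    by (simp add: rademacher_def)
qed

text \<open>\<open>rademacher 1\<close> has period 2 and changes sign under t + 1; this is why
  averaging over a sign is done for indices from 2 on.\<close>

lemma rademacher_period: "2 \<le> k \<Longrightarrow> rademacher k (t + 1) = rademacher k t"
  using rademacher_shift_later[of 1 k t] by simp

lemma AE_rademacher_nonzero: "AE t in unit_measure. rademacher k t \<noteq> 0"
proof -
  have "{t. rademacher k t = 0} \<subseteq> (\<lambda>i. of_int i / 2 ^ (k - 1)) ` (UNIV :: int set)"
    by (auto simp: rademacher_def sgn_zero_iff sin_zero_iff_int2 field_simps)
  then have "countable {t. rademacher k t = 0}"
    by (rule countable_subset) auto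
  then have "{t. rademacher k t = 0} \<in> null_sets lebesgue"
    using countable_imp_null_set_lborel null_sets_completionI by blast
  then have "AE t in lebesgue. rademacher k t \<noteq> 0"
    by (metis (mono_tags, lifting) AE_not_in eventually_mono mem_Collect_eq)
  then show ?thesis
    by (auto simp: AE_restrict_space_iff elim: eventually_mono)
qed

lemma AE_rademacher_sign: "AE t in unit_measure. rademacher k t = 1 \<or> rademacher k t = -1"
  using AE_rademacher_nonzero[of k]
  by eventually_elim (auto simp: rademacher_def sgn_if)

lemma AE_rademacher_1: "AE t in unit_measure. rademacher 1 t = 1"
proof -
  have "rademacher 1 t = 1" if "t \<in> {0..1}" "rademacher 1 t \<noteq> 0" for t
  proof -
    have "0 \<le> sin (pi * t)"
      using that by (intro sin_ge_zero) auto
    then show ?thesis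
      using that by (auto simp: rademacher_def sgn_if)
  qed
  then show ?thesis
    using AE_rademacher_nonzero[of 1]
    by (auto intro: AE_mp[OF AE_rademacher_nonzero[of 1]] AE_I2)
qed

text \<open>A substitute for "depends only on signs after r_i": invariance under the translation
  that reverses r_i. Simplicity is built in so that integrability is automatic, and the codomain is
  left general so that tuples of such functions can be composed with any function.\<close>

definition shift_inv :: "nat \<Rightarrow> (real \<Rightarrow> 'a) \<Rightarrow> bool" where
  "shift_inv i f \<longleftrightarrow> simple_function borel f \<and> (\<forall>t. f (t + 1 / 2 ^ (i - 1)) = f t)"

lemma shift_inv_simple: "shift_inv i f \<Longrightarrow> simple_function borel f"
  by (simp add: shift_inv_def)

lemma shift_inv_const: "shift_inv i (\<lambda>_. c)"
  by (simp add: shift_inv_def)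

lemma shift_inv_compose: "shift_inv i f \<Longrightarrow> shift_inv i (\<lambda>t. F (f t))"
  by (auto simp: shift_inv_def intro: simple_function_compose1)

lemma shift_inv_compose2: "shift_inv i f \<Longrightarrow> shift_inv i g \<Longrightarrow> shift_inv i (\<lambda>t. F (f t) (g t))"
  by (auto simp: shift_inv_def intro: simple_function_compose2)

lemma shift_inv_rademacher: "1 \<le> i \<Longrightarrow> i < j \<Longrightarrow> shift_inv i (rademacher j)"
  using rademacher_shift_later[of i j] by (simp add: shift_inv_def rademacher_simple)

lemma shift_inv_sum:
  fixes f :: "'b \<Rightarrow> real \<Rightarrow> real"
  assumes "\<And>a. a \<in> A \<Longrightarrow> shift_inv i (f a)"
  shows "shift_inv i (\<lambda>t. \<Sum>a\<in>A. f a t)"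
  using assms
  by (induction A rule: infinite_finite_induct)
     (auto intro: shift_inv_const shift_inv_compose2[where F = "(+)"])

lemma shift_inv_period:
  assumes "shift_inv i f"
  shows "f (t + 1) = f t"
proof -
  have "f (t + real m * (1 / 2 ^ (i - 1))) = f t" for m
  proof (induction m)
    case (Suc m)
    have "t + real (Suc m) * (1 / 2 ^ (i - 1)) = (t + real m * (1 / 2 ^ (i - 1))) + 1 / 2 ^ (i - 1)"
      by (simp add: field_simps)
    then show ?case
      using Suc assms unfolding shift_inv_def by metis
  qed simp
  from this[of "2 ^ (i - 1)"] show ?thesis
    by simp
qed

text \<open>The translation by \<open>1 / 2 ^ (i - 1)\<close> reverses the integrand but preserves
  its integral.\<close>

lemma expectation_rademacher_mult:
  fixes f :: "real \<Rightarrow> real"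
  assumes "2 \<le> i" "shift_inv i f"
  shows "expectation (\<lambda>t. rademacher i t * f t) = 0"
proof -
  let ?g = "\<lambda>t. rademacher i t * f t"
  have "expectation (\<lambda>t. ?g (t + 1 / 2 ^ (i - 1))) = expectation ?g"
  proof (rule expectation_shift)
    show "simple_function borel ?g"
      using assms by (intro simple_function_mult rademacher_simple shift_inv_simple)
    show "?g (t + 1) = ?g t" for t
      using assms by (simp add: rademacher_period shift_inv_period)
  qed (auto simp: divide_le_eq)
  moreover have "?g (t + 1 / 2 ^ (i - 1)) = - ?g t" for t
    using assms rademacher_shift_self[of i t] by (simp add: shift_inv_def)
  ultimately show ?thesis
    by simp
qed

text \<open>Integration over the sign r_i alone. On signs r, \<open>F r\<close> equals
  \<open>(F 1 + F (-1)) / 2 + r * (F 1 - F (-1)) / 2\<close>, and the second term has mean 0.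
  Measurability is assumed separately because \<open>F\<close> is unrestricted at the null set where
  r_i = 0.\<close>

lemma expectation_average:
  fixes F :: "real \<Rightarrow> real \<Rightarrow> real"
  assumes i: "2 \<le> i" and F: "shift_inv i (F 1)" "shift_inv i (F (-1))"
    and meas: "(\<lambda>t. F (rademacher i t) t) \<in> borel_measurable unit_measure"
  shows "expectation (\<lambda>t. F (rademacher i t) t) = (expectation (F 1) + expectation (F (-1))) / 2"
proof -
  note s = F[THEN shift_inv_simple] rademacher_simple[of i]
  note m = s[THEN simple_borel_unit]
  have d: "shift_inv i (\<lambda>t. F 1 t - F (-1) t)"
    using F by (rule shift_inv_compose2)
  have "expectation (\<lambda>t. F (rademacher i t) t)
      = expectation (\<lambda>t. (F 1 t + F (-1) t) / 2 + rademacher i t * (F 1 t - F (-1) t) / 2)"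
  proof (rule integral_cong_AE[OF meas])
    show "AE t in unit_measure. F (rademacher i t) t
        = (F 1 t + F (-1) t) / 2 + rademacher i t * (F 1 t - F (-1) t) / 2"
      using AE_rademacher_sign[of i] by eventually_elim (auto simp: field_simps)
  qed (use m in measurable)
  also have "\<dots> = expectation (\<lambda>t. (F 1 t + F (-1) t) / 2)
      + expectation (\<lambda>t. rademacher i t * (F 1 t - F (-1) t)) / 2"
    using s by (subst Bochner_Integration.integral_add)
      (auto intro!: integrable_simple_unit Bochner_Integration.integrable_add
         simple_function_mult simple_function_diff)
  also have "expectation (\<lambda>t. rademacher i t * (F 1 t - F (-1) t)) = 0"
    using i d by (rule expectation_rademacher_mult)
  finally show ?thesis
    using s by (simp add: integrable_simple_unit)
qed

section \<open>Moments of Rademacher polynomials\<close>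

text \<open>From l to l + 1 the left side is multiplied by (m - l)/(l + 1) times (2m - 2l - 1)/(2l +
  1), the right side by (m - l)/(l + 1) times 2m - 1.\<close>

lemma binomial_double_le:
  assumes "l \<le> m"
  shows "real (2 * m choose (2 * l)) \<le> real (m choose l) * (2 * real m - 1) ^ l"
  using assms
proof (induction l)
  case (Suc l)
  have e: "real (Suc k) * real (n choose Suc k) = (real n - real k) * real (n choose k)"
    if "k \<le> n" for n k
    using binomial_absorption[of k n] binomial_absorb_comp[of n k] that
    by (metis of_nat_diff of_nat_mult)
  have e1: "(2 * real l + 1) * real (2 * m choose (2 * l + 1))
      = (2 * real m - 2 * real l) * real (2 * m choose (2 * l))"
    using e[of "2 * l" "2 * m"] Suc.prems by (simp add: algebra_simps)
  have e2: "(2 * real l + 2) * real (2 * m choose (2 * l + 2))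
      = (2 * real m - 2 * real l - 1) * real (2 * m choose (2 * l + 1))"
    using e[of "2 * l + 1" "2 * m"] Suc.prems by (simp add: algebra_simps)
  have e3: "(real l + 1) * real (m choose Suc l) = (real m - real l) * real (m choose l)"
    using e[of l m] Suc.prems by (simp add: algebra_simps)
  have ml: "real l + 1 \<le> real m"
    using Suc.prems by linarith
  have "(2 * real l + 1) * ((2 * real l + 2) * real (2 * m choose (2 * l + 2)))
      = (2 * real m - 2 * real l - 1) * ((2 * real m - 2 * real l) * real (2 * m choose (2 * l)))"
    by (simp only: e1[symmetric] e2) (simp add: mult_ac)
  also have "\<dots> \<le> ((2 * real l + 1) * (2 * real m - 1)) *
      ((2 * real m - 2 * real l) * (real (m choose l) * (2 * real m - 1) ^ l))"
  proof (intro mult_mono)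
    have "0 \<le> real l * (4 * real m)"
      by simp
    then show "2 * real m - 2 * real l - 1 \<le> (2 * real l + 1) * (2 * real m - 1)"
      by (simp add: algebra_simps)
  qed (use Suc ml in \<open>auto intro!: mult_nonneg_nonneg\<close>)
  also have "\<dots> = (2 * real l + 1) * (2 * (((real m - real l) * real (m choose l)) * (2 * real m - 1) ^ Suc l))"
    by (simp add: algebra_simps)
  also have "\<dots> = (2 * real l + 1) * ((2 * real l + 2) * (real (m choose Suc l) * (2 * real m - 1) ^ Suc l))"
    by (simp only: e3[symmetric]) (simp add: algebra_simps)
  finally have "(2 * real l + 1) * ((2 * real l + 2) * real (2 * m choose (2 * l + 2)))
      \<le> (2 * real l + 1) * ((2 * real l + 2) * (real (m choose Suc l) * (2 * real m - 1) ^ Suc l))" .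
  then show ?case
    by (simp add: mult_le_cancel_left_pos)
qed simp

text \<open>The two-point case of hypercontractivity from L2 to L2m. Odd powers of \<open>y\<close>
  cancel, and the even ones are compared term by term with the binomial expansion of the right
  side.\<close>

lemma two_point_inequality:
  fixes x y :: real
  assumes "1 \<le> m"
  shows "(x + y) ^ (2 * m) + (x - y) ^ (2 * m) \<le> 2 * (x\<^sup>2 + (2 * real m - 1) * y\<^sup>2) ^ m"
proof -
  have even_terms: "(\<Sum>k\<le>2 * n. f k) = (\<Sum>l\<le>n. f (2 * l))" if "\<And>k. odd k \<Longrightarrow> f k = 0"
    for f :: "nat \<Rightarrow> real" and n
    by (induction n) (simp_all add: that)
  have "(x + y) ^ (2 * m) + (x - y) ^ (2 * m)
      = (\<Sum>k\<le>2 * m. real (2 * m choose k) * (y ^ k + (- y) ^ k) * x ^ (2 * m - k))"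
    using binomial_ring[of y x "2 * m"] binomial_ring[of "-y" x "2 * m"]
    by (simp add: sum.distrib algebra_simps)
  also have "\<dots> = (\<Sum>l\<le>m. real (2 * m choose (2 * l)) * (y ^ (2 * l) + (- y) ^ (2 * l)) * x ^ (2 * m - 2 * l))"
    by (rule even_terms) simp
  also have "\<dots> = 2 * (\<Sum>l\<le>m. real (2 * m choose (2 * l)) * ((y\<^sup>2) ^ l * (x\<^sup>2) ^ (m - l)))"
    by (simp only: sum_distrib_left power_mult power2_minus diff_mult_distrib2[symmetric])
       (simp add: mult_ac)
  also have "\<dots> \<le> 2 * (\<Sum>l\<le>m. real (m choose l) * (2 * real m - 1) ^ l * ((y\<^sup>2) ^ l * (x\<^sup>2) ^ (m - l)))"
    by (intro mult_left_mono sum_mono mult_right_mono binomial_double_le) auto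
  also have "\<dots> = 2 * ((2 * real m - 1) * y\<^sup>2 + x\<^sup>2) ^ m"
    by (simp add: binomial_ring power_mult_distrib mult_ac)
  finally show ?thesis
    by (simp add: add.commute)
qed

lemma convex_on_power_nonneg: "convex_on {0::real..} (\<lambda>x. x ^ m)"
proof (cases "even m")
  case True
  then show ?thesis
    by (rule convex_on_subset[OF convex_power_even]) auto
qed (rule convex_power_odd)

lemma power_convex_combination:
  fixes a b x y :: real
  assumes "a + b = 1" "0 \<le> a" "0 \<le> b" "0 \<le> x" "0 \<le> y"
  shows "(a * x + b * y) ^ m \<le> a * x ^ m + b * y ^ m"
proof -
  have a: "a = 1 - b"
    using assms by simp
  show ?thesis
    using convex_onD[OF convex_on_power_nonneg, of b x y m] assms unfolding a by simp
qed

text \<open>Minkowski's inequality in L_m, in a form free of roots: after normalisation it is the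
  convexity of the m-th power.\<close>

lemma expectation_add_power_le:
  fixes u v :: "real \<Rightarrow> real"
  assumes s: "simple_function borel u" "simple_function borel v"
    and nonneg: "\<And>t. 0 \<le> u t" "\<And>t. 0 \<le> v t" "0 \<le> A" "0 \<le> B"
    and u: "expectation (\<lambda>t. u t ^ m) \<le> A ^ m" and v: "expectation (\<lambda>t. v t ^ m) \<le> B ^ m"
  shows "expectation (\<lambda>t. (u t + v t) ^ m) \<le> (A + B) ^ m"
proof -
  have int: "integrable unit_measure (\<lambda>t. F (u t) (v t))" for F :: "real \<Rightarrow> real \<Rightarrow> real"
    using s by (rule integrable_simple_unit[OF simple_function_compose2])
  \<comment> \<open>\<open>A\<close> and \<open>B\<close> may vanish, so the division by them is
    done for slightly larger values, which then tend to \<open>A\<close> and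
    \<open>B\<close>.\<close>
  have pos: "expectation (\<lambda>t. (u t + v t) ^ m) \<le> (A' + B') ^ m"
    if "A < A'" "B < B'" for A' B'
  proof -
    have p: "0 < A'" "0 < B'"
      using that nonneg by auto
    let ?a = "A' / (A' + B')" and ?b = "B' / (A' + B')"
    have ab: "?a + ?b = 1" "0 \<le> ?a" "0 \<le> ?b"
      using p by (auto simp: add_divide_distrib[symmetric])
    have ptw: "(u t + v t) ^ m \<le> (A' + B') ^ m * (?a * (u t ^ m / A' ^ m) + ?b * (v t ^ m / B' ^ m))" for t
    proof -
      have "(u t + v t) ^ m = (A' + B') ^ m * (?a * (u t / A') + ?b * (v t / B')) ^ m"
        using p by (simp add: power_mult_distrib[symmetric] add_divide_distrib[symmetric])
      also have "(?a * (u t / A') + ?b * (v t / B')) ^ m \<le> ?a * (u t / A') ^ m + ?b * (v t / B') ^ m"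
        using ab p nonneg by (intro power_convex_combination) auto
      finally show ?thesis
        using p by (simp add: power_divide mult_left_mono)
    qed
    have "expectation (\<lambda>t. (u t + v t) ^ m)
        \<le> expectation (\<lambda>t. (A' + B') ^ m * (?a * (u t ^ m / A' ^ m) + ?b * (v t ^ m / B' ^ m)))"
      using ptw by (intro integral_mono int[where F = "\<lambda>x y. (x + y) ^ m"]
          int[where F = "\<lambda>x y. (A' + B') ^ m * (?a * (x ^ m / A' ^ m) + ?b * (y ^ m / B' ^ m))"])
    also have "\<dots> = (A' + B') ^ m * (?a * (expectation (\<lambda>t. u t ^ m) / A' ^ m)
        + ?b * (expectation (\<lambda>t. v t ^ m) / B' ^ m))"
      using int[where F = "\<lambda>x y. x ^ m"] int[where F = "\<lambda>x y. y ^ m"]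
      by (simp del: times_divide_eq_right times_divide_eq_left add: divide_inverse)
    also have "\<dots> \<le> (A' + B') ^ m * (?a * 1 + ?b * 1)"
    proof (intro mult_left_mono add_mono)
      show "expectation (\<lambda>t. u t ^ m) / A' ^ m \<le> 1"
        using u power_mono[of A A' m] that nonneg p by (simp add: divide_le_eq)
      show "expectation (\<lambda>t. v t ^ m) / B' ^ m \<le> 1"
        using v power_mono[of B B' m] that nonneg p by (simp add: divide_le_eq)
    qed (use p in auto)
    finally show ?thesis
      using ab by simp
  qed
  have "((\<lambda>e. ((A + e) + (B + e)) ^ m) \<longlongrightarrow> ((A + 0) + (B + 0)) ^ m) (at_right 0)"
    by (intro tendsto_intros)
  moreover have "\<forall>\<^sub>F e in at_right (0::real). expectation (\<lambda>t. (u t + v t) ^ m) \<le> ((A + e) + (B + e)) ^ m"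
    using eventually_at_right_less[of "0::real"] by eventually_elim (rule pos; simp)
  ultimately have "expectation (\<lambda>t. (u t + v t) ^ m) \<le> ((A + 0) + (B + 0)) ^ m"
    by (rule tendsto_lowerbound) simp
  then show ?thesis
    by simp
qed

text \<open>The induction step of hypercontractivity: the two-point inequality averages out r_i, and
  Minkowski is applied to g^2 and (2m - 1) h^2. Keeping both bounds as m-th powers makes the steps
  chain without roots.\<close>

lemma expectation_rademacher_power_le:
  assumes i: "2 \<le> i" and inv: "shift_inv i g" "shift_inv i h" and m: "1 \<le> m"
    and nonneg: "0 \<le> A" "0 \<le> B"
    and g: "expectation (\<lambda>t. g t ^ (2 * m)) \<le> A ^ m"
    and h: "(2 * real m - 1) ^ m * expectation (\<lambda>t. h t ^ (2 * m)) \<le> B ^ m"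
  shows "expectation (\<lambda>t. (g t + rademacher i t * h t) ^ (2 * m)) \<le> (A + B) ^ m"
proof -
  note s = inv[THEN shift_inv_simple]
  have int: "integrable unit_measure (\<lambda>t. F (g t) (h t))" for F :: "real \<Rightarrow> real \<Rightarrow> real"
    using s by (rule integrable_simple_unit[OF simple_function_compose2])
  have "expectation (\<lambda>t. (g t + rademacher i t * h t) ^ (2 * m))
      = (expectation (\<lambda>t. (g t + 1 * h t) ^ (2 * m)) + expectation (\<lambda>t. (g t + (-1) * h t) ^ (2 * m))) / 2"
  proof (rule expectation_average[where F = "\<lambda>r t. (g t + r * h t) ^ (2 * m)", OF i])
    show "shift_inv i (\<lambda>t. (g t + 1 * h t) ^ (2 * m))" "shift_inv i (\<lambda>t. (g t + (-1) * h t) ^ (2 * m))"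
      using inv by (rule shift_inv_compose2)+
    show "(\<lambda>t. (g t + rademacher i t * h t) ^ (2 * m)) \<in> borel_measurable unit_measure"
      using s[THEN simple_borel_unit] simple_borel_unit[OF rademacher_simple[of i]] by measurable
  qed
  also have "\<dots> = expectation (\<lambda>t. ((g t + h t) ^ (2 * m) + (g t - h t) ^ (2 * m)) / 2)"
    using int[where F = "\<lambda>x y. (x + y) ^ (2 * m)"] int[where F = "\<lambda>x y. (x - y) ^ (2 * m)"]
    by simp
  also have "\<dots> \<le> expectation (\<lambda>t. ((g t)\<^sup>2 + (2 * real m - 1) * (h t)\<^sup>2) ^ m)"
    using two_point_inequality[OF m]
    by (intro integral_mono int[where F = "\<lambda>x y. ((x + y) ^ (2 * m) + (x - y) ^ (2 * m)) / 2"]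
         int[where F = "\<lambda>x y. (x\<^sup>2 + (2 * real m - 1) * y\<^sup>2) ^ m"]) (simp add: field_simps)
  also have "\<dots> \<le> (A + B) ^ m"
  proof (rule expectation_add_power_le)
    show "simple_function borel (\<lambda>t. (g t)\<^sup>2)" "simple_function borel (\<lambda>t. (2 * real m - 1) * (h t)\<^sup>2)"
      by (rule simple_function_compose1, rule s)+
    show "expectation (\<lambda>t. ((2 * real m - 1) * (h t)\<^sup>2) ^ m) \<le> B ^ m"
      using h by (simp add: power_mult_distrib power_mult[symmetric])
  qed (use m nonneg g in \<open>auto simp: power_mult[symmetric]\<close>)
  finally show ?thesis .
qed

lemma expectation_rademacher_square:
  assumes i: "2 \<le> i" and inv: "shift_inv i g" "shift_inv i h"
  shows "expectation (\<lambda>t. (g t + rademacher i t * h t)\<^sup>2)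
    = expectation (\<lambda>t. (g t)\<^sup>2) + expectation (\<lambda>t. (h t)\<^sup>2)"
proof -
  note s = inv[THEN shift_inv_simple]
  have int: "integrable unit_measure (\<lambda>t. F (g t) (h t))" for F :: "real \<Rightarrow> real \<Rightarrow> real"
    using s by (rule integrable_simple_unit[OF simple_function_compose2])
  have "expectation (\<lambda>t. (g t + rademacher i t * h t)\<^sup>2)
      = (expectation (\<lambda>t. (g t + 1 * h t)\<^sup>2) + expectation (\<lambda>t. (g t + (-1) * h t)\<^sup>2)) / 2"
  proof (rule expectation_average[where F = "\<lambda>r t. (g t + r * h t)\<^sup>2", OF i])
    show "shift_inv i (\<lambda>t. (g t + 1 * h t)\<^sup>2)" "shift_inv i (\<lambda>t. (g t + (-1) * h t)\<^sup>2)"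
      using inv by (rule shift_inv_compose2)+
    show "(\<lambda>t. (g t + rademacher i t * h t)\<^sup>2) \<in> borel_measurable unit_measure"
      using s[THEN simple_borel_unit] simple_borel_unit[OF rademacher_simple[of i]] by measurable
  qed
  also have "\<dots> = expectation (\<lambda>t. ((g t + h t)\<^sup>2 + (g t - h t)\<^sup>2) / 2)"
    using int[where F = "\<lambda>x y. (x + y)\<^sup>2"] int[where F = "\<lambda>x y. (x - y)\<^sup>2"] by simp
  also have "\<dots> = expectation (\<lambda>t. (g t)\<^sup>2 + (h t)\<^sup>2)"
    by (intro Bochner_Integration.integral_cong) (simp_all add: power2_eq_square field_simps)
  also have "\<dots> = expectation (\<lambda>t. (g t)\<^sup>2) + expectation (\<lambda>t. (h t)\<^sup>2)"
    using int[where F = "\<lambda>x y. x\<^sup>2"] int[where F = "\<lambda>x y. y\<^sup>2"]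
    by simp
  finally show ?thesis .
qed

section \<open>Rademacher polynomials of degree one and two\<close>

definition rad_linear :: "real \<Rightarrow> (nat \<Rightarrow> real) \<Rightarrow> nat \<Rightarrow> nat \<Rightarrow> real \<Rightarrow> real" where
  "rad_linear c b k n t = c + (\<Sum>j\<in>{k..<n}. b j * rademacher j t)"

text \<open>The constant and linear terms keep the class closed when the smallest index is split
  off: what remains has the same form, and the coefficient of r_k is a \<open>rad_linear\<close> in
  the later signs.\<close>

definition rad_quadratic ::
  "real \<Rightarrow> (nat \<Rightarrow> real) \<Rightarrow> (nat \<Rightarrow> nat \<Rightarrow> real) \<Rightarrow> nat \<Rightarrow> nat \<Rightarrow> real \<Rightarrow> real" where
  "rad_quadratic c b a k n t = c + (\<Sum>j\<in>{k..<n}. b j * rademacher j t)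
     + (\<Sum>i\<in>{k..<n}. \<Sum>j\<in>{Suc i..<n}. a i j * (rademacher i t * rademacher j t))"

lemma interval_insert: "k < n \<Longrightarrow> {k..<n} = insert k {Suc k..<n}"
  by auto

lemma rad_linear_step:
  "k < n \<Longrightarrow> rad_linear c b k n = (\<lambda>t. rad_linear c b (Suc k) n t + rademacher k t * b k)"
  by (auto simp: rad_linear_def interval_insert algebra_simps)

lemma rad_quadratic_step:
  "k < n \<Longrightarrow> rad_quadratic c b a k n = (\<lambda>t. rad_quadratic c b a (Suc k) n t
      + rademacher k t * rad_linear (b k) (a k) (Suc k) n t)"
  by (auto simp: rad_quadratic_def rad_linear_def interval_insert algebra_simps sum_distrib_left
      simp del: sum.op_ivl_Suc)

lemma shift_inv_rad_linear: "1 \<le> k \<Longrightarrow> shift_inv k (rad_linear c b (Suc k) n)"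
  unfolding rad_linear_def
  by (rule shift_inv_compose, rule shift_inv_sum, rule shift_inv_compose, rule shift_inv_rademacher) auto

lemma shift_inv_rad_quadratic: "1 \<le> k \<Longrightarrow> shift_inv k (rad_quadratic c b a (Suc k) n)"
  unfolding rad_quadratic_def
  by (rule shift_inv_compose2[where F = "(+)"],
      (rule shift_inv_compose, rule shift_inv_sum, rule shift_inv_compose, rule shift_inv_rademacher, auto)[],
      rule shift_inv_sum, rule shift_inv_sum, rule shift_inv_compose, rule shift_inv_compose2;
      rule shift_inv_rademacher; auto)

lemma rad_linear_moment:
  assumes "2 \<le> k" "1 \<le> m"
  shows "expectation (\<lambda>t. rad_linear c b k n t ^ (2 * m))
    \<le> ((2 * real m - 1) * (c\<^sup>2 + (\<Sum>j\<in>{k..<n}. (b j)\<^sup>2))) ^ m"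
  using assms(1)
proof (induction "n - k" arbitrary: k)
  case 0
  have "(c\<^sup>2) ^ m \<le> ((2 * real m - 1) * c\<^sup>2) ^ m"
    using assms by (intro power_mono) (auto simp: mult_le_cancel_right1)
  then show ?case
    using 0 by (simp add: rad_linear_def power_mult)
next
  case (Suc d)
  then have k: "k < n" "d = n - Suc k" "2 \<le> Suc k" "1 \<le> k"
    by auto
  have "expectation (\<lambda>t. (rad_linear c b (Suc k) n t + rademacher k t * b k) ^ (2 * m))
      \<le> ((2 * real m - 1) * (c\<^sup>2 + (\<Sum>j\<in>{Suc k..<n}. (b j)\<^sup>2)) + (2 * real m - 1) * (b k)\<^sup>2) ^ m"
    using Suc.hyps(1)[OF k(2,3)] assms(2) Suc.prems
    by (intro expectation_rademacher_power_le shift_inv_rad_linear shift_inv_const k)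
       (auto simp: power_mult_distrib power_mult[symmetric] sum_nonneg)
  then show ?case
    using k by (simp add: rad_linear_step interval_insert algebra_simps del: sum.op_ivl_Suc)
qed

text \<open>The square of 2m - 1 reflects the degree: one factor is paid when r_k is averaged out,
  the other is contained in the moment of its linear coefficient.\<close>

lemma rad_quadratic_moment:
  assumes "2 \<le> k" "1 \<le> m"
  shows "expectation (\<lambda>t. rad_quadratic c b a k n t ^ (2 * m))
    \<le> ((2 * real m - 1)\<^sup>2 * (c\<^sup>2 + (\<Sum>j\<in>{k..<n}. (b j)\<^sup>2)
        + (\<Sum>i\<in>{k..<n}. \<Sum>j\<in>{Suc i..<n}. (a i j)\<^sup>2))) ^ m"
  using assms(1)
proof (induction "n - k" arbitrary: k)
  case 0
  have "1 \<le> (2 * real m - 1)\<^sup>2"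
    using assms by (intro one_le_power) auto
  then have "(c\<^sup>2) ^ m \<le> ((2 * real m - 1)\<^sup>2 * c\<^sup>2) ^ m"
    using assms by (intro power_mono) (auto simp: mult_le_cancel_right1)
  then show ?case
    using 0 by (simp add: rad_quadratic_def power_mult)
next
  case (Suc d)
  then have k: "k < n" "d = n - Suc k" "2 \<le> Suc k" "1 \<le> k"
    by auto
  let ?K = "2 * real m - 1"
  have "?K ^ m * expectation (\<lambda>t. rad_linear (b k) (a k) (Suc k) n t ^ (2 * m))
      \<le> ?K ^ m * (?K * ((b k)\<^sup>2 + (\<Sum>j\<in>{Suc k..<n}. (a k j)\<^sup>2))) ^ m"
    using assms k by (intro mult_left_mono rad_linear_moment) auto
  also have "\<dots> = (?K\<^sup>2 * ((b k)\<^sup>2 + (\<Sum>j\<in>{Suc k..<n}. (a k j)\<^sup>2))) ^ m"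
    by (simp add: power_mult_distrib[symmetric] power2_eq_square mult_ac)
  finally have "expectation (\<lambda>t. (rad_quadratic c b a (Suc k) n t
        + rademacher k t * rad_linear (b k) (a k) (Suc k) n t) ^ (2 * m))
      \<le> (?K\<^sup>2 * (c\<^sup>2 + (\<Sum>j\<in>{Suc k..<n}. (b j)\<^sup>2)
            + (\<Sum>i\<in>{Suc k..<n}. \<Sum>j\<in>{Suc i..<n}. (a i j)\<^sup>2))
          + ?K\<^sup>2 * ((b k)\<^sup>2 + (\<Sum>j\<in>{Suc k..<n}. (a k j)\<^sup>2))) ^ m"
    using Suc.hyps(1)[OF k(2,3)] assms(2) Suc.prems
    by (intro expectation_rademacher_power_le shift_inv_rad_linear shift_inv_rad_quadratic k)
       (auto intro!: mult_nonneg_nonneg add_nonneg_nonneg sum_nonneg)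
  then show ?case
    using k by (simp add: rad_quadratic_step interval_insert algebra_simps del: sum.op_ivl_Suc)
qed

lemma rad_linear_second_moment:
  assumes "2 \<le> k"
  shows "expectation (\<lambda>t. (rad_linear c b k n t)\<^sup>2) = c\<^sup>2 + (\<Sum>j\<in>{k..<n}. (b j)\<^sup>2)"
  using assms
proof (induction "n - k" arbitrary: k)
  case 0
  then show ?case
    by (simp add: rad_linear_def)
next
  case (Suc d)
  then have k: "k < n" "d = n - Suc k" "2 \<le> Suc k" "1 \<le> k"
    by auto
  show ?case
    using k Suc.hyps(1)[OF k(2,3)] Suc.prems
    by (simp add: rad_linear_step expectation_rademacher_square shift_inv_rad_linear
        shift_inv_const interval_insert del: sum.op_ivl_Suc)
qed

lemma rad_quadratic_second_moment:
  assumes "2 \<le> k"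
  shows "expectation (\<lambda>t. (rad_quadratic c b a k n t)\<^sup>2) = c\<^sup>2 + (\<Sum>j\<in>{k..<n}. (b j)\<^sup>2)
        + (\<Sum>i\<in>{k..<n}. \<Sum>j\<in>{Suc i..<n}. (a i j)\<^sup>2)"
  using assms
proof (induction "n - k" arbitrary: k)
  case 0
  then show ?case
    by (simp add: rad_quadratic_def)
next
  case (Suc d)
  then have k: "k < n" "d = n - Suc k" "2 \<le> Suc k" "1 \<le> k"
    by auto
  show ?case
    using k Suc.hyps(1)[OF k(2,3)] Suc.prems
    by (simp add: rad_quadratic_step expectation_rademacher_square shift_inv_rad_linear
        shift_inv_rad_quadratic rad_linear_second_moment interval_insert del: sum.op_ivl_Suc)
qed

section \<open>Finite chaos sums as Rademacher polynomials\<close>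

definition chaos_poly :: "(nat \<times> nat) set \<Rightarrow> (nat \<times> nat \<Rightarrow> real) \<Rightarrow> real \<Rightarrow> real" where
  "chaos_poly F a t = (\<Sum>p\<in>F. a p * chaos_fun p t)"

lemma chaos_poly_simple: "simple_function borel (chaos_poly F a)"
  unfolding chaos_poly_def chaos_fun_def
  by (intro simple_function_sum simple_function_mult simple_function_const rademacher_simple)

text \<open>Since \<open>r\<^sub>1 = 1\<close> almost everywhere, the terms with \<open>i = 1\<close> make up the linear part.\<close>

lemma chaos_poly_AE_eq_quadratic:
  assumes F: "finite F" "F \<subseteq> chaos_index"
  obtains n b c where "AE t in unit_measure. chaos_poly F a t = rad_quadratic 0 b c 2 n t"
    "(\<Sum>p\<in>F. (a p)\<^sup>2) = (\<Sum>j\<in>{2..<n}. (b j)\<^sup>2) + (\<Sum>i\<in>{2..<n}. \<Sum>j\<in>{Suc i..<n}. (c i j)\<^sup>2)"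
proof -
  \<comment> \<open>A strict bound for all indices, which is at least 2 even for empty
    \<open>F\<close>, so that the row i = 1 can be split off from \<open>{1..<n}\<close>.\<close>
  define n where "n = Suc (Suc (Max (insert 0 (snd ` F))))"
  have n: "F \<subseteq> (SIGMA i:{1..<n}. {Suc i..<n})"
  proof
    fix p assume p: "p \<in> F"
    then have "snd p \<le> Max (insert 0 (snd ` F))"
      using F by (intro Max_ge) auto
    then show "p \<in> (SIGMA i:{1..<n}. {Suc i..<n})"
      using p F by (cases p) (auto simp: n_def chaos_index_def)
  qed
  define a' where "a' i j = (if (i, j) \<in> F then a (i, j) else 0)" for i j
  have split: "(\<Sum>p\<in>F. f p) = (\<Sum>j\<in>{2..<n}. f' 1 j) + (\<Sum>i\<in>{2..<n}. \<Sum>j\<in>{Suc i..<n}. f' i j)"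
    if "\<And>i j. f' i j = (if (i, j) \<in> F then f (i, j) else 0)" for f :: "nat \<times> nat \<Rightarrow> real" and f'
  proof -
    have "(\<Sum>p\<in>F. f p) = (\<Sum>(i, j)\<in>(SIGMA i:{1..<n}. {Suc i..<n}). f' i j)"
      using n by (intro sum.mono_neutral_cong_left) (auto simp: that)
    also have "\<dots> = (\<Sum>i\<in>{1..<n}. \<Sum>j\<in>{Suc i..<n}. f' i j)"
      by (rule sum.Sigma[symmetric]) auto
    also have "{1..<n} = insert 1 {2..<n}"
      by (auto simp: n_def)
    finally show ?thesis
      by (simp add: numeral_2_eq_2 del: sum.op_ivl_Suc)
  qed
  show ?thesis
  proof (rule that)
    show "(\<Sum>p\<in>F. (a p)\<^sup>2) = (\<Sum>j\<in>{2..<n}. (a' 1 j)\<^sup>2)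
        + (\<Sum>i\<in>{2..<n}. \<Sum>j\<in>{Suc i..<n}. (a' i j)\<^sup>2)"
      by (rule split) (simp add: a'_def)
    have "chaos_poly F a t = (\<Sum>j\<in>{2..<n}. a' 1 j * (rademacher 1 t * rademacher j t))
       + (\<Sum>i\<in>{2..<n}. \<Sum>j\<in>{Suc i..<n}. a' i j * (rademacher i t * rademacher j t))" for t
      unfolding chaos_poly_def by (rule split) (simp add: a'_def chaos_fun_def)
    then show "AE t in unit_measure. chaos_poly F a t = rad_quadratic 0 (a' 1) a' 2 n t"
      using AE_rademacher_1 by (auto simp: rad_quadratic_def elim!: eventually_mono)
  qed
qed

lemma rad_quadratic_simple: "simple_function borel (rad_quadratic c b a k n)"
  unfolding rad_quadratic_def
  by (intro simple_function_sum simple_function_mult simple_function_add simple_function_const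
      rademacher_simple)

lemma chaos_poly_moments:
  assumes F: "finite F" "F \<subseteq> chaos_index"
  shows chaos_poly_second_moment: "expectation (\<lambda>t. (chaos_poly F a t)\<^sup>2) = (\<Sum>p\<in>F. (a p)\<^sup>2)"
    and chaos_poly_even_moment: "1 \<le> m \<Longrightarrow> expectation (\<lambda>t. chaos_poly F a t ^ (2 * m))
      \<le> ((2 * real m - 1)\<^sup>2 * (\<Sum>p\<in>F. (a p)\<^sup>2)) ^ m"
proof -
  obtain n b c where eq: "AE t in unit_measure. chaos_poly F a t = rad_quadratic 0 b c 2 n t"
    and s: "(\<Sum>p\<in>F. (a p)\<^sup>2) = (\<Sum>j\<in>{2..<n}. (b j)\<^sup>2) + (\<Sum>i\<in>{2..<n}. \<Sum>j\<in>{Suc i..<n}. (c i j)\<^sup>2)"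
    using chaos_poly_AE_eq_quadratic[OF F] .
  note meas = chaos_poly_simple[THEN simple_borel_unit] rad_quadratic_simple[THEN simple_borel_unit]
  have e: "expectation (\<lambda>t. chaos_poly F a t ^ k) = expectation (\<lambda>t. rad_quadratic 0 b c 2 n t ^ k)" for k
    using eq by (intro integral_cong_AE borel_measurable_power meas) (auto elim!: eventually_mono)
  show "expectation (\<lambda>t. (chaos_poly F a t)\<^sup>2) = (\<Sum>p\<in>F. (a p)\<^sup>2)"
    unfolding e s by (subst rad_quadratic_second_moment) auto
  show "expectation (\<lambda>t. chaos_poly F a t ^ (2 * m)) \<le> ((2 * real m - 1)\<^sup>2 * (\<Sum>p\<in>F. (a p)\<^sup>2)) ^ m"
    if "1 \<le> m"
    unfolding e s using rad_quadratic_moment[of 2 m 0 b c n] that by simp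
qed

section \<open>Exponential integrability and lower tails of the chaos\<close>

lemma power_self_le_exp_fact: "real n ^ n \<le> exp (real n) * fact n"
proof -
  have "(\<lambda>k. real n ^ k /\<^sub>R fact k) sums exp (real n)"
    by (rule exp_converges)
  then have "real n ^ n /\<^sub>R fact n \<le> exp (real n)"
    using sum_le_suminf[of "\<lambda>k. real n ^ k /\<^sub>R fact k" "{n}"]
    by (simp add: sums_iff)
  then show ?thesis
    by (simp add: field_simps)
qed

lemma cosh_even_sums: "(\<lambda>m. x ^ (2 * m) / fact (2 * m)) sums cosh x" for x :: real
proof -
  let ?c = "\<lambda>n. if even n then x ^ n /\<^sub>R fact n else 0"
  have "(\<lambda>m. ?c (2 * m)) sums cosh x"
  proof (subst sums_mono_reindex)
    show "strict_mono (\<lambda>m :: nat. 2 * m)"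
      by (simp add: strict_mono_def)
    show "?c n = 0" if "n \<notin> range (\<lambda>m. 2 * m)" for n
      using that by (auto elim!: evenE)
  qed (rule cosh_converges)
  then show ?thesis
    by (simp add: divide_inverse mult.commute)
qed

text \<open>The moments of order 2m grow like (2m)^(2m), which the factorial compensates up to
  e^(2m). The constant 4e removes this exponential and the factor 2, and leaves a ratio 1/4.\<close>

lemma chaos_poly_scaled_moment:
  assumes F: "finite F" "F \<subseteq> chaos_index" and l: "0 < l" "4 * exp 1 * sqrt (\<Sum>p\<in>F. (a p)\<^sup>2) \<le> l"
  shows "expectation (\<lambda>t. (2 * chaos_poly F a t / l) ^ (2 * m) / fact (2 * m)) \<le> (1 / 4) ^ m"
proof (cases "m = 0")
  case False
  define v where "v = (\<Sum>p\<in>F. (a p)\<^sup>2)"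
  have v: "0 \<le> v"
    by (simp add: v_def sum_nonneg)
  have "(4 * exp 1 * sqrt v)\<^sup>2 \<le> l\<^sup>2"
    using l v by (intro power_mono) (auto simp: v_def)
  then have vl: "16 * (exp 1)\<^sup>2 * v \<le> l\<^sup>2"
    using v by (simp add: power_mult_distrib)
  have m1: "(2 * real m - 1)\<^sup>2 \<le> (2 * real m)\<^sup>2"
    using False by (intro power_mono) auto
  have base: "(2 / l)\<^sup>2 * ((2 * real m - 1)\<^sup>2 * v) \<le> (real (2 * m))\<^sup>2 / (4 * (exp 1)\<^sup>2)"
  proof -
    have "4 * (exp 1)\<^sup>2 * (4 * ((2 * real m - 1)\<^sup>2 * v)) = (2 * real m - 1)\<^sup>2 * (16 * (exp 1)\<^sup>2 * v)"
      by simp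
    also have "\<dots> \<le> (2 * real m)\<^sup>2 * l\<^sup>2"
      using v by (intro mult_mono m1 vl) auto
    finally show ?thesis
      using l by (simp add: field_simps power2_eq_square)
  qed
  have "expectation (\<lambda>t. (2 * chaos_poly F a t / l) ^ (2 * m) / fact (2 * m))
      = (2 / l) ^ (2 * m) / fact (2 * m) * expectation (\<lambda>t. chaos_poly F a t ^ (2 * m))"
    by (simp add: power_divide power_mult_distrib flip: integral_mult_right_zero)
  also have "\<dots> \<le> (2 / l) ^ (2 * m) / fact (2 * m) * ((2 * real m - 1)\<^sup>2 * v) ^ m"
    using False l unfolding v_def by (intro mult_left_mono chaos_poly_even_moment F) auto
  also have "\<dots> = ((2 / l)\<^sup>2 * ((2 * real m - 1)\<^sup>2 * v)) ^ m / fact (2 * m)"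
    by (simp add: power_mult power_mult_distrib)
  also have "\<dots> \<le> ((real (2 * m))\<^sup>2 / (4 * (exp 1)\<^sup>2)) ^ m / fact (2 * m)"
    using v by (intro divide_right_mono power_mono base) auto
  also have "\<dots> = (1 / 4) ^ m * (real (2 * m) ^ (2 * m) / (exp (real (2 * m)) * fact (2 * m)))"
    by (simp add: power_divide power_mult_distrib exp_of_nat_mult[symmetric] power_mult[of _ 2]
        power_mult[of "exp 1" 2 m, symmetric] del: of_nat_mult of_nat_numeral)
  also have "\<dots> \<le> (1 / 4) ^ m * 1"
    using power_self_le_exp_fact[of "2 * m"] by (intro mult_left_mono) (auto simp: divide_le_eq)
  finally show ?thesis
    by simp
qed simp

text \<open>Only even moments are available, so the exponential is replaced by cosh, whose series
  they control: its mean is at most the geometric sum 4/3, and 4/3 - 1/2 is below 1.\<close>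

lemma chaos_poly_exp_integral:
  assumes F: "finite F" "F \<subseteq> chaos_index" and l: "0 < l" "4 * exp 1 * sqrt (\<Sum>p\<in>F. (a p)\<^sup>2) \<le> l"
  shows "(\<integral>\<^sup>+ t. ennreal (M_exp (\<bar>chaos_poly F a t\<bar> / l)) \<partial>unit_measure) \<le> 1"
proof -
  define x where "x t = 2 * chaos_poly F a t / l" for t
  have sx: "simple_function borel (\<lambda>t. G (x t))" for G :: "real \<Rightarrow> real"
    unfolding x_def by (rule simple_function_compose1, rule simple_function_compose1, rule chaos_poly_simple)
  have int: "integrable unit_measure (\<lambda>t. G (x t))" for G :: "real \<Rightarrow> real"
    by (rule integrable_simple_unit[OF sx])
  have "ennreal (expectation (\<lambda>t. cosh (x t))) = (\<integral>\<^sup>+ t. ennreal (cosh (x t)) \<partial>unit_measure)"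
    by (intro nn_integral_eq_integral[symmetric] int) (auto intro: cosh_real_nonneg)
  also have "\<dots> = (\<integral>\<^sup>+ t. (\<Sum>m. ennreal (x t ^ (2 * m) / fact (2 * m))) \<partial>unit_measure)"
  proof (intro nn_integral_cong)
    fix t
    have "(\<lambda>m. x t ^ (2 * m) / fact (2 * m)) sums cosh (x t)"
      by (rule cosh_even_sums)
    then show "ennreal (cosh (x t)) = (\<Sum>m. ennreal (x t ^ (2 * m) / fact (2 * m)))"
      by (intro suminf_ennreal_eq[symmetric]) (auto simp: power_mult)
  qed
  also have "\<dots> = (\<Sum>m. \<integral>\<^sup>+ t. ennreal (x t ^ (2 * m) / fact (2 * m)) \<partial>unit_measure)"
    by (intro nn_integral_suminf measurable_compose[OF _ measurable_ennreal] simple_borel_unit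
        sx[where G = "\<lambda>x. x ^ (2 * _) / fact (2 * _)"])
  also have "\<dots> \<le> (\<Sum>m. ennreal ((1 / 4) ^ m))"
  proof (intro suminf_le summableI)
    fix m
    have "(\<integral>\<^sup>+ t. ennreal (x t ^ (2 * m) / fact (2 * m)) \<partial>unit_measure)
        = ennreal (expectation (\<lambda>t. x t ^ (2 * m) / fact (2 * m)))"
      by (intro nn_integral_eq_integral int[where G = "\<lambda>x. x ^ (2 * m) / fact (2 * m)"]) (auto simp: power_mult)
    also have "\<dots> \<le> ennreal ((1 / 4) ^ m)"
      unfolding x_def by (intro ennreal_leI chaos_poly_scaled_moment assms)
    finally show "(\<integral>\<^sup>+ t. ennreal (x t ^ (2 * m) / fact (2 * m)) \<partial>unit_measure) \<le> ennreal ((1 / 4) ^ m)" .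
  qed
  also have "\<dots> = ennreal (4 / 3)"
    using geometric_sums[of "1 / 4 :: real"] by (intro suminf_ennreal_eq) auto
  finally have cosh: "expectation (\<lambda>t. cosh (x t)) \<le> 4 / 3"
    by simp
  \<comment> \<open>From (e^y - 1)^2 >= 0 follows 2 e^y - 1 <= e^(2y) <= 2 cosh (2y). The doubling
    of the argument is the reason for the factor 2 in \<open>x\<close>.\<close>
  have ptw: "M_exp (\<bar>chaos_poly F a t\<bar> / l) \<le> cosh (x t) - 1 / 2" for t
  proof -
    define y where "y = \<bar>chaos_poly F a t\<bar> / l"
    have x: "\<bar>x t\<bar> = y + y"
      using l by (simp add: x_def y_def abs_mult)
    have "0 \<le> (exp y - 1)\<^sup>2"
      by simp
    then have "2 * exp y - 1 \<le> exp \<bar>x t\<bar>"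
      unfolding x exp_add by (simp add: power2_eq_square algebra_simps)
    also have "exp \<bar>x t\<bar> \<le> 2 * cosh (x t)"
      by (auto simp: cosh_def abs_if)
    finally show ?thesis
      by (simp add: M_exp_def y_def)
  qed
  have half: "1 / 2 \<le> cosh (x t)" for t
    using cosh_real_ge_1[of "x t"] by linarith
  have "(\<integral>\<^sup>+ t. ennreal (M_exp (\<bar>chaos_poly F a t\<bar> / l)) \<partial>unit_measure)
      \<le> (\<integral>\<^sup>+ t. ennreal (cosh (x t) - 1 / 2) \<partial>unit_measure)"
    using ptw by (intro nn_integral_mono ennreal_leI)
  also have "\<dots> = ennreal (expectation (\<lambda>t. cosh (x t) - 1 / 2))"
    by (intro nn_integral_eq_integral int[where G = "\<lambda>x. cosh x - 1 / 2"])
       (simp only: diff_ge_0_iff_ge half AE_I2)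
  also have "expectation (\<lambda>t. cosh (x t) - 1 / 2) = expectation (\<lambda>t. cosh (x t)) - 1 / 2"
    using int[where G = cosh] by simp
  also have "ennreal \<dots> \<le> 1"
    using cosh by simp
  finally show ?thesis .
qed

text \<open>Integrating the pointwise inequality below gives v <= v/4 + v/4 + K v p for the
  probability p in question.\<close>

lemma paley_zygmund:
  assumes s: "simple_function borel f" and v: "0 < v" "expectation (\<lambda>t. (f t)\<^sup>2) = v"
    and K: "0 < K" "expectation (\<lambda>t. f t ^ 4) \<le> K * v\<^sup>2"
  shows "1 / (2 * K) \<le> prob (\<lambda>t. v / 4 \<le> (f t)\<^sup>2)"
proof -
  have int: "integrable unit_measure (\<lambda>t. g (f t))" for g :: "real \<Rightarrow> real"
    by (rule integrable_simple_unit[OF simple_function_compose1[OF s]])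
  let ?p = "\<lambda>t. of_bool (v / 4 \<le> (f t)\<^sup>2) :: real"
  \<comment> \<open>The arithmetic-geometric mean inequality replaces Cauchy-Schwarz; its weight is
    tuned so that the fourth moment contributes just v/4.\<close>
  have ptw: "(f t)\<^sup>2 \<le> v / 4 + f t ^ 4 / (4 * K * v) + K * v * ?p t" for t
  proof (cases "v / 4 \<le> (f t)\<^sup>2")
    case True
    have "0 \<le> ((f t)\<^sup>2 - 2 * K * v)\<^sup>2"
      by simp
    then have "(f t)\<^sup>2 * (4 * K * v) \<le> f t ^ 4 + K * v * (4 * K * v)"
      by (simp add: power2_eq_square algebra_simps power4_eq_xxxx)
    then have "(f t)\<^sup>2 \<le> f t ^ 4 / (4 * K * v) + K * v"
      using v K by (simp add: field_simps)
    then show ?thesis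
      using True v by simp
  next
    case False
    have "0 \<le> f t ^ 4 / (4 * K * v)"
      using v K by auto
    with False show ?thesis
      by simp
  qed
  have i: "integrable unit_measure (\<lambda>t. f t ^ 4)" "integrable unit_measure ?p"
    using int[where g = "\<lambda>x. x ^ 4"] int[where g = "\<lambda>x. of_bool (v / 4 \<le> x\<^sup>2)"] by auto
  have "v \<le> expectation (\<lambda>t. v / 4 + f t ^ 4 / (4 * K * v) + K * v * ?p t)"
    by (subst v(2)[symmetric], rule integral_mono[OF _ _ ptw])
       (rule int[where g = "\<lambda>x. x\<^sup>2"],
        rule int[where g = "\<lambda>x. v / 4 + x ^ 4 / (4 * K * v) + K * v * of_bool (v / 4 \<le> x\<^sup>2)"])
  also have "\<dots> = v / 4 + expectation (\<lambda>t. f t ^ 4) / (4 * K * v) + K * v * expectation ?p"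
    using i by simp
  also have "expectation (\<lambda>t. f t ^ 4) / (4 * K * v) \<le> K * v\<^sup>2 / (4 * K * v)"
    using K v by (intro divide_right_mono) auto
  also have "\<dots> = v / 4"
    using K v by (simp add: power2_eq_square)
  finally have "v / 2 \<le> K * v * expectation ?p"
    by simp
  then have "1 / (2 * K) \<le> expectation ?p"
    using v K by (simp add: field_simps)
  then show ?thesis
    using prob_eq_expectation[OF s, where P = "\<lambda>x. v / 4 \<le> x\<^sup>2"] by simp
qed

text \<open>For m = 2 the moment bound has the constant (3^2)^2 = 81, hence 1/162 = 1/(2 *
  81).\<close>

lemma chaos_poly_large:
  assumes F: "finite F" "F \<subseteq> chaos_index"
  shows "1 / 162 \<le> prob (\<lambda>t. sqrt (\<Sum>p\<in>F. (a p)\<^sup>2) / 2 \<le> \<bar>chaos_poly F a t\<bar>)"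
proof -
  define v where "v = (\<Sum>p\<in>F. (a p)\<^sup>2)"
  have v0: "0 \<le> v"
    by (simp add: v_def sum_nonneg)
  show ?thesis
  proof (cases "v = 0")
    case True
    then have "{t \<in> {0..1}. sqrt (\<Sum>p\<in>F. (a p)\<^sup>2) / 2 \<le> \<bar>chaos_poly F a t\<bar>} = {0..1}"
      by (auto simp flip: v_def)
    then show ?thesis
      by (simp only: measure_unit_space)
  next
    case False
    have "1 / (2 * 81) \<le> prob (\<lambda>t. v / 4 \<le> (chaos_poly F a t)\<^sup>2)"
    proof (rule paley_zygmund[OF chaos_poly_simple])
      show "expectation (\<lambda>t. (chaos_poly F a t)\<^sup>2) = v"
        using chaos_poly_second_moment[OF F] by (simp add: v_def)
      show "expectation (\<lambda>t. chaos_poly F a t ^ 4) \<le> 81 * v\<^sup>2"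
        using chaos_poly_even_moment[OF F, of 2 a] by (simp add: v_def power_mult_distrib)
    qed (use v0 False in auto)
    moreover have "sqrt v / 2 \<le> \<bar>x\<bar> \<longleftrightarrow> v / 4 \<le> x\<^sup>2" for x
      using real_le_rsqrt[of "\<bar>x\<bar>"] abs_le_square_iff[of "sqrt v / 2" x] v0
      by (simp add: power_divide)
    ultimately show ?thesis
      by (simp flip: v_def)
  qed
qed

section \<open>Large values of a block chaos\<close>

definition rad_sum :: "nat set \<Rightarrow> real \<Rightarrow> real" where
  "rad_sum A t = (\<Sum>i\<in>A. rademacher i t)"

lemma rad_sum_simple: "simple_function borel (rad_sum A)"
  unfolding rad_sum_def by (intro simple_function_sum rademacher_simple)

lemma shift_inv_rad_sum:
  assumes "1 \<le> i" "\<And>j. j \<in> A \<Longrightarrow> i < j"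
  shows "shift_inv i (rad_sum A)"
  unfolding rad_sum_def using assms by (intro shift_inv_sum shift_inv_rademacher)

text \<open>The smallest index is removed first, since its translation fixes the sum over the
  others. \<open>G\<close> varies in the induction because a removed sign shifts its argument by 1
  or -1.\<close>

lemma expectation_rad_sum_indep:
  fixes G :: "real \<Rightarrow> real" and \<Phi> :: "real \<Rightarrow> real"
  assumes "finite A" "\<And>i. i \<in> A \<Longrightarrow> 2 \<le> i" "\<And>i. i \<in> A \<Longrightarrow> shift_inv i \<Phi>"
  shows "expectation (\<lambda>t. G (rad_sum A t) * \<Phi> t) = expectation (\<lambda>t. G (rad_sum A t)) * expectation \<Phi>"
  using assms
proof (induction A arbitrary: G rule: finite_linorder_min_induct)
  case empty
  then show ?case
    by (simp add: rad_sum_def)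
next
  case (insert b A)
  have S: "rad_sum (insert b A) t = rademacher b t + rad_sum A t" for t
    using insert.hyps by (auto simp: rad_sum_def)
  have step: "expectation (\<lambda>t. G (rad_sum (insert b A) t) * \<Psi> t)
      = (expectation (\<lambda>t. G (1 + rad_sum A t) * \<Psi> t)
        + expectation (\<lambda>t. G (- 1 + rad_sum A t) * \<Psi> t)) / 2"
    if \<Psi>: "shift_inv b \<Psi>" for \<Psi> :: "real \<Rightarrow> real"
    unfolding S
  proof (rule expectation_average[where F = "\<lambda>r t. G (r + rad_sum A t) * \<Psi> t"])
    have "shift_inv b (rad_sum A)"
      using insert.hyps insert.prems(1)[of b] by (intro shift_inv_rad_sum) auto
    then show "shift_inv b (\<lambda>t. G (1 + rad_sum A t) * \<Psi> t)"
        "shift_inv b (\<lambda>t. G (- 1 + rad_sum A t) * \<Psi> t)"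
      using \<Psi> shift_inv_compose2[of b "rad_sum A" \<Psi> "\<lambda>x y. G (1 + x) * y"]
         shift_inv_compose2[of b "rad_sum A" \<Psi> "\<lambda>x y. G (- 1 + x) * y"] by auto
    show "(\<lambda>t. G (rademacher b t + rad_sum A t) * \<Psi> t) \<in> borel_measurable unit_measure"
      using \<Psi> by (intro simple_borel_unit simple_function_mult shift_inv_simple
          simple_function_compose2[OF rademacher_simple rad_sum_simple, of "\<lambda>x y. G (x + y)"])
  qed (use insert.prems in auto)
  show ?case
    using step[of \<Phi>] step[OF shift_inv_const[of b 1]] insert
      insert.IH[of "\<lambda>x. G (1 + x)"] insert.IH[of "\<lambda>x. G (- 1 + x)"]
    by (simp add: algebra_simps add_divide_distrib)
qed

lemma prob_rad_sum_indep:
  assumes "finite A" "\<And>i. i \<in> A \<Longrightarrow> 2 \<le> i" "\<And>i j. i \<in> A \<Longrightarrow> j \<in> B \<Longrightarrow> i < j"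
  shows "prob (\<lambda>t. s \<le> rad_sum A t \<and> s' \<le> rad_sum B t)
    = prob (\<lambda>t. s \<le> rad_sum A t) * prob (\<lambda>t. s' \<le> rad_sum B t)"
proof -
  have "simple_function borel (\<lambda>t. (rad_sum A t, rad_sum B t))"
    by (rule simple_function_Pair[OF rad_sum_simple rad_sum_simple])
  from prob_eq_expectation[OF this, of "\<lambda>(x, y). s \<le> x \<and> s' \<le> y"]
  have "prob (\<lambda>t. s \<le> rad_sum A t \<and> s' \<le> rad_sum B t)
      = expectation (\<lambda>t. of_bool (s \<le> rad_sum A t) * of_bool (s' \<le> rad_sum B t))"
    by (simp add: of_bool_conj)
  also have "\<dots> = expectation (\<lambda>t. of_bool (s \<le> rad_sum A t)) * expectation (\<lambda>t. of_bool (s' \<le> rad_sum B t))"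
  proof (rule expectation_rad_sum_indep[where G = "\<lambda>x. of_bool (s \<le> x)"])
    show "shift_inv i (\<lambda>t. of_bool (s' \<le> rad_sum B t) :: real)" if "i \<in> A" for i
      using assms(2)[OF that] assms(3)[OF that]
      by (intro shift_inv_compose[where F = "\<lambda>x. of_bool (s' \<le> x)"] shift_inv_rad_sum) auto
  qed (use assms in auto)
  also have "\<dots> = prob (\<lambda>t. s \<le> rad_sum A t) * prob (\<lambda>t. s' \<le> rad_sum B t)"
    using prob_eq_expectation[OF rad_sum_simple, where P = "\<lambda>x. s \<le> x"]
      prob_eq_expectation[OF rad_sum_simple, where P = "\<lambda>x. s' \<le> x"] by simp
  finally show ?thesis .
qed

lemma prob_mono:
  assumes "simple_function borel f" "\<And>t. 0 \<le> t \<Longrightarrow> t \<le> 1 \<Longrightarrow> P t \<Longrightarrow> Q (f t)"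
  shows "prob P \<le> prob (\<lambda>t. Q (f t))"
  using assms finite_unit measurable_pred_unit[OF assms(1), of Q]
  by (intro finite_measure.finite_measure_mono) auto

text \<open>The sum is large as soon as each of \<open>l\<close> consecutive blocks contributes
  \<open>s\<close>, and these events are independent. The base estimate is uniform in the starting
  index, so it serves every block.\<close>

lemma prob_rad_sum_blocks:
  assumes base: "\<And>a. 2 \<le> a \<Longrightarrow> \<delta> \<le> prob (\<lambda>t. s \<le> rad_sum {a..<a + m} t)"
    and \<delta>: "0 \<le> \<delta>" and a: "2 \<le> a"
  shows "\<delta> ^ l \<le> prob (\<lambda>t. real l * s \<le> rad_sum {a..<a + l * m} t)"
  using a
proof (induction l arbitrary: a)
  case 0
  have "{t \<in> {0..1}. real 0 * s \<le> rad_sum {a..<a + 0 * m} t} = {0..1}"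
    by (auto simp: rad_sum_def)
  then show ?case
    by (simp only: measure_unit_space) simp
next
  case (Suc l)
  have S: "rad_sum {a..<a + Suc l * m} t = rad_sum {a..<a + m} t + rad_sum {a + m..<(a + m) + l * m} t" for t
    unfolding rad_sum_def by (subst sum.atLeastLessThan_concat) (auto simp: add_ac)
  have "\<delta> ^ Suc l \<le> prob (\<lambda>t. s \<le> rad_sum {a..<a + m} t)
      * prob (\<lambda>t. real l * s \<le> rad_sum {a + m..<(a + m) + l * m} t)"
    unfolding power_Suc using Suc.prems \<delta> by (intro mult_mono base Suc.IH) auto
  also have "\<dots> = prob (\<lambda>t. s \<le> rad_sum {a..<a + m} t
      \<and> real l * s \<le> rad_sum {a + m..<(a + m) + l * m} t)"
    using Suc.prems by (intro prob_rad_sum_indep[symmetric]) auto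
  also have "\<dots> \<le> prob (\<lambda>t. real (Suc l) * s \<le> rad_sum {a..<a + Suc l * m} t)"
    by (rule prob_mono[OF rad_sum_simple]) (simp only: S, simp add: ring_distribs)
  finally show ?case .
qed

lemma prob_rad_sum_max:
  assumes "2 \<le> a"
  shows "(1 / 2) ^ n \<le> prob (\<lambda>t. real n \<le> rad_sum {a..<a + n} t)"
proof -
  have "1 / 2 \<le> prob (\<lambda>t. 1 \<le> rad_sum {a..<a + 1} t)" if a: "2 \<le> a" for a
  proof -
    have "expectation (\<lambda>t. of_bool (1 \<le> rademacher a t))
        = (expectation (\<lambda>t. of_bool (1 \<le> (1::real))) + expectation (\<lambda>t. of_bool (1 \<le> (-1::real)))) / 2"
      using rademacher_simple[of a]
      by (intro expectation_average[where F = "\<lambda>r t. of_bool (1 \<le> r)"] a shift_inv_const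
          simple_borel_unit) (rule simple_function_compose1)
    then show ?thesis
      using prob_eq_expectation[OF rad_sum_simple, of "\<lambda>x. 1 \<le> x" "{a..<a + 1}"]
      by (simp add: rad_sum_def)
  qed
  from prob_rad_sum_blocks[of "1 / 2" 1 1, OF this _ assms, of n] show ?thesis
    by simp
qed

text \<open>The quartic has positive mean for a variable of mean 0 and variance 1 whose fourth moment is
  at most 9, and it is nonpositive on the negative half-line: this makes the estimate one-sided.\<close>

lemma quartic_le:
  fixes u :: real
  shows "u + (4/5) * u\<^sup>2 - (2/25) * u ^ 4 \<le> 7/200 + 5 * of_bool (1/32 \<le> u)"
proof -
  consider "u < 0" | "0 \<le> u" "u < 1/32" | "1/32 \<le> u"
    by linarith
  then show ?thesis
  proof cases
    case 1
    define x where "x = - u"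
    \<comment> \<open>After division by (2/25) x the cubic x^3 - 10 x + 25/2 remains. Its minimum on
      the positive axis is at sqrt (10/3), close to 11/6, and its value there is small but positive;
      the double root is placed at 11/6.\<close>
    have "0 \<le> (2/25) * x * ((x - 11/6)\<^sup>2 * (x + 11/3) + (1/12) * x + 1/6)"
      using 1 by (intro mult_nonneg_nonneg add_nonneg_nonneg) (auto simp: x_def)
    also have "\<dots> \<le> x - (4/5) * x\<^sup>2 + (2/25) * x ^ 4"
    proof -
      have "x - (4/5) * x\<^sup>2 + (2/25) * x ^ 4 - (2/25) * x * ((x - 11/6)\<^sup>2 * (x + 11/3) + (1/12) * x + 1/6)
          = (2/25) * x * (12.5 - 1331/108 - 1/6)"
        by (simp add: power2_eq_square power4_eq_xxxx field_simps)
      also have "\<dots> \<ge> 0"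
        using 1 by (simp add: x_def)
      finally show ?thesis
        by simp
    qed
    finally show ?thesis
      using 1 by (simp add: x_def)
  next
    case 2
    then have "u\<^sup>2 \<le> (1/32)\<^sup>2"
      by (intro power_mono) auto
    then have "u\<^sup>2 \<le> 1/1024"
      by (simp add: power2_eq_square)
    moreover have "0 \<le> u ^ 4" "of_bool (1/32 \<le> u) = (0::real)"
      using 2 by simp_all
    ultimately show ?thesis
      using 2 by linarith
  next
    case 3
    have "0 \<le> (2/25) * (u\<^sup>2 - 6)\<^sup>2 + (4/25) * (u - 25/8)\<^sup>2"
      by simp
    then show ?thesis
      using 3 by (simp add: power2_eq_square power4_eq_xxxx algebra_simps)
  qed
qed

text \<open>The mean of the quartic is at least 4/5 - 9 * 2/25 = 2/25, so five times the probability
  is at least 2/25 - 7/200 = 9/200. The bound does not depend on \<open>m\<close> and is one-sided,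
  so that contributions of several blocks add up.\<close>

lemma prob_rad_sum_base:
  assumes a: "2 \<le> a" and m: "1 \<le> m"
  shows "1 / 125 \<le> prob (\<lambda>t. sqrt (real m) / 32 \<le> rad_sum {a..<a + m} t)"
proof -
  define S where "S = rad_sum {a..<a + m}"
  define u where "u t = S t / sqrt (real m)" for t
  have S_lin: "S = rad_linear 0 (\<lambda>_. 1) a (a + m)"
    by (auto simp: S_def rad_sum_def rad_linear_def)
  have "simple_function borel S"
    unfolding S_def by (rule rad_sum_simple)
  then have su: "simple_function borel (\<lambda>t. g (u t))" for g :: "real \<Rightarrow> real"
    unfolding u_def by (rule simple_function_compose1)
  then have int: "integrable unit_measure (\<lambda>t. g (u t))" for g :: "real \<Rightarrow> real"
    by (rule integrable_simple_unit)
  have "expectation (rademacher i) = 0" if "2 \<le> i" for i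
    using expectation_rademacher_mult[OF that shift_inv_const[of i 1]] by simp
  then have "expectation S = 0"
    unfolding S_def rad_sum_def using a
    by (subst Bochner_Integration.integral_sum) (auto intro: integrable_simple_unit rademacher_simple)
  moreover have "u = (\<lambda>t. S t / sqrt (real m))"
    by (auto simp: u_def)
  ultimately have e1: "expectation u = 0"
    by simp
  have "expectation (\<lambda>t. (S t)\<^sup>2) = real m"
    unfolding S_lin using a by (subst rad_linear_second_moment) auto
  then have e2: "expectation (\<lambda>t. (u t)\<^sup>2) = 1"
    using m by (simp add: u_def power_divide)
  have "expectation (\<lambda>t. S t ^ 4) \<le> (3 * real m)\<^sup>2"
    unfolding S_lin using rad_linear_moment[OF a, of 2 0 "\<lambda>_. 1" "a + m"] by simp
  moreover have "sqrt (real m) ^ 4 = (real m)\<^sup>2"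
    using m by (simp add: power4_eq_xxxx power2_eq_square)
  ultimately have e4: "expectation (\<lambda>t. u t ^ 4) \<le> 9"
    using m by (simp add: u_def power_divide divide_le_eq power_mult_distrib)
  have "2/25 \<le> expectation u + (4/5) * expectation (\<lambda>t. (u t)\<^sup>2) - (2/25) * expectation (\<lambda>t. u t ^ 4)"
    using e1 e2 e4 by simp
  also have "\<dots> = expectation (\<lambda>t. u t + (4/5) * (u t)\<^sup>2 - (2/25) * u t ^ 4)"
    using int[where g = "\<lambda>x. x"] int[where g = "\<lambda>x. x\<^sup>2"] int[where g = "\<lambda>x. x ^ 4"] by simp
  also have "\<dots> \<le> expectation (\<lambda>t. 7/200 + 5 * of_bool (1/32 \<le> u t))"
    by (rule integral_mono[OF _ _ quartic_le])
       (rule int[where g = "\<lambda>x. x + (4/5) * x\<^sup>2 - (2/25) * x ^ 4"],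
        rule int[where g = "\<lambda>x. 7/200 + 5 * of_bool (1/32 \<le> x)"])
  also have "\<dots> = 7/200 + 5 * expectation (\<lambda>t. of_bool (1/32 \<le> u t))"
    using int[where g = "\<lambda>x. of_bool (1/32 \<le> x)"] by simp
  also have "expectation (\<lambda>t. of_bool (1/32 \<le> u t)) = prob (\<lambda>t. 1/32 \<le> u t)"
    by (rule prob_eq_expectation[OF su[where g = "\<lambda>x. x"], symmetric])
  also have "\<dots> = prob (\<lambda>t. sqrt (real m) / 32 \<le> S t)"
    using m by (simp add: u_def field_simps)
  finally show ?thesis
    by (simp add: S_def)
qed

text \<open>Indices start at 2 because r_1 is constant almost everywhere. A product of two disjoint
  intervals makes the chaos a product of two independent Rademacher sums.\<close>

definition chaos_block :: "nat \<Rightarrow> (nat \<times> nat) set" where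
  "chaos_block q = {2..<2 + 4 ^ q} \<times> {2 + 4 ^ q..<2 + 4 ^ q + 4 ^ q}"

definition block_chaos :: "nat \<Rightarrow> real \<Rightarrow> real" where
  "block_chaos q = chaos_poly (chaos_block q) (\<lambda>_. 1 / 4 ^ q)"

lemma finite_chaos_block [simp]: "finite (chaos_block q)"
  by (simp add: chaos_block_def)

lemma chaos_block_subset: "chaos_block q \<subseteq> chaos_index"
  by (auto simp: chaos_block_def chaos_index_def)

lemma card_chaos_block: "card (chaos_block q) = 4 ^ q * 4 ^ q"
  by (simp add: chaos_block_def card_cartesian_product)

lemma block_chaos_simple: "simple_function borel (block_chaos q)"
  unfolding block_chaos_def by (rule chaos_poly_simple)

lemma block_chaos_eq:
  "block_chaos q t = rad_sum {2..<2 + 4 ^ q} t * rad_sum {2 + 4 ^ q..<2 + 4 ^ q + 4 ^ q} t / 4 ^ q"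
  unfolding block_chaos_def chaos_poly_def rad_sum_def chaos_block_def chaos_fun_def
  by (simp only: sum_product sum.cartesian_product sum_divide_distrib case_prod_unfold) (rule sum.cong; simp)

lemma prob_block_chaos:
  assumes "\<And>a. 2 \<le> a \<Longrightarrow> \<delta> \<le> prob (\<lambda>t. s \<le> rad_sum {a..<a + 4 ^ q} t)" "0 \<le> \<delta>" "0 \<le> s"
  shows "\<delta>\<^sup>2 \<le> prob (\<lambda>t. s\<^sup>2 / 4 ^ q \<le> block_chaos q t)"
proof -
  have "\<delta>\<^sup>2 \<le> prob (\<lambda>t. s \<le> rad_sum {2..<2 + 4 ^ q} t)
      * prob (\<lambda>t. s \<le> rad_sum {2 + 4 ^ q..<2 + 4 ^ q + 4 ^ q} t)"
    unfolding power2_eq_square using assms by (intro mult_mono assms) auto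
  also have "\<dots> = prob (\<lambda>t. s \<le> rad_sum {2..<2 + 4 ^ q} t
      \<and> s \<le> rad_sum {2 + 4 ^ q..<2 + 4 ^ q + 4 ^ q} t)"
    by (intro prob_rad_sum_indep[symmetric]) auto
  also have "\<dots> \<le> prob (\<lambda>t. s\<^sup>2 / 4 ^ q \<le> block_chaos q t)"
    using assms(3) by (intro prob_mono[OF block_chaos_simple])
      (auto simp: block_chaos_eq power2_eq_square intro!: divide_right_mono mult_mono)
  finally show ?thesis .
qed

text \<open>Each of the two sums is cut into \<open>4 ^ p\<close> blocks of length
  \<open>4 ^ (q - p)\<close>, each exceeding \<open>2 ^ (q - p) / 32\<close> with probability at
  least 1/125. After the product and the normalisation the level no longer depends on
  \<open>q\<close>.\<close>

lemma prob_block_chaos_tail: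
  assumes "p \<le> q"
  shows "(1 / 125) ^ (2 * 4 ^ p) \<le> prob (\<lambda>t. 4 ^ p / 1024 \<le> block_chaos q t)"
proof -
  have q: "(4::nat) ^ p * 4 ^ (q - p) = 4 ^ q"
    using assms by (simp flip: power_add)
  have "((1 / 125) ^ 4 ^ p)\<^sup>2 \<le> prob (\<lambda>t. (4 ^ p * 2 ^ (q - p) / 32)\<^sup>2 / 4 ^ q \<le> block_chaos q t)"
  proof (rule prob_block_chaos)
    fix a :: nat assume a: "2 \<le> a"
    have "sqrt (real (4 ^ (q - p))) = 2 ^ (q - p)"
      by (simp add: real_sqrt_power)
    then have "(1 / 125) ^ 4 ^ p \<le> prob (\<lambda>t. real (4 ^ p) * (2 ^ (q - p) / 32)
        \<le> rad_sum {a..<a + 4 ^ p * 4 ^ (q - p)} t)"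
      using prob_rad_sum_base[of _ "4 ^ (q - p)"] a by (intro prob_rad_sum_blocks) auto
    then show "(1 / 125) ^ 4 ^ p \<le> prob (\<lambda>t. 4 ^ p * 2 ^ (q - p) / 32 \<le> rad_sum {a..<a + 4 ^ q} t)"
      by (simp add: q)
  qed auto
  moreover have "(4 ^ p * 2 ^ (q - p) / 32)\<^sup>2 / 4 ^ q = (4 ^ p / 1024 :: real)"
  proof -
    have "(2 ^ (q - p))\<^sup>2 = (4::real) ^ (q - p)"
      by (simp add: power2_eq_square flip: power_mult_distrib)
    then have "(4::real) ^ q = 4 ^ p * (2 ^ (q - p))\<^sup>2"
      using assms by (simp flip: power_add)
    then show ?thesis
      by (simp add: field_simps power2_eq_square)
  qed
  moreover have "((1 / 125 :: real) ^ 4 ^ p)\<^sup>2 = (1 / 125) ^ (2 * 4 ^ p)"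
    by (simp only: power_mult[symmetric] mult.commute)
  ultimately show ?thesis
    by simp
qed

text \<open>The event that all \<open>2 * 4 ^ q\<close> signs are positive.\<close>

lemma prob_block_chaos_max: "(1 / 4) ^ 4 ^ q \<le> prob (\<lambda>t. 4 ^ q \<le> block_chaos q t)"
proof -
  have "((1 / 2) ^ 4 ^ q)\<^sup>2 \<le> prob (\<lambda>t. (4 ^ q)\<^sup>2 / 4 ^ q \<le> block_chaos q t)"
    using prob_rad_sum_max[of _ "4 ^ q"] by (intro prob_block_chaos) auto
  moreover have "((1 / 2) ^ 4 ^ q)\<^sup>2 = (1 / 4 :: real) ^ 4 ^ q"
    by (simp add: power2_eq_square flip: power_mult_distrib)
  ultimately show ?thesis
    by (simp add: power2_eq_square)
qed

section \<open>Sign changes by Hadamard matrices\<close>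

declare sum.op_ivl_Suc [simp del]

lemma fact_double_ge: "2 ^ n * fact n \<le> (fact (2 * n) :: real)"
proof (induction n)
  case (Suc n)
  have "2 ^ Suc n * fact (Suc n) = (2 * (real n + 1)) * (2 ^ n * fact n)"
    by (simp add: algebra_simps)
  also have "\<dots> \<le> ((2 * real n + 2) * (2 * real n + 1)) * fact (2 * n)"
    by (intro mult_mono Suc.IH) (auto simp: algebra_simps)
  also have "\<dots> = fact (2 * Suc n)"
    by (simp add: algebra_simps)
  finally show ?case .
qed simp

text \<open>Term by term, since (2m)! >= 2^m m!.\<close>

lemma cosh_le_exp_square: "cosh x \<le> exp (x\<^sup>2 / 2)" for x :: real
proof -
  have exp: "(\<lambda>n. (x\<^sup>2 / 2) ^ n /\<^sub>R fact n) sums exp (x\<^sup>2 / 2)"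
    by (rule exp_converges)
  have le: "x ^ (2 * m) / fact (2 * m) \<le> (x\<^sup>2 / 2) ^ m /\<^sub>R fact m" for m
  proof -
    have "x ^ (2 * m) / fact (2 * m) \<le> x ^ (2 * m) / (2 ^ m * fact m)"
      by (intro divide_left_mono fact_double_ge mult_pos_pos zero_le_even_power) auto
    moreover have "(x\<^sup>2 / 2) ^ m = x ^ (2 * m) / 2 ^ m"
      by (metis power_divide power_mult)
    then have "(x\<^sup>2 / 2) ^ m /\<^sub>R fact m = x ^ (2 * m) / (2 ^ m * fact m)"
      by (simp only: real_scaleR_def divide_inverse inverse_mult_distrib mult_ac)
    ultimately show ?thesis
      by (simp only:)
  qed
  show ?thesis
    by (rule sums_le[OF le cosh_even_sums exp])
qed

text \<open>A sub-Gaussian bound conditional on the later signs: the coefficients \<open>h\<close>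
  are unaffected by the translations for the summation range, so each sign is averaged with its
  coefficient frozen, which gives a cosh. The weight \<open>\<Phi>\<close> is there for the
  induction.\<close>

lemma expectation_exp_rademacher_le:
  assumes "2 \<le> k"
    and "\<And>i j. k \<le> i \<Longrightarrow> i < n \<Longrightarrow> k \<le> j \<Longrightarrow> j < n \<Longrightarrow> shift_inv i (h j)"
    and "\<And>i. k \<le> i \<Longrightarrow> i < n \<Longrightarrow> shift_inv i \<Phi>" and "simple_function borel \<Phi>" and "\<And>t. 0 \<le> \<Phi> t"
  shows "expectation (\<lambda>t. \<Phi> t * exp (\<Sum>i\<in>{k..<n}. rademacher i t * h i t))
    \<le> expectation (\<lambda>t. \<Phi> t * exp ((\<Sum>i\<in>{k..<n}. (h i t)\<^sup>2) / 2))"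
  using assms
proof (induction "n - k" arbitrary: k \<Phi>)
  case 0
  then show ?case
    by simp
next
  case (Suc d)
  then have k: "k < n" "d = n - Suc k" "2 \<le> Suc k" "1 \<le> k"
    by auto
  note inv = Suc.prems(2) and \<Phi> = Suc.prems(3-5)
  define R where "R t = (\<Sum>i\<in>{Suc k..<n}. rademacher i t * h i t)" for t
  have invR: "shift_inv k R"
    unfolding R_def using k inv
    by (intro shift_inv_sum shift_inv_compose2[where F = "(*)"] shift_inv_rademacher) auto
  have inv1: "shift_inv k (\<lambda>t. (\<Phi> t, h k t))"
    using k inv \<Phi> by (intro shift_inv_compose2[where F = Pair]) auto
  have inv3: "shift_inv k (\<lambda>t. G (\<Phi> t) (h k t) (R t))" for G :: "real \<Rightarrow> real \<Rightarrow> real \<Rightarrow> real"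
    using shift_inv_compose2[OF inv1 invR, of "\<lambda>(x, y) z. G x y z"] by simp
  have int3: "integrable unit_measure (\<lambda>t. G (\<Phi> t) (h k t) (R t))" for G :: "real \<Rightarrow> real \<Rightarrow> real \<Rightarrow> real"
    by (rule integrable_simple_unit[OF shift_inv_simple[OF inv3]])
  \<comment> \<open>The factor released by averaging r_k joins the weight for the remaining
    signs.\<close>
  define \<Psi> where "\<Psi> t = \<Phi> t * exp ((h k t)\<^sup>2 / 2)" for t
  have "expectation (\<lambda>t. \<Phi> t * exp (\<Sum>i\<in>{k..<n}. rademacher i t * h i t))
      = expectation (\<lambda>t. \<Phi> t * exp (rademacher k t * h k t + R t))"
    using k by (simp add: interval_insert R_def)
  also have "\<dots> = (expectation (\<lambda>t. \<Phi> t * exp (1 * h k t + R t))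
      + expectation (\<lambda>t. \<Phi> t * exp (- 1 * h k t + R t))) / 2"
  proof (rule expectation_average[where F = "\<lambda>r t. \<Phi> t * exp (r * h k t + R t)", OF Suc.prems(1)])
    show "shift_inv k (\<lambda>t. \<Phi> t * exp (1 * h k t + R t))" "shift_inv k (\<lambda>t. \<Phi> t * exp (- 1 * h k t + R t))"
      using inv3[of "\<lambda>x y z. x * exp (1 * y + z)"] inv3[of "\<lambda>x y z. x * exp (- 1 * y + z)"] by auto
    show "(\<lambda>t. \<Phi> t * exp (rademacher k t * h k t + R t)) \<in> borel_measurable unit_measure"
      using simple_borel_unit[OF rademacher_simple[of k]] simple_borel_unit[OF shift_inv_simple[OF invR]]
        simple_borel_unit[OF \<Phi>(2)] simple_borel_unit[OF shift_inv_simple[OF inv[of k k]]] k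
      by measurable
  qed
  also have "\<dots> = expectation (\<lambda>t. (\<Phi> t * exp (1 * h k t + R t) + \<Phi> t * exp (- 1 * h k t + R t)) / 2)"
    using int3[of "\<lambda>x y z. x * exp (1 * y + z)"] int3[of "\<lambda>x y z. x * exp (- 1 * y + z)"] by simp
  also have "\<dots> = expectation (\<lambda>t. \<Phi> t * cosh (h k t) * exp (R t))"
    by (intro Bochner_Integration.integral_cong) (simp_all add: cosh_def exp_add exp_diff exp_minus field_simps)
  also have "\<dots> \<le> expectation (\<lambda>t. \<Psi> t * exp (R t))"
    using cosh_le_exp_square \<Phi>(3) unfolding \<Psi>_def
    by (intro integral_mono int3[of "\<lambda>x y z. x * cosh y * exp z"] int3[of "\<lambda>x y z. x * exp (y\<^sup>2 / 2) * exp z"]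
        mult_right_mono mult_left_mono) auto
  also have "\<dots> \<le> expectation (\<lambda>t. \<Psi> t * exp ((\<Sum>i\<in>{Suc k..<n}. (h i t)\<^sup>2) / 2))"
    unfolding R_def
  proof (rule Suc.hyps(1)[OF k(2,3)])
    show "shift_inv i (h j)" if "Suc k \<le> i" "i < n" "Suc k \<le> j" "j < n" for i j
      using that inv by auto
    show "shift_inv i \<Psi>" if "Suc k \<le> i" "i < n" for i
      unfolding \<Psi>_def using that k inv \<Phi>
      by (intro shift_inv_compose2[where F = "\<lambda>x y. x * exp (y\<^sup>2 / 2)"]) auto
    show "simple_function borel \<Psi>"
      unfolding \<Psi>_def using k inv[of k k] \<Phi>
      by (intro simple_function_compose2[where h = "\<lambda>x y. x * exp (y\<^sup>2 / 2)"] shift_inv_simple[of k]) auto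
    show "0 \<le> \<Psi> t" for t
      using \<Phi> by (simp add: \<Psi>_def)
  qed
  also have "\<dots> = expectation (\<lambda>t. \<Phi> t * exp ((\<Sum>i\<in>{k..<n}. (h i t)\<^sup>2) / 2))"
    using k by (simp add: interval_insert \<Psi>_def add_divide_distrib exp_add mult_ac)
  finally show ?case .
qed

lemma sum_lessThan_add: "(\<Sum>i<n + m. f i) = (\<Sum>i<n. f i) + (\<Sum>i<m. f (n + i))"
  for f :: "nat \<Rightarrow> real"
  by (induction m) (simp_all add: add_ac)

text \<open>Sylvester's doubling. Orthogonality is recorded as a scaled isometry, the form in which
  it is applied to the vector of signs of the second block.\<close>

lemma hadamard_exists:
  "\<exists>w :: nat \<Rightarrow> nat \<Rightarrow> real. (\<forall>i j. w i j = 1 \<or> w i j = -1) \<and>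
    (\<forall>y. (\<Sum>i<2 ^ k. (\<Sum>j<2 ^ k. w i j * y j)\<^sup>2) = 2 ^ k * (\<Sum>j<2 ^ k. (y j)\<^sup>2))"
proof (induction k)
  case 0
  show ?case
    by (rule exI[of _ "\<lambda>_ _. 1"]) simp
next
  case (Suc k)
  then obtain w :: "nat \<Rightarrow> nat \<Rightarrow> real" where sign: "\<And>i j. w i j = 1 \<or> w i j = -1"
    and iso: "\<And>y. (\<Sum>i<2 ^ k. (\<Sum>j<2 ^ k. w i j * y j)\<^sup>2) = 2 ^ k * (\<Sum>j<2 ^ k. (y j)\<^sup>2)"
    by blast
  define n :: nat where "n = 2 ^ k"
  \<comment> \<open>The block matrix with blocks w, w, w, -w; the remainders mod \<open>n\<close>
    make every entry a sign, also outside the matrix.\<close>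
  define w' where "w' i j = (if n \<le> i \<and> n \<le> j then - w (i mod n) (j mod n) else w (i mod n) (j mod n))" for i j
  have "(\<Sum>i<2 ^ Suc k. (\<Sum>j<2 ^ Suc k. w' i j * y j)\<^sup>2) = 2 ^ Suc k * (\<Sum>j<2 ^ Suc k. (y j)\<^sup>2)" for y
  proof -
    define A where "A i = (\<Sum>j<n. w i j * y j)" for i
    define B where "B i = (\<Sum>j<n. w i j * y (n + j))" for i
    have upper: "(\<Sum>j<n + n. w' i j * y j) = A i + B i"
      and lower: "(\<Sum>j<n + n. w' (n + i) j * y j) = A i - B i" if "i < n" for i
      using that by (simp_all add: sum_lessThan_add w'_def A_def B_def sum_negf[symmetric])
    have "(\<Sum>i<n + n. (\<Sum>j<n + n. w' i j * y j)\<^sup>2)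
        = (\<Sum>i<n. (\<Sum>j<n + n. w' i j * y j)\<^sup>2) + (\<Sum>i<n. (\<Sum>j<n + n. w' (n + i) j * y j)\<^sup>2)"
      by (rule sum_lessThan_add)
    also have "\<dots> = (\<Sum>i<n. (A i + B i)\<^sup>2) + (\<Sum>i<n. (A i - B i)\<^sup>2)"
      by (simp add: upper lower)
    also have "\<dots> = 2 * ((\<Sum>i<n. (A i)\<^sup>2) + (\<Sum>i<n. (B i)\<^sup>2))"
      by (simp add: sum.distrib[symmetric] sum_distrib_left power2_eq_square algebra_simps)
    also have "\<dots> = 2 * (real n * (\<Sum>j<n. (y j)\<^sup>2) + real n * (\<Sum>j<n. (y (n + j))\<^sup>2))"
      using iso[of y] iso[of "\<lambda>j. y (n + j)"] by (simp add: A_def B_def n_def)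
    also have "\<dots> = 2 * real n * (\<Sum>j<n + n. (y j)\<^sup>2)"
      by (simp add: sum_lessThan_add algebra_simps)
    finally show ?thesis
      by (simp add: n_def mult_2[symmetric])
  qed
  moreover have "w' i j = 1 \<or> w' i j = -1" for i j
    using sign[of "i mod n" "j mod n"] by (auto simp: w'_def)
  ultimately show ?case
    by blast
qed

definition hadamard :: "nat \<Rightarrow> nat \<Rightarrow> nat \<Rightarrow> real" where
  "hadamard k = (SOME w. (\<forall>i j. w i j = 1 \<or> w i j = -1) \<and>
    (\<forall>y. (\<Sum>i<2 ^ k. (\<Sum>j<2 ^ k. w i j * y j)\<^sup>2) = 2 ^ k * (\<Sum>j<2 ^ k. (y j)\<^sup>2)))"

lemma hadamard_sign: "hadamard k i j = 1 \<or> hadamard k i j = -1"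
  and hadamard_isometry:
    "(\<Sum>i<2 ^ k. (\<Sum>j<2 ^ k. hadamard k i j * y j)\<^sup>2) = 2 ^ k * (\<Sum>j<2 ^ k. (y j)\<^sup>2)"
  using someI_ex[OF hadamard_exists[of k]] unfolding hadamard_def by auto

text \<open>The order \<open>2 ^ (2 * q)\<close> is the side length \<open>4 ^ q\<close> of the
  block, and the subtractions renumber rows and columns from 0.\<close>

definition block_signs :: "nat \<Rightarrow> nat \<times> nat \<Rightarrow> real" where
  "block_signs q p = hadamard (2 * q) (fst p - 2) (snd p - (2 + 4 ^ q))"

definition signed_block_chaos :: "nat \<Rightarrow> real \<Rightarrow> real" where
  "signed_block_chaos q = chaos_poly (chaos_block q) (\<lambda>p. block_signs q p / 4 ^ q)"

lemma block_signs_sign: "block_signs q p = 1 \<or> block_signs q p = -1"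
  unfolding block_signs_def by (rule hadamard_sign)

lemma signed_block_chaos_simple: "simple_function borel (signed_block_chaos q)"
  unfolding signed_block_chaos_def by (rule chaos_poly_simple)

text \<open>The coefficient of r_i for frozen signs of the second block.\<close>

definition block_row :: "nat \<Rightarrow> nat \<Rightarrow> real \<Rightarrow> real" where
  "block_row q i t = (\<Sum>j\<in>{2 + 4 ^ q..<2 + 4 ^ q + 4 ^ q}. block_signs q (i, j) * rademacher j t) / 4 ^ q"

lemma signed_block_chaos_eq:
  "signed_block_chaos q t = (\<Sum>i\<in>{2..<2 + 4 ^ q}. rademacher i t * block_row q i t)"
  unfolding signed_block_chaos_def chaos_poly_def chaos_block_def chaos_fun_def block_row_def
  by (simp only: sum.cartesian_product[symmetric] sum_distrib_left sum_divide_distrib case_prod_unfold)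
     (simp add: sum.cartesian_product sum_distrib_left sum_divide_distrib mult_ac
        case_prod_unfold)

text \<open>The purpose of the Hadamard signs: this bound holds at every point, not merely on
  average, so that the conditional variance never exceeds 1. For constant signs it can be as large
  as \<open>4 ^ q\<close>.\<close>

lemma block_row_square_sum: "(\<Sum>i\<in>{2..<2 + 4 ^ q}. (block_row q i t)\<^sup>2) \<le> 1"
proof -
  define n :: nat where "n = 4 ^ q"
  have n2: "2 ^ (2 * q) = n"
    by (simp add: n_def power_mult)
  have shift: "(\<Sum>j\<in>{a..<a + n}. f j) = (\<Sum>j<n. f (j + a))" for a and f :: "nat \<Rightarrow> real"
    using sum.shift_bounds_nat_ivl[of f 0 a n] by (simp add: lessThan_atLeast0 add.commute)
  have "(\<Sum>i\<in>{2..<2 + n}. (block_row q i t)\<^sup>2)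
      = (\<Sum>i<n. (\<Sum>j<n. hadamard (2 * q) i j * rademacher (j + (2 + n)) t)\<^sup>2) / (real n)\<^sup>2"
    unfolding block_row_def n_def[symmetric] shift block_signs_def
    by (simp add: power_divide sum_divide_distrib[symmetric] n_def)
  also have "\<dots> = real n * (\<Sum>j<n. (rademacher (j + (2 + n)) t)\<^sup>2) / (real n)\<^sup>2"
  proof -
    have "(2::real) ^ (2 * q) = real n"
      by (simp add: n_def power_mult)
    then show ?thesis
      using hadamard_isometry[of "2 * q" "\<lambda>j. rademacher (j + (2 + n)) t"] by (simp only: n2)
  qed
  also have "\<dots> \<le> real n * (\<Sum>j<n. 1) / (real n)\<^sup>2"
    by (intro divide_right_mono mult_left_mono sum_mono) (auto simp: abs_square_le_1 abs_rademacher_le_1)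
  also have "\<dots> = 1"
    by (simp add: n_def power2_eq_square)
  finally show ?thesis
    by (simp add: n_def)
qed

text \<open>Cauchy-Schwarz over the rows. Since \<open>block_chaos q\<close> reaches
  \<open>4 ^ q\<close>, the signs reduce the maximum to its square root.\<close>

lemma abs_signed_block_chaos_le: "\<bar>signed_block_chaos q t\<bar> \<le> 2 ^ q"
proof -
  have "(signed_block_chaos q t)\<^sup>2
      \<le> (\<Sum>i\<in>{2..<2 + 4 ^ q}. (rademacher i t)\<^sup>2) * (\<Sum>i\<in>{2..<2 + 4 ^ q}. (block_row q i t)\<^sup>2)"
    unfolding signed_block_chaos_eq by (rule Cauchy_Schwarz_ineq_sum)
  also have "\<dots> \<le> (\<Sum>i::nat\<in>{2..<2 + 4 ^ q}. 1) * 1"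
    by (intro mult_mono sum_mono block_row_square_sum)
       (auto simp: abs_square_le_1 abs_rademacher_le_1 intro: sum_nonneg)
  also have "\<dots> = (2 ^ q)\<^sup>2"
    by (simp add: power2_eq_square flip: power_mult_distrib)
  finally show ?thesis
    by (metis abs_le_square_iff abs_of_nonneg zero_le_numeral zero_le_power)
qed

lemma expectation_exp_signed_block_chaos:
  "expectation (\<lambda>t. exp (c * signed_block_chaos q t)) \<le> exp (c\<^sup>2 / 2)"
proof -
  let ?h = "\<lambda>i t. c * block_row q i t"
  have inv: "shift_inv i (?h j)" if "2 \<le> i" "i < 2 + 4 ^ q" for i j
    unfolding block_row_def using that
    by (intro shift_inv_compose[where F = "\<lambda>x. c * (x / 4 ^ q)"] shift_inv_sum
        shift_inv_compose[where F = "\<lambda>x. _ * x"] shift_inv_rademacher) auto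
  have s: "simple_function borel (block_row q i)" for i
    unfolding block_row_def
    by (rule simple_function_compose1[where g = "\<lambda>x. x / 4 ^ q"])
       (intro simple_function_sum simple_function_mult simple_function_const rademacher_simple)
  have "expectation (\<lambda>t. exp (c * signed_block_chaos q t))
      = expectation (\<lambda>t. 1 * exp (\<Sum>i\<in>{2..<2 + 4 ^ q}. rademacher i t * ?h i t))"
    by (simp add: signed_block_chaos_eq sum_distrib_left mult_ac)
  also have "\<dots> \<le> expectation (\<lambda>t. 1 * exp ((\<Sum>i\<in>{2..<2 + 4 ^ q}. (?h i t)\<^sup>2) / 2))"
    by (rule expectation_exp_rademacher_le) (auto intro!: inv shift_inv_const)
  also have "\<dots> \<le> expectation (\<lambda>t. exp (c\<^sup>2 / 2))"
  proof (rule integral_mono)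
    show "integrable unit_measure (\<lambda>t. 1 * exp ((\<Sum>i\<in>{2..<2 + 4 ^ q}. (?h i t)\<^sup>2) / 2))"
      by (intro integrable_simple_unit simple_function_compose1[where g = "\<lambda>x. 1 * exp (x / 2)"]
          simple_function_sum simple_function_compose1[where g = "\<lambda>x. (c * x)\<^sup>2"] s)
    show "1 * exp ((\<Sum>i\<in>{2..<2 + 4 ^ q}. (?h i t)\<^sup>2) / 2) \<le> exp (c\<^sup>2 / 2)" for t
      using mult_left_mono[OF block_row_square_sum[of q t], of "c\<^sup>2"]
      by (simp add: power_mult_distrib sum_distrib_left)
  qed (simp add: integrable_simple_unit)
  finally show ?thesis
    by simp
qed

text \<open>Chernoff's bound with the optimal parameter \<open>s\<close>, for both signs at
  once.\<close>

lemma prob_signed_block_chaos_gaussian: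
  assumes "0 \<le> s"
  shows "prob (\<lambda>t. s \<le> \<bar>signed_block_chaos q t\<bar>) \<le> 2 * exp (- s\<^sup>2 / 2)"
proof -
  let ?g = "signed_block_chaos q"
  have int: "integrable unit_measure (\<lambda>t. G (?g t))" for G :: "real \<Rightarrow> real"
    by (rule integrable_simple_unit[OF simple_function_compose1[OF signed_block_chaos_simple]])
  have ptw: "of_bool (s \<le> \<bar>x\<bar>) \<le> exp (- s\<^sup>2) * (exp (s * x) + exp (- s * x))" for x
  proof (cases "s \<le> \<bar>x\<bar>")
    case True
    have "s\<^sup>2 \<le> s * \<bar>x\<bar>"
      using True assms by (simp add: power2_eq_square mult_left_mono)
    then have "1 \<le> exp (- s\<^sup>2) * exp (s * \<bar>x\<bar>)"
      by (simp flip: exp_add)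
    also have "\<dots> \<le> exp (- s\<^sup>2) * (exp (s * x) + exp (- s * x))"
      by (intro mult_left_mono) (auto simp: abs_if)
    finally show ?thesis
      using True by simp
  qed simp
  have "prob (\<lambda>t. s \<le> \<bar>?g t\<bar>) = expectation (\<lambda>t. of_bool (s \<le> \<bar>?g t\<bar>))"
    by (rule prob_eq_expectation[OF signed_block_chaos_simple])
  also have "\<dots> \<le> expectation (\<lambda>t. exp (- s\<^sup>2) * (exp (s * ?g t) + exp (- s * ?g t)))"
    by (rule integral_mono[OF _ _ ptw])
       (rule int[of "\<lambda>x. of_bool (s \<le> \<bar>x\<bar>)"], rule int[of "\<lambda>x. exp (- s\<^sup>2) * (exp (s * x) + exp (- s * x))"])
  also have "\<dots> = exp (- s\<^sup>2) * (expectation (\<lambda>t. exp (s * ?g t)) + expectation (\<lambda>t. exp (- s * ?g t)))"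
    using int[of "\<lambda>x. exp (s * x)"] int[of "\<lambda>x. exp (- s * x)"] by simp
  also have "\<dots> \<le> exp (- s\<^sup>2) * (exp (s\<^sup>2 / 2) + exp ((- s)\<^sup>2 / 2))"
    by (intro mult_left_mono add_mono expectation_exp_signed_block_chaos) auto
  also have "\<dots> = 2 * exp (- s\<^sup>2 / 2)"
    by (simp flip: exp_add)
  finally show ?thesis .
qed

text \<open>The right side is chosen to match \<open>prob_block_chaos_max\<close> at k - 1. With N =
  \<open>4 ^ (k - 1)\<close> the Gaussian bound is 2 e^(-2N); since e^2 >= 5 there is room (5/4)^N
  for the factor 2, and \<open>2 \<le> k\<close> gives N >= 4.\<close>

lemma prob_signed_block_chaos_tail:
  assumes "2 \<le> k"
  shows "prob (\<lambda>t. 2 ^ k \<le> \<bar>signed_block_chaos q t\<bar>) \<le> (1 / 4) ^ 4 ^ (k - 1)"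
proof -
  define N :: nat where "N = 4 ^ (k - 1)"
  have "(4::nat) ^ 1 \<le> N"
    unfolding N_def using assms by (intro power_increasing) auto
  then have "(5 / 4 :: real) ^ 4 \<le> (5 / 4) ^ N"
    by (intro power_increasing) auto
  moreover have "2 \<le> (5 / 4 :: real) ^ 4"
    by (simp add: power_divide)
  ultimately have N: "2 \<le> (5 / 4 :: real) ^ N"
    by linarith
  have "(5::real) \<le> exp 2"
    using exp_lower_Taylor_quadratic[of "2::real"] by simp
  then have "5 ^ N \<le> exp (2::real) ^ N"
    by (intro power_mono) auto
  moreover have "2 * 4 ^ N \<le> (5::real) ^ N"
    using N by (simp add: power_divide field_simps)
  ultimately have e: "2 * 4 ^ N \<le> exp (2 * real N)"
    by (simp add: exp_of_nat2_mult)
  have "((2::real) ^ k)\<^sup>2 = 4 ^ k"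
    by (simp add: power2_eq_square flip: power_mult_distrib)
  also have "\<dots> = 4 * real N"
    unfolding N_def using assms by (cases k) auto
  finally have "2 * exp (- ((2 ^ k)\<^sup>2) / 2) = 2 / exp (2 * real N)"
    by (simp add: exp_minus field_simps)
  also have "\<dots> \<le> (1 / 4) ^ N"
    using e by (simp add: power_divide field_simps)
  finally show ?thesis
    using prob_signed_block_chaos_gaussian[of "2 ^ k" q] by (simp add: N_def)
qed

section \<open>Rearrangements and symmetric spaces\<close>

lemma unit_sets_greater:
  fixes x :: "real \<Rightarrow> real"
  shows "x \<in> borel_measurable unit_measure \<Longrightarrow> {t \<in> {0..1}. s < \<bar>x t\<bar>} \<in> sets unit_measure"
  using borel_measurable_abs[of x unit_measure] borel_measurable_iff_greater[of "\<lambda>t. \<bar>x t\<bar>" unit_measure] by simp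

lemma unit_sets_ge:
  fixes x :: "real \<Rightarrow> real"
  shows "x \<in> borel_measurable unit_measure \<Longrightarrow> {t \<in> {0..1}. s \<le> \<bar>x t\<bar>} \<in> sets unit_measure"
  using borel_measurable_abs[of x unit_measure] borel_measurable_iff_ge[of "\<lambda>t. \<bar>x t\<bar>" unit_measure] by simp

lemma measure_unit_interval:
  assumes "0 \<le> a" "a \<le> b" "b \<le> 1"
  shows "measure unit_measure {a..b} = b - a" "measure unit_measure {a<..<b} = b - a"
proof -
  have "{a..b} \<subseteq> {0..1}" "{a<..<b} \<subseteq> {0..1}"
    using assms by auto
  then show "measure unit_measure {a..b} = b - a" "measure unit_measure {a<..<b} = b - a"
    using assms by (simp_all add: measure_restrict_space)
qed

lemma interval_sets_unit:
  assumes "0 \<le> a" "b \<le> 1"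
  shows "{a..b} \<in> sets unit_measure" "{a<..<b} \<in> sets unit_measure"
  using assms by (auto simp: sets_restrict_space_iff)

lemma prob_le_1: "prob P \<le> 1"
  using finite_measure.bounded_measure[OF finite_unit, of "{t \<in> {0..1}. P t}"]
  by simp

section \<open>Distribution functions and decreasing rearrangement\<close>

definition distr_fun :: "(real \<Rightarrow> real) \<Rightarrow> real \<Rightarrow> real" where
  "distr_fun x s = prob (\<lambda>t. s < \<bar>x t\<bar>)"

text \<open>The value at 0 is set to 0: for an unbounded function no level has distribution 0, and
  the infimum would be over the empty set.\<close>

definition rearrangement :: "(real \<Rightarrow> real) \<Rightarrow> real \<Rightarrow> real" where
  "rearrangement x t = (if 0 < t \<and> t \<le> 1 then Inf {s. 0 \<le> s \<and> distr_fun x s \<le> t} else 0)"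

lemma distr_fun_le_1: "distr_fun x s \<le> 1"
  unfolding distr_fun_def by (rule prob_le_1)

lemma distr_fun_antimono:
  assumes "x \<in> borel_measurable unit_measure" "s \<le> s'"
  shows "distr_fun x s' \<le> distr_fun x s"
  unfolding distr_fun_def
  using assms by (intro finite_measure.finite_measure_mono[OF finite_unit] unit_sets_greater) auto

text \<open>Continuity of the measure along the sets where |x| exceeds s + 1/(n + 1). It is what
  makes the strict equivalence in \<open>rearrangement_greater_iff\<close> hold.\<close>

lemma distr_fun_right_continuous:
  assumes x: "x \<in> borel_measurable unit_measure" and t: "t < distr_fun x s"
  obtains s' where "s < s'" "t < distr_fun x s'"
proof -
  define A where "A n = {r \<in> {0..1}. s + 1 / real (Suc n) < \<bar>x r\<bar>}" for n
  have "(\<lambda>n. measure unit_measure (A n)) \<longlonglongrightarrow> measure unit_measure (\<Union>n. A n)"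
  proof (rule finite_measure.finite_Lim_measure_incseq[OF finite_unit])
    show "incseq A"
    proof (rule incseq_SucI)
      fix n
      have "1 / real (Suc (Suc n)) \<le> 1 / real (Suc n)"
        by (simp add: frac_le)
      then show "A n \<le> A (Suc n)"
        unfolding A_def by force
    qed
    show "range A \<subseteq> sets unit_measure"
      unfolding A_def using x by (intro image_subsetI unit_sets_greater)
  qed
  also have "(\<Union>n. A n) = {r \<in> {0..1}. s < \<bar>x r\<bar>}"
  proof (intro equalityI subsetI)
    fix r assume "r \<in> (\<Union>n. A n)"
    then obtain n where n: "r \<in> {0..1}" "s + 1 / real (Suc n) < \<bar>x r\<bar>"
      by (auto simp: A_def)
    have "0 < 1 / real (Suc n)"
      by simp
    with n(2) have "s < \<bar>x r\<bar>"
      by linarith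
    with n(1) show "r \<in> {r \<in> {0..1}. s < \<bar>x r\<bar>}"
      by simp
  next
    fix r assume r: "r \<in> {r \<in> {0..1}. s < \<bar>x r\<bar>}"
    obtain n where "inverse (real (Suc n)) < \<bar>x r\<bar> - s"
      using reals_Archimedean[of "\<bar>x r\<bar> - s"] r by auto
    then have "r \<in> A n"
      using r by (simp add: A_def inverse_eq_divide)
    then show "r \<in> (\<Union>n. A n)"
      by blast
  qed
  finally have "(\<lambda>n. distr_fun x (s + 1 / real (Suc n))) \<longlonglongrightarrow> distr_fun x s"
    by (simp add: A_def distr_fun_def)
  then have "\<forall>\<^sub>F n in sequentially. t < distr_fun x (s + 1 / real (Suc n))"
    using t by (rule order_tendstoD)
  then obtain n where "t < distr_fun x (s + 1 / real (Suc n))"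
    by (auto simp: eventually_sequentially)
  then show ?thesis
    by (intro that[of "s + 1 / real (Suc n)"]) auto
qed

lemma distr_fun_eventually_small:
  assumes x: "x \<in> borel_measurable unit_measure" and t: "0 < t"
  obtains s where "0 \<le> s" "distr_fun x s \<le> t"
proof -
  define A where "A n = {r \<in> {0..1}. real n < \<bar>x r\<bar>}" for n
  have "(\<lambda>n. measure unit_measure (A n)) \<longlonglongrightarrow> measure unit_measure (\<Inter>n. A n)"
  proof (rule finite_measure.finite_Lim_measure_decseq[OF finite_unit])
    show "decseq A"
      by (rule decseq_SucI) (auto simp: A_def)
    show "range A \<subseteq> sets unit_measure"
      unfolding A_def using x by (intro image_subsetI unit_sets_greater)
  qed
  also have "(\<Inter>n. A n) = {}"
  proof -
    have "\<exists>n. r \<notin> A n" for r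
      using real_arch_simple[of "\<bar>x r\<bar>"] by (auto simp: A_def not_less)
    then show ?thesis
      by blast
  qed
  finally have "(\<lambda>n. distr_fun x (real n)) \<longlonglongrightarrow> 0"
    by (simp add: A_def distr_fun_def)
  then have "\<forall>\<^sub>F n in sequentially. distr_fun x (real n) < t"
    using t by (rule order_tendstoD)
  then obtain n where "distr_fun x (real n) < t"
    by (auto simp: eventually_sequentially)
  then show ?thesis
    by (intro that[of "real n"]) auto
qed

text \<open>The two functions are generalised inverses. Hence the level sets of the rearrangement
  are intervals from 0 whose length is the value of the distribution function.\<close>

lemma rearrangement_greater_iff:
  assumes x: "x \<in> borel_measurable unit_measure" and t: "0 < t" "t \<le> 1" and s: "0 \<le> s"
  shows "s < rearrangement x t \<longleftrightarrow> t < distr_fun x s"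
proof
  let ?S = "{s. 0 \<le> s \<and> distr_fun x s \<le> t}"
  have bdd: "bdd_below ?S"
    by (rule bdd_belowI[of _ 0]) auto
  show "t < distr_fun x s" if "s < rearrangement x t"
  proof (rule ccontr)
    assume "\<not> t < distr_fun x s"
    then have "Inf ?S \<le> s"
      using s by (intro cInf_lower bdd) auto
    then show False
      using that t by (simp add: rearrangement_def)
  qed
  assume "t < distr_fun x s"
  then obtain s' where s': "s < s'" "t < distr_fun x s'"
    using distr_fun_right_continuous[OF x] by blast
  have "s' \<le> Inf ?S"
  proof (rule cInf_greatest)
    show "?S \<noteq> {}"
      using distr_fun_eventually_small[OF x t(1)] by blast
    show "s' \<le> r" if "r \<in> ?S" for r
      using that s' distr_fun_antimono[OF x, of r s'] by force
  qed
  then show "s < rearrangement x t"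
    using s' t by (simp add: rearrangement_def)
qed

lemma rearrangement_nonneg:
  assumes "x \<in> borel_measurable unit_measure"
  shows "0 \<le> rearrangement x t"
  using distr_fun_eventually_small[OF assms]
  by (auto simp: rearrangement_def intro!: cInf_greatest)

lemma rearrangement_level_set:
  assumes x: "x \<in> borel_measurable unit_measure" and s: "0 \<le> s"
  shows "{t \<in> {0..1}. s < rearrangement x t} = {0<..<distr_fun x s}"
proof -
  have "s < rearrangement x t \<longleftrightarrow> 0 < t \<and> t < distr_fun x s" if "t \<in> {0..1}" for t
  proof (cases "t = 0")
    case True
    then show ?thesis
      using s by (simp add: rearrangement_def)
  next
    case False
    then show ?thesis
      using rearrangement_greater_iff[OF x _ _ s, of t] that by auto
  qed
  note level = this
  show ?thesis
  proof (intro set_eqI)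
    fix t
    show "t \<in> {t \<in> {0..1}. s < rearrangement x t} \<longleftrightarrow> t \<in> {0<..<distr_fun x s}"
      using level[of t] distr_fun_le_1[of x s] by (cases "t \<in> {0..1}") auto
  qed
qed

lemma distr_fun_nonneg: "0 \<le> distr_fun x s"
  by (simp add: distr_fun_def)

lemma rearrangement_measurable:
  assumes x: "x \<in> borel_measurable unit_measure"
  shows "rearrangement x \<in> borel_measurable unit_measure"
  unfolding borel_measurable_iff_greater
proof
  fix s
  show "{t \<in> space unit_measure. s < rearrangement x t} \<in> sets unit_measure"
  proof (cases "0 \<le> s")
    case True
    then show ?thesis
      using rearrangement_level_set[OF x True] interval_sets_unit(2)[OF order_refl distr_fun_le_1]
      by simp
  next
    case False
    then have "s < rearrangement x t" for t
      using rearrangement_nonneg[OF x, of t] by linarith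
    then have "{t \<in> space unit_measure. s < rearrangement x t} = space unit_measure"
      by blast
    then show ?thesis
      by (rule ssubst) (rule sets.top)
  qed
qed

lemma equimeasurable_rearrangement:
  assumes x: "x \<in> borel_measurable unit_measure"
  shows "equimeasurable (\<lambda>t. \<bar>rearrangement x t\<bar>) (\<lambda>t. \<bar>x t\<bar>)"
  unfolding equimeasurable_def
proof
  fix s
  show "emeasure unit_measure {t \<in> space unit_measure. s < \<bar>rearrangement x t\<bar>}
      = emeasure unit_measure {t \<in> space unit_measure. s < \<bar>x t\<bar>}"
  proof (cases "0 \<le> s")
    case True
    then show ?thesis
      using rearrangement_level_set[OF x True] rearrangement_nonneg[OF x]
        measure_unit_interval(2)[OF order_refl distr_fun_nonneg distr_fun_le_1, of x s]
      by (simp add: emeasure_unit_eq distr_fun_def)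
  next
    case False
    then have "{t \<in> space unit_measure. s < \<bar>y t\<bar>} = space unit_measure" for y :: "real \<Rightarrow> real"
      by (auto simp del: space_restrict_space)
    then show ?thesis
      by (simp only:)
  qed
qed

lemma distr_fun_zero_imp_AE:
  assumes x: "x \<in> borel_measurable unit_measure" and zero: "\<And>e. 0 < e \<Longrightarrow> distr_fun x e = 0"
  shows "AE t in unit_measure. x t = 0"
proof -
  have "distr_fun x 0 = 0"
    using distr_fun_right_continuous[OF x, of 0 0] zero distr_fun_nonneg[of x 0] by force
  then have "{t \<in> {0..1}. 0 < \<bar>x t\<bar>} \<in> null_sets unit_measure"
    using unit_sets_greater[OF x, of 0]
    by (simp only: null_sets_def mem_Collect_eq emeasure_unit_eq ennreal_0 distr_fun_def)
  then have "AE t in unit_measure. t \<notin> {t \<in> {0..1}. 0 < \<bar>x t\<bar>}"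
    by (rule AE_not_in)
  then show ?thesis
    by (rule AE_mp) (auto intro!: AE_I2)
qed

section \<open>Monotonicity in the distribution function, and bounded functions in X\<close>

context symmetric_space
begin

lemma mem_measurable: "x \<in> X \<Longrightarrow> x \<in> borel_measurable unit_measure"
  using measurable by blast

text \<open>Domination of the distribution functions becomes pointwise domination of the
  rearrangements, to which the ideal property applies; symmetry leads from the functions to their
  rearrangements and back.\<close>

lemma distribution_dominated:
  assumes y: "y \<in> X" and x: "x \<in> borel_measurable unit_measure"
    and le: "\<And>s. 0 \<le> s \<Longrightarrow> distr_fun x s \<le> distr_fun y s"
  shows dominated_mem: "x \<in> X" and dominated_norm: "N x \<le> N y"
proof -
  note ym = mem_measurable[OF y]
  have eq_sym: "equimeasurable (\<lambda>t. \<bar>x t\<bar>) (\<lambda>t. \<bar>rearrangement x t\<bar>)"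
    using equimeasurable_rearrangement[OF x] by (simp add: equimeasurable_def)
  have y': "rearrangement y \<in> X" "N (rearrangement y) = N y"
    using y ym by (auto intro: symmetric_mem symmetric_norm rearrangement_measurable equimeasurable_rearrangement)
  have "rearrangement x t \<le> rearrangement y t" for t
  proof (cases "0 < t \<and> t \<le> 1")
    case True
    show ?thesis
    proof (rule ccontr)
      assume "\<not> rearrangement x t \<le> rearrangement y t"
      then have "t < distr_fun x (rearrangement y t)"
        using rearrangement_greater_iff[OF x, of t "rearrangement y t"] True
          rearrangement_nonneg[OF ym, of t] by auto
      also have "\<dots> \<le> distr_fun y (rearrangement y t)"
        by (intro le rearrangement_nonneg ym)
      finally show False
        using rearrangement_greater_iff[OF ym] True rearrangement_nonneg[OF ym, of t] by blast
    qed
  qed (auto simp: rearrangement_def)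
  then have ae: "AE t in unit_measure. \<bar>rearrangement x t\<bar> \<le> \<bar>rearrangement y t\<bar>"
    using rearrangement_nonneg[OF x] rearrangement_nonneg[OF ym] by simp
  note rm = rearrangement_measurable[OF x]
  have x': "rearrangement x \<in> X" "N (rearrangement x) \<le> N (rearrangement y)"
    using ideal_mem[OF y'(1) rm ae] ideal_norm[OF y'(1) rm ae] by auto
  show "x \<in> X"
    by (rule symmetric_mem[OF x'(1) x eq_sym])
  show "N x \<le> N y"
    using symmetric_norm[OF x'(1) x eq_sym] x' y' by simp
qed

lemma zero_mem: "(\<lambda>_. 0) \<in> X"
proof -
  obtain x where "x \<in> X"
    using nonzero by blast
  then show ?thesis
    using scale_mem[of x 0] by simp
qed

lemma norm_zero: "N (\<lambda>_. 0) = 0"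
  using norm_eq_0_iff[OF zero_mem] by simp

lemma uminus_mem: "x \<in> X \<Longrightarrow> (\<lambda>t. - x t) \<in> X"
  using scale_mem[of x "-1"] by simp

lemma diff_mem: "x \<in> X \<Longrightarrow> y \<in> X \<Longrightarrow> (\<lambda>t. x t - y t) \<in> X"
  using add_mem[of x "\<lambda>t. - y t"] uminus_mem[of y] by simp

lemma norm_uminus: "x \<in> X \<Longrightarrow> N (\<lambda>t. - x t) = N x"
  using norm_scale[of x "-1"] by simp

lemma norm_diff_commute: "x \<in> X \<Longrightarrow> y \<in> X \<Longrightarrow> N (\<lambda>t. x t - y t) = N (\<lambda>t. y t - x t)"
  using norm_uminus[OF diff_mem[of x y]] by simp

lemma norm_diff_le: "x \<in> X \<Longrightarrow> y \<in> X \<Longrightarrow> N (\<lambda>t. x t - y t) \<le> N x + N y"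
  using norm_triangle[of x "\<lambda>t. - y t"] uminus_mem[of y] norm_uminus[of y] by simp

lemma norm_diff_triangle:
  "x \<in> X \<Longrightarrow> y \<in> X \<Longrightarrow> z \<in> X \<Longrightarrow> N (\<lambda>t. x t - z t) \<le> N (\<lambda>t. x t - y t) + N (\<lambda>t. y t - z t)"
  using norm_triangle[OF diff_mem[of x y] diff_mem[of y z]] by simp

lemma norm_le_norm_diff: "x \<in> X \<Longrightarrow> y \<in> X \<Longrightarrow> N x \<le> N (\<lambda>t. x t - y t) + N y"
  using norm_triangle[OF diff_mem[of x y], of y] by simp

lemma sum_mem: "(\<And>i. i \<in> A \<Longrightarrow> f i \<in> X) \<Longrightarrow> (\<lambda>t. \<Sum>i\<in>A. f i t) \<in> X"
  by (induction A rule: infinite_finite_induct) (auto intro: zero_mem add_mem)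

lemma norm_sum_le:
  "(\<And>i. i \<in> A \<Longrightarrow> f i \<in> X) \<Longrightarrow> N (\<lambda>t. \<Sum>i\<in>A. f i t) \<le> (\<Sum>i\<in>A. N (f i))"
proof (induction A rule: infinite_finite_induct)
  case (insert i A)
  then have "N (\<lambda>t. f i t + (\<Sum>i\<in>A. f i t)) \<le> N (f i) + N (\<lambda>t. \<Sum>i\<in>A. f i t)"
    by (intro norm_triangle sum_mem) auto
  with insert show ?case
    by fastforce
qed (auto simp: norm_zero)

lemma AE_eq_norm:
  assumes "x \<in> X" "y \<in> borel_measurable unit_measure" "AE t in unit_measure. x t = y t"
  shows AE_eq_mem: "y \<in> X" and AE_eq_norm_eq: "N y = N x"
proof -
  have ae: "AE t in unit_measure. \<bar>y t\<bar> \<le> \<bar>x t\<bar>" "AE t in unit_measure. \<bar>x t\<bar> \<le> \<bar>y t\<bar>"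
    using assms(3) by (auto elim: eventually_mono)
  show "y \<in> X"
    by (rule ideal_mem[OF assms(1,2) ae(1)])
  then show "N y = N x"
    using ideal_norm[OF assms(1,2) ae(1)] ideal_norm[OF _ mem_measurable[OF assms(1)] ae(2)] by simp
qed

lemma distr_fun_indicator:
  assumes "E \<in> sets unit_measure" "0 \<le> s"
  shows "distr_fun (indicator E) s = (if s < 1 then measure unit_measure E else 0)"
proof -
  have "E \<subseteq> {0..1}"
    using sets.sets_into_space[OF assms(1)] by simp
  then have "{t \<in> {0..1}. s < \<bar>indicator E t\<bar>} = (if s < 1 then E else {})"
    using assms(2) by (auto simp: indicator_def split: if_splits)
  then show ?thesis
    by (simp add: distr_fun_def)
qed

lemma indicator_dominated:
  assumes "indicator E' \<in> X" "E \<in> sets unit_measure" "E' \<in> sets unit_measure"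
    "measure unit_measure E \<le> measure unit_measure E'"
  shows "indicator E \<in> X" "N (indicator E) \<le> N (indicator E')"
proof -
  have le: "distr_fun (indicator E) s \<le> distr_fun (indicator E') s" if "0 \<le> s" for s
    using assms that by (simp add: distr_fun_indicator)
  have m: "(indicator E :: real \<Rightarrow> real) \<in> borel_measurable unit_measure"
    using assms(2) by (rule borel_measurable_indicator)
  show "indicator E \<in> X" "N (indicator E) \<le> N (indicator E')"
    using distribution_dominated[OF assms(1) m le] by auto
qed

lemma exists_indicator_mem:
  obtains E where "E \<in> sets unit_measure" "0 < measure unit_measure E" "indicator E \<in> X"
proof -
  obtain x where x: "x \<in> X" "\<not> (AE t in unit_measure. x t = 0)"
    using nonzero by blast
  have xm: "x \<in> borel_measurable unit_measure"
    using x(1) by (rule mem_measurable)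
  obtain e where e: "0 < e" "distr_fun x e \<noteq> 0"
    using distr_fun_zero_imp_AE[OF xm] x(2) by blast
  then have "0 < distr_fun x e"
    using distr_fun_nonneg[of x e] by simp
  let ?E = "{t \<in> {0..1}. e < \<bar>x t\<bar>}"
  note s = unit_sets_greater[OF xm, of e]
  have "AE t in unit_measure. \<bar>indicator ?E t\<bar> \<le> \<bar>(1 / e) * x t\<bar>"
    using e by (intro AE_I2) (auto simp: indicator_def abs_mult field_simps)
  then have "indicator ?E \<in> X"
    using s by (intro ideal_mem[OF scale_mem[OF x(1), of "1 / e"]] borel_measurable_indicator)
  then show ?thesis
    using \<open>0 < distr_fun x e\<close> s by (intro that[of ?E]) (auto simp: distr_fun_def)
qed

text \<open>The indicator of one set of positive measure lies in X; by symmetry so do those of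
  intervals of length 1/m that are short enough, and m of them cover \<open>{0..1}\<close>.\<close>

lemma one_mem: "(\<lambda>_. 1) \<in> X"
proof -
  obtain E where E: "E \<in> sets unit_measure" "0 < measure unit_measure E" "indicator E \<in> X"
    by (rule exists_indicator_mem)
  obtain m' where "inverse (real (Suc m')) < measure unit_measure E"
    using reals_Archimedean[OF E(2)] by blast
  then obtain m where m: "0 < m" "1 / real m \<le> measure unit_measure E"
    by (metis inverse_eq_divide less_imp_le zero_less_Suc)
  let ?I = "\<lambda>k. {real k / real m..real (Suc k) / real m}"
  have "(\<lambda>t. \<Sum>k<m. indicator (?I k) t :: real) \<in> X"
  proof (intro sum_mem)
    fix k assume "k \<in> {..<m}"
    then have k: "real (Suc k) / real m \<le> 1"
      using m by (simp add: divide_le_eq)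
    have "real k / real m \<le> real (Suc k) / real m"
      by (intro divide_right_mono) auto
    then have "measure unit_measure (?I k) = real (Suc k) / real m - real k / real m"
      using k by (intro measure_unit_interval) auto
    then show "indicator (?I k) \<in> X"
      using E m k by (intro indicator_dominated[OF E(3)] interval_sets_unit)
        (auto simp flip: diff_divide_distrib)
  qed
  moreover have "1 \<le> (\<Sum>k<m. indicator (?I k) t :: real)" if t: "0 \<le> t" "t \<le> 1" for t
  proof -
    \<comment> \<open>The minimum assigns the right end point t = 1 to the last interval.\<close>
    define k where "k = min (nat \<lfloor>t * m\<rfloor>) (m - 1)"
    have "t \<in> ?I k"
    proof (cases "nat \<lfloor>t * m\<rfloor> \<le> m - 1")
      case True
      then have "k = nat \<lfloor>t * m\<rfloor>"
        by (simp add: k_def)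
      moreover have "real (nat \<lfloor>t * m\<rfloor>) \<le> t * m" "t * m \<le> real (Suc (nat \<lfloor>t * m\<rfloor>))"
        using t by (auto simp: of_nat_nat intro: less_imp_le) linarith
      ultimately show ?thesis
        using m by (simp add: field_simps)
    next
      case False
      then have "m \<le> t * m"
        using m by linarith
      then have "t = 1"
        using t m by simp
      moreover have "k = m - 1"
        using False by (simp add: k_def)
      ultimately show ?thesis
        using m by (simp add: of_nat_diff)
    qed
    moreover have "k < m"
      using m by (auto simp: k_def)
    ultimately have "1 = (indicator (?I k) t :: real)" "k \<in> {..<m}"
      by auto
    then show ?thesis
      using member_le_sum[of k "{..<m}" "\<lambda>k. indicator (?I k) t :: real"] by simp
  qed
  then have "AE t in unit_measure. \<bar>1\<bar> \<le> \<bar>\<Sum>k<m. indicator (?I k) t :: real\<bar>"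
    by (intro AE_I2) force
  ultimately show ?thesis
    using ideal_mem[of "\<lambda>t. \<Sum>k<m. indicator (?I k) t" "\<lambda>_. 1"] by simp
qed

lemma bounded_mem:
  assumes "x \<in> borel_measurable unit_measure" "AE t in unit_measure. \<bar>x t\<bar> \<le> C"
  shows "x \<in> X"
proof (rule ideal_mem[OF scale_mem[OF one_mem, of C] assms(1)])
  show "AE t in unit_measure. \<bar>x t\<bar> \<le> \<bar>C * 1\<bar>"
    using assms(2) by eventually_elim auto
qed

lemma L_infinity_subset: "L_infinity \<subseteq> X"
  unfolding L_infinity_def using bounded_mem by auto

lemma simple_mem:
  assumes "simple_function borel x"
  shows "x \<in> X"
proof -
  obtain B where "\<And>t. \<bar>x t\<bar> \<le> B"
    using simple_bounded[OF assms] by blast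
  then show ?thesis
    by (intro bounded_mem[of x B] simple_borel_unit assms) simp
qed

lemma indicator_mem: "E \<in> sets unit_measure \<Longrightarrow> indicator E \<in> X"
  by (rule bounded_mem[where C = 1]) (simp_all add: indicator_def)

lemma indicator_norm_pos:
  assumes "E \<in> sets unit_measure" "0 < measure unit_measure E"
  shows "0 < N (indicator E)"
proof -
  have "\<not> (AE t in unit_measure. indicator E t = (0::real))"
  proof
    assume "AE t in unit_measure. indicator E t = (0::real)"
    then have "AE t in unit_measure. t \<notin> E"
      by (rule eventually_mono) (simp add: indicator_eq_0_iff)
    then have "E \<in> null_sets unit_measure"
      using AE_iff_null_sets[OF assms(1)] by simp
    then show False
      using assms(2) by (simp add: null_sets_def emeasure_unit_eq)
  qed
  then show ?thesis
    using norm_nonneg[OF indicator_mem] norm_eq_0_iff[OF indicator_mem] assms(1) by fastforce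
qed

section \<open>The fundamental function and lower estimates of norms\<close>

definition fundamental :: "real \<Rightarrow> real" where
  "fundamental \<delta> = N (indicator {0..\<delta>})"

lemma fundamental_pos: "0 < \<delta> \<Longrightarrow> \<delta> \<le> 1 \<Longrightarrow> 0 < fundamental \<delta>"
  unfolding fundamental_def by (intro indicator_norm_pos interval_sets_unit) (auto simp: measure_unit_interval)

lemma indicator_norm_le_fundamental:
  assumes "E \<in> sets unit_measure" "measure unit_measure E \<le> \<delta>" "\<delta> \<le> 1"
  shows "N (indicator E) \<le> fundamental \<delta>"
proof -
  have "0 \<le> \<delta>"
    using assms(2) measure_nonneg[of unit_measure E] by linarith
  then show ?thesis
    unfolding fundamental_def using assms
    by (intro indicator_dominated(2) indicator_mem interval_sets_unit) (auto simp: measure_unit_interval)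
qed

text \<open>Chebyshev's inequality with the norm of X in place of the integral. It turns a lower
  bound for a tail into one for a norm, and a small norm into smallness in measure.\<close>

lemma fundamental_le_norm:
  assumes x: "x \<in> X" and c: "0 \<le> c" and \<delta>: "0 \<le> \<delta>" "\<delta> \<le> prob (\<lambda>t. c \<le> \<bar>x t\<bar>)"
  shows "c * fundamental \<delta> \<le> N x"
proof -
  let ?E = "{t \<in> {0..1}. c \<le> \<bar>x t\<bar>}"
  have E: "?E \<in> sets unit_measure"
    using mem_measurable[OF x] by (rule unit_sets_ge)
  have "\<delta> \<le> 1"
    using \<delta> prob_le_1[of "\<lambda>t. c \<le> \<bar>x t\<bar>"] by linarith
  then have "fundamental \<delta> \<le> N (indicator ?E)"
    unfolding fundamental_def using \<delta> E
    by (intro indicator_dominated(2) indicator_mem interval_sets_unit) (auto simp: measure_unit_interval)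
  then have "c * fundamental \<delta> \<le> c * N (indicator ?E)"
    using c by (rule mult_left_mono)
  also have "\<dots> = N (\<lambda>t. c * indicator ?E t)"
    using norm_scale[OF indicator_mem[OF E], of c] c by simp
  also have "\<dots> \<le> N x"
  proof (rule ideal_norm[OF x])
    show "(\<lambda>t. c * indicator ?E t) \<in> borel_measurable unit_measure"
      using E by (intro borel_measurable_times borel_measurable_indicator borel_measurable_const)
    show "AE t in unit_measure. \<bar>c * indicator ?E t\<bar> \<le> \<bar>x t\<bar>"
      using c by (intro AE_I2) (auto simp: indicator_def)
  qed
  finally show ?thesis .
qed

lemma chaos_poly_mem: "chaos_poly F a \<in> X"
  by (rule simple_mem[OF chaos_poly_simple])

text \<open>The lower ell_2 estimate, valid in every symmetric space; only the upper one
  characterises the embedding.\<close>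

lemma chaos_poly_lower:
  assumes "finite F" "F \<subseteq> chaos_index"
  shows "sqrt (\<Sum>p\<in>F. (a p)\<^sup>2) / 2 * fundamental (1 / 162) \<le> N (chaos_poly F a)"
  by (rule fundamental_le_norm[OF chaos_poly_mem _ _ chaos_poly_large[OF assms]]) (simp_all add: sum_nonneg)

end

section \<open>The space H and its embedding\<close>

lemma M_exp_mono: "s \<le> t \<Longrightarrow> M_exp s \<le> M_exp t"
  by (simp add: M_exp_def)

lemma M_exp_nonneg: "0 \<le> t \<Longrightarrow> 0 \<le> M_exp t"
  by (simp add: M_exp_def)

lemma M_exp_measurable:
  fixes x :: "'a \<Rightarrow> real"
  assumes [measurable]: "x \<in> borel_measurable M"
  shows "(\<lambda>t. ennreal (M_exp (\<bar>x t\<bar> / l))) \<in> borel_measurable M"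
  unfolding M_exp_def by measurable

section \<open>Admissible factors in the Luxemburg norm, and exponential tails\<close>

lemma orlicz_bounds_pos: "l \<in> orlicz_bounds M_exp x \<Longrightarrow> 0 < l"
  by (simp add: orlicz_bounds_def)

lemma orlicz_bounds_upward:
  assumes "l \<in> orlicz_bounds M_exp x" "l \<le> l'"
  shows "l' \<in> orlicz_bounds M_exp x"
proof -
  have l: "0 < l" "0 < l'"
    using assms by (auto simp: orlicz_bounds_def)
  have "(\<integral>\<^sup>+ t. ennreal (M_exp (\<bar>x t\<bar> / l')) \<partial>unit_measure) \<le> (\<integral>\<^sup>+ t. ennreal (M_exp (\<bar>x t\<bar> / l)) \<partial>unit_measure)"
    using l assms(2) by (intro nn_integral_mono ennreal_leI M_exp_mono divide_left_mono) auto
  then show ?thesis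
    using assms l by (auto simp: orlicz_bounds_def)
qed

lemma bdd_below_orlicz_bounds: "bdd_below (orlicz_bounds M x)"
  by (rule bdd_belowI[of _ 0]) (simp add: orlicz_bounds_def)

lemma orlicz_norm_le: "l \<in> orlicz_bounds M x \<Longrightarrow> orlicz_norm M x \<le> l"
  unfolding orlicz_norm_def by (rule cInf_lower[OF _ bdd_below_orlicz_bounds])

lemma orlicz_norm_less_imp_bounds:
  assumes "orlicz_bounds M_exp x \<noteq> {}" "orlicz_norm M_exp x < l"
  shows "l \<in> orlicz_bounds M_exp x"
  using cInf_lessD[OF assms(1), of l] assms(2) orlicz_bounds_upward
  unfolding orlicz_norm_def by (metis less_imp_le)

text \<open>Convexity of exp with weights proportional to \<open>l\<close> and \<open>l'\<close>.
  Working with admissible factors avoids the question whether the infimum defining the norm is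
  attained.\<close>

lemma orlicz_bounds_add:
  assumes "l \<in> orlicz_bounds M_exp x" "l' \<in> orlicz_bounds M_exp y"
    and [measurable]: "x \<in> borel_measurable unit_measure" "y \<in> borel_measurable unit_measure"
  shows "l + l' \<in> orlicz_bounds M_exp (\<lambda>t. x t + y t)"
proof -
  have l: "0 < l" "0 < l'"
    using assms by (auto simp: orlicz_bounds_def)
  define a where "a = l / (l + l')"
  define b where "b = l' / (l + l')"
  have ab: "a + b = 1" "0 \<le> a" "0 \<le> b"
    using l by (auto simp: a_def b_def add_divide_distrib[symmetric])
  have ptw: "M_exp (\<bar>x t + y t\<bar> / (l + l')) \<le> a * M_exp (\<bar>x t\<bar> / l) + b * M_exp (\<bar>y t\<bar> / l')" for t
  proof -
    have "M_exp (\<bar>x t + y t\<bar> / (l + l')) \<le> M_exp (a * (\<bar>x t\<bar> / l) + b * (\<bar>y t\<bar> / l'))"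
      using l by (intro M_exp_mono) (simp add: a_def b_def add_divide_distrib[symmetric] divide_right_mono)
    also have "\<dots> \<le> a * M_exp (\<bar>x t\<bar> / l) + b * M_exp (\<bar>y t\<bar> / l')"
    proof -
      have a: "a = 1 - b"
        using ab by simp
      have "exp ((1 - b) *\<^sub>R (\<bar>x t\<bar> / l) + b *\<^sub>R (\<bar>y t\<bar> / l'))
          \<le> (1 - b) * exp (\<bar>x t\<bar> / l) + b * exp (\<bar>y t\<bar> / l')"
        using ab by (intro convex_onD[OF exp_convex]) auto
      then show ?thesis
        unfolding M_exp_def a by (simp add: algebra_simps)
    qed
    finally show ?thesis .
  qed
  have "(\<integral>\<^sup>+ t. ennreal (M_exp (\<bar>x t + y t\<bar> / (l + l'))) \<partial>unit_measure)
      \<le> (\<integral>\<^sup>+ t. ennreal (a * M_exp (\<bar>x t\<bar> / l) + b * M_exp (\<bar>y t\<bar> / l')) \<partial>unit_measure)"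
    using ptw by (intro nn_integral_mono ennreal_leI)
  also have "\<dots> = (\<integral>\<^sup>+ t. ennreal a * ennreal (M_exp (\<bar>x t\<bar> / l)) + ennreal b * ennreal (M_exp (\<bar>y t\<bar> / l')) \<partial>unit_measure)"
    using l ab by (intro nn_integral_cong) (simp add: ennreal_mult M_exp_nonneg)
  also have "\<dots> = ennreal a * (\<integral>\<^sup>+ t. ennreal (M_exp (\<bar>x t\<bar> / l)) \<partial>unit_measure)
      + ennreal b * (\<integral>\<^sup>+ t. ennreal (M_exp (\<bar>y t\<bar> / l')) \<partial>unit_measure)"
    using M_exp_measurable[of x unit_measure l] M_exp_measurable[of y unit_measure l'] assms(3,4)
    by (subst nn_integral_add) (auto simp: nn_integral_cmult)
  also have "\<dots> \<le> ennreal a * 1 + ennreal b * 1"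
    using assms by (intro add_mono mult_left_mono) (auto simp: orlicz_bounds_def)
  also have "\<dots> = 1"
    using ab by (simp flip: ennreal_plus)
  finally show ?thesis
    using l by (simp add: orlicz_bounds_def)
qed

lemma orlicz_bounds_uminus: "orlicz_bounds M (\<lambda>t. - x t) = orlicz_bounds M x"
  by (simp add: orlicz_bounds_def)

lemma orlicz_bounds_diff:
  assumes "l \<in> orlicz_bounds M_exp x" "l' \<in> orlicz_bounds M_exp y"
    and "x \<in> borel_measurable unit_measure" "y \<in> borel_measurable unit_measure"
  shows "l + l' \<in> orlicz_bounds M_exp (\<lambda>t. x t - y t)"
  using orlicz_bounds_add[of l x l' "\<lambda>t. - y t"] assms by (simp add: orlicz_bounds_uminus)

lemma orlicz_bounds_bounded:
  assumes "AE t in unit_measure. \<bar>x t\<bar> \<le> C"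
  shows "orlicz_bounds M_exp x \<noteq> {}"
proof -
  \<comment> \<open>\<open>M_exp (ln 2) = 1\<close>; the maximum keeps \<open>l\<close> positive
    when \<open>C\<close> is not.\<close>
  define l where "l = max C 1 / ln 2"
  have l: "0 < l"
    by (simp add: l_def)
  have "(\<integral>\<^sup>+ t. ennreal (M_exp (\<bar>x t\<bar> / l)) \<partial>unit_measure) \<le> (\<integral>\<^sup>+ t. 1 \<partial>unit_measure)"
  proof (rule nn_integral_mono_AE)
    show "AE t in unit_measure. ennreal (M_exp (\<bar>x t\<bar> / l)) \<le> 1"
      using assms
    proof eventually_elim
      case (elim t)
      then have "\<bar>x t\<bar> * ln 2 \<le> max C 1 * ln 2"
        by (intro mult_right_mono) auto
      then have "\<bar>x t\<bar> / l \<le> ln 2"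
        by (simp add: l_def pos_divide_le_eq mult.commute)
      then have "M_exp (\<bar>x t\<bar> / l) \<le> M_exp (ln 2)"
        by (rule M_exp_mono)
      also have "\<dots> = 1"
        by (simp add: M_exp_def)
      finally show ?case
        by simp
    qed
  qed
  also have "\<dots> = 1"
    by (simp add: emeasure_restrict_space)
  finally show ?thesis
    using l by (auto simp: orlicz_bounds_def)
qed

text \<open>Markov's inequality gives (e^s - 1) d <= 1 for the tail d; adding d <= 1 avoids the
  singularity at s = 0 and produces the factor 2.\<close>

lemma orlicz_bounds_exp_tail:
  assumes l: "l \<in> orlicz_bounds M_exp x" and x: "x \<in> borel_measurable unit_measure" and s: "0 \<le> s"
  shows "distr_fun x (l * s) \<le> 2 * exp (- s)"
proof -
  let ?E = "{t \<in> {0..1}. l * s < \<bar>x t\<bar>}"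
  have l0: "0 < l" "(\<integral>\<^sup>+ t. ennreal (M_exp (\<bar>x t\<bar> / l)) \<partial>unit_measure) \<le> 1"
    using l by (auto simp: orlicz_bounds_def)
  have E: "?E \<in> sets unit_measure"
    using x by (rule unit_sets_greater)
  have "ennreal (M_exp s * distr_fun x (l * s)) = ennreal (M_exp s) * emeasure unit_measure ?E"
    using s by (simp add: distr_fun_def emeasure_unit_eq ennreal_mult M_exp_nonneg)
  also have "\<dots> = (\<integral>\<^sup>+ t. ennreal (M_exp s) * indicator ?E t \<partial>unit_measure)"
    using E by (rule nn_integral_cmult_indicator[symmetric])
  also have "\<dots> \<le> (\<integral>\<^sup>+ t. ennreal (M_exp (\<bar>x t\<bar> / l)) \<partial>unit_measure)"
    using l0 by (intro nn_integral_mono)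
      (auto simp: indicator_def intro!: ennreal_leI M_exp_mono, simp add: field_simps)
  also note l0(2)
  finally have "M_exp s * distr_fun x (l * s) \<le> 1"
    by simp
  then have "exp s * distr_fun x (l * s) \<le> 2"
    using distr_fun_le_1[of x "l * s"] by (simp add: M_exp_def algebra_simps)
  then show ?thesis
    by (simp add: exp_minus field_simps)
qed

text \<open>31250 = 2 * 125^2 is the factor 2 of \<open>orlicz_bounds_exp_tail\<close> times the
  base occurring in \<open>prob_block_chaos_tail\<close>.\<close>

lemma exp_12_ge: "31250 \<le> exp (12::real)"
proof -
  have "(5 / 2) ^ 12 \<le> exp (1::real) ^ 12"
    using exp_lower_Taylor_quadratic[of "1::real"] by (intro power_mono) auto
  also have "exp (1::real) ^ 12 = exp 12"
    by (simp flip: exp_of_nat_mult)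
  finally show ?thesis
    by (simp add: power_divide)
qed

lemma L_infinity_subset_H: "L_infinity \<subseteq> H_space"
proof
  fix x assume x: "x \<in> L_infinity"
  then obtain C where "AE t in unit_measure. \<bar>x t\<bar> \<le> C"
    by (auto simp: L_infinity_def)
  then have o: "x \<in> orlicz_space M_exp"
    using x orlicz_bounds_bounded by (auto simp: orlicz_space_def L_infinity_def)
  have "orlicz_norm M_exp (\<lambda>t. x t - x t) < e" if "0 < e" for e
  proof -
    have "e / 2 \<in> orlicz_bounds M_exp (\<lambda>t. x t - x t)"
      using that by (simp add: orlicz_bounds_def M_exp_def)
    from orlicz_norm_le[OF this] show ?thesis
      using that by linarith
  qed
  then show "x \<in> H_space"
    using x o unfolding H_space_def by blast
qed

lemma simple_L_infinity:
  assumes "simple_function borel x"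
  shows "x \<in> L_infinity"
proof -
  obtain B where "\<And>t. \<bar>x t\<bar> \<le> B"
    using simple_bounded[OF assms] by blast
  then show ?thesis
    using simple_borel_unit[OF assms] by (auto simp: L_infinity_def)
qed

section \<open>From bounded block chaoses to the embedding of H\<close>

context symmetric_space
begin

text \<open>By \<open>fundamental_le_norm\<close>, convergence in X implies convergence in measure.
  This identifies a limit obtained from completeness with a function not yet known to lie in
  X.\<close>

lemma convergence_limit_unique:
  assumes g: "g \<in> X" and y: "\<And>n. y n \<in> X" and x: "x \<in> borel_measurable unit_measure"
    and lim: "(\<lambda>n. N (\<lambda>t. y n t - g t)) \<longlonglongrightarrow> 0"
    and lim': "\<And>e. 0 < e \<Longrightarrow> (\<lambda>n. distr_fun (\<lambda>t. x t - y n t) e) \<longlonglongrightarrow> 0"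
  shows "AE t in unit_measure. g t = x t"
proof -
  note gm = mem_measurable[OF g] and ym = mem_measurable[OF y]
  have dm: "(\<lambda>t. x t - g t) \<in> borel_measurable unit_measure"
    using x gm by (rule borel_measurable_diff)
  have zero: "distr_fun (\<lambda>t. x t - g t) e = 0" if e: "0 < e" for e
  proof -
    have "distr_fun (\<lambda>t. x t - g t) e \<le> \<delta>" if \<delta>: "0 < \<delta>" for \<delta>
    proof -
      \<comment> \<open>Capped at 1, since the fundamental function is known to be positive only for
        arguments in (0, 1].\<close>
      define \<eta> where "\<eta> = min (\<delta> / 2) 1"
      have \<eta>: "0 < \<eta>" "\<eta> \<le> 1" "\<eta> \<le> \<delta> / 2"
        using \<delta> by (auto simp: \<eta>_def)
      have "0 < e / 2 * fundamental \<eta>"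
        using e \<eta> fundamental_pos[of \<eta>] by simp
      then have "\<forall>\<^sub>F n in sequentially. N (\<lambda>t. y n t - g t) < e / 2 * fundamental \<eta>"
        using lim by (rule order_tendstoD(2)[rotated])
      moreover have "\<forall>\<^sub>F n in sequentially. distr_fun (\<lambda>t. x t - y n t) (e / 2) < \<delta> / 2"
        using lim'[of "e / 2"] e \<delta> by (intro order_tendstoD(2)) auto
      ultimately have "\<forall>\<^sub>F n in sequentially. N (\<lambda>t. y n t - g t) < e / 2 * fundamental \<eta>
          \<and> distr_fun (\<lambda>t. x t - y n t) (e / 2) < \<delta> / 2"
        by (rule eventually_conj)
      then obtain n where n: "N (\<lambda>t. y n t - g t) < e / 2 * fundamental \<eta>"
          "distr_fun (\<lambda>t. x t - y n t) (e / 2) < \<delta> / 2"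
        by (auto simp: eventually_sequentially)
      have d: "(\<lambda>t. y n t - g t) \<in> X"
        using y g by (rule diff_mem)
      have small: "prob (\<lambda>t. e / 2 \<le> \<bar>y n t - g t\<bar>) < \<eta>"
      proof (rule ccontr)
        assume "\<not> prob (\<lambda>t. e / 2 \<le> \<bar>y n t - g t\<bar>) < \<eta>"
        then have "e / 2 * fundamental \<eta> \<le> N (\<lambda>t. y n t - g t)"
          using e \<eta> by (intro fundamental_le_norm[OF d]) auto
        with n(1) show False
          by simp
      qed
      have sets: "{t \<in> {0..1}. e / 2 < \<bar>x t - y n t\<bar>} \<in> sets unit_measure"
        "{t \<in> {0..1}. e / 2 \<le> \<bar>y n t - g t\<bar>} \<in> sets unit_measure"
        by (intro unit_sets_greater unit_sets_ge borel_measurable_diff x ym gm)+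
      have "distr_fun (\<lambda>t. x t - g t) e
          \<le> measure unit_measure ({t \<in> {0..1}. e / 2 < \<bar>x t - y n t\<bar>} \<union> {t \<in> {0..1}. e / 2 \<le> \<bar>y n t - g t\<bar>})"
        unfolding distr_fun_def
      proof (intro finite_measure.finite_measure_mono[OF finite_unit] sets.Un sets subsetI)
        fix t assume t: "t \<in> {t \<in> {0..1}. e < \<bar>x t - g t\<bar>}"
        then have "e / 2 < \<bar>x t - y n t\<bar> \<or> e / 2 \<le> \<bar>y n t - g t\<bar>"
          by (simp add: abs_if split: if_splits) linarith+
        then show "t \<in> {t \<in> {0..1}. e / 2 < \<bar>x t - y n t\<bar>} \<union> {t \<in> {0..1}. e / 2 \<le> \<bar>y n t - g t\<bar>}"
          using t by blast
      qed
      also have "\<dots> \<le> distr_fun (\<lambda>t. x t - y n t) (e / 2) + prob (\<lambda>t. e / 2 \<le> \<bar>y n t - g t\<bar>)"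
        unfolding distr_fun_def
        by (rule measure_Un_le[OF sets])
      finally show ?thesis
        using small n(2) \<eta> by linarith
    qed
    then have "distr_fun (\<lambda>t. x t - g t) e \<le> 0"
      by (rule field_le_epsilon[of _ 0, simplified])
    then show ?thesis
      using distr_fun_nonneg[of "\<lambda>t. x t - g t" e] by linarith
  qed
  have "AE t in unit_measure. x t - g t = 0"
    using dm zero by (rule distr_fun_zero_imp_AE)
  then show ?thesis
    by (rule eventually_mono) simp
qed

text \<open>49152 = 12 * 4 * 1024: the 12 comes from \<open>exp_12_ge\<close>, the 1024 from
  \<open>prob_block_chaos_tail\<close>, and the 4 from rounding a level up to the next
  \<open>4 ^ p / 1024\<close>. The summand with \<open>N (\<lambda>_. 1)\<close> is the norm of the
  constant that is added to the block chaos.\<close>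

definition embedding_const :: "real \<Rightarrow> real" where
  "embedding_const C = 49152 * (C + N (\<lambda>_. 1) / 1024)"

text \<open>The exponential tail of \<open>x\<close> lies below that of \<open>\<bar>block_chaos q\<bar>\<close> at all levels up to \<open>4 ^ q / 1024\<close>;
  choosing \<open>q\<close> large covers the range of the bounded function \<open>x\<close>.\<close>

lemma bounded_norm_le:
  assumes C: "\<And>q. N (block_chaos q) \<le> C" and x: "x \<in> L_infinity" and l: "l \<in> orlicz_bounds M_exp x"
  shows "N x \<le> embedding_const C * l"
proof -
  define K :: real where "K = 49152"
  have K: "0 < K"
    by (simp add: K_def)
  have xX: "x \<in> X"
    using x L_infinity_subset by blast
  note xm = mem_measurable[OF xX]
  have l0: "0 < l"
    using l by (rule orlicz_bounds_pos)
  obtain B where B: "AE t in unit_measure. \<bar>x t\<bar> \<le> B"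
    using x by (auto simp: L_infinity_def)
  obtain q :: nat where "1024 * B / (K * l) < 4 ^ q"
    using real_arch_pow[of 4 "1024 * B / (K * l)"] by auto
  then have q: "B \<le> K * l * (4 ^ q / 1024)"
    using K l0 by (simp add: field_simps)
  define x' where "x' t = 1 / (K * l) * x t" for t
  have x'm: "x' \<in> borel_measurable unit_measure"
    unfolding x'_def using xm by measurable
  have distr_x': "distr_fun x' s = distr_fun x (l * (K * s))" for s
    unfolding distr_fun_def x'_def using K l0 by (simp add: abs_mult field_simps)
  \<comment> \<open>The added constant makes the distribution function of \<open>y\<close> equal to
    1 below the level 1/1024, where no exponential comparison is available.\<close>
  define y where "y t = \<bar>block_chaos q t\<bar> + 1 / 1024" for t
  have bX: "block_chaos q \<in> X" and abs: "(\<lambda>t. \<bar>block_chaos q t\<bar>) \<in> X"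
    using simple_mem[OF block_chaos_simple] simple_mem[OF simple_function_compose1[OF block_chaos_simple]]
    by auto
  have cX: "(\<lambda>_. 1 / 1024) \<in> X" "N (\<lambda>_. 1 / 1024) = N (\<lambda>_. 1) / 1024"
    using scale_mem[OF one_mem, of "1 / 1024"] norm_scale[OF one_mem, of "1 / 1024"] by auto
  have yX: "y \<in> X"
    unfolding y_def using abs cX(1) by (rule add_mem)
  have "N (\<lambda>t. \<bar>block_chaos q t\<bar>) \<le> N (block_chaos q)"
    using mem_measurable[OF abs] by (intro ideal_norm[OF bX]) auto
  then have Ny: "N y \<le> C + N (\<lambda>_. 1) / 1024"
    unfolding y_def using norm_triangle[OF abs cX(1)] C[of q] cX(2) by linarith
  have dom: "distr_fun x' s \<le> distr_fun y s" if s: "0 \<le> s" for s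
  proof -
    consider "s < 1 / 1024" | "4 ^ q / 1024 \<le> s" | "1 / 1024 \<le> s" "s < 4 ^ q / 1024"
      by linarith
    then show ?thesis
    proof cases
      case 1
      then have "{t \<in> {0..1}. s < \<bar>y t\<bar>} = {0..1}"
        by (auto simp: y_def)
      then have "distr_fun y s = 1"
        by (simp only: distr_fun_def measure_unit_space)
      then show ?thesis
        using distr_fun_le_1[of x' s] by simp
    next
      case 2
      have "K * l * (4 ^ q / 1024) \<le> l * (K * s)"
        using 2 K l0 by (simp add: mult_ac)
      then have "AE t in unit_measure. \<not> l * (K * s) < \<bar>x t\<bar>"
        using B q by (auto elim!: eventually_mono)
      then have "{t \<in> {0..1}. l * (K * s) < \<bar>x t\<bar>} \<in> null_sets unit_measure"
        using AE_iff_null_sets[OF unit_sets_greater[OF xm]] by (auto elim: eventually_mono)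
      then have "distr_fun x (l * (K * s)) = 0"
        unfolding distr_fun_def by (rule measure_eq_0_null_sets)
      then show ?thesis
        by (simp add: distr_x' distr_fun_nonneg)
    next
      case 3
      \<comment> \<open>By minimality \<open>4 ^ (p - 1) / 1024\<close> is at most \<open>s\<close>,
        so the tail known at the level \<open>4 ^ p / 1024\<close> is compared with that of
        \<open>x'\<close> at a level smaller by a factor of at most 4.\<close>
      define p where "p = (LEAST p. s < 4 ^ p / 1024)"
      have p: "s < 4 ^ p / 1024" "p \<le> q"
        unfolding p_def using 3 LeastI[of "\<lambda>p. s < 4 ^ p / 1024" q] Least_le[of "\<lambda>p. s < 4 ^ p / 1024" q] by auto
      then have "p \<noteq> 0"
        using 3 by (auto intro: ccontr)
      then obtain p' where p': "p = Suc p'"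
        using not0_implies_Suc by blast
      then have "4 ^ p' / 1024 \<le> s"
        using not_less_Least[of p' "\<lambda>p. s < 4 ^ p / 1024"] by (simp add: p_def)
      then have Ks: "12 * real (4 ^ p) \<le> K * s"
        by (simp add: p' K_def)
      define n :: nat where "n = 4 ^ p"
      have "2 * 15625 ^ n \<le> (2 * 15625 :: real) ^ n"
        unfolding power_mult_distrib by (intro mult_right_mono self_le_power) (auto simp: n_def)
      also have "\<dots> \<le> exp 12 ^ n"
        using exp_12_ge by (intro power_mono) auto
      also have "\<dots> = exp (12 * real n)"
        by (simp add: exp_of_nat2_mult)
      also have "\<dots> \<le> exp (K * s)"
        using Ks by (simp add: n_def)
      finally have "2 * exp (- (K * s)) \<le> (1 / 15625) ^ n"
        by (simp add: exp_minus power_divide field_simps)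
      have "distr_fun x' s \<le> 2 * exp (- (K * s))"
        unfolding distr_x' using K s by (intro orlicz_bounds_exp_tail[OF l xm]) auto
      also have "\<dots> \<le> (1 / 15625) ^ n"
        by fact
      also have "\<dots> = (1 / 125) ^ (2 * 4 ^ p)"
        by (simp add: power_mult n_def power2_eq_square)
      also have "\<dots> \<le> prob (\<lambda>t. 4 ^ p / 1024 \<le> block_chaos q t)"
        by (rule prob_block_chaos_tail[OF p(2)])
      also have "\<dots> \<le> distr_fun y s"
        unfolding distr_fun_def
      proof (rule finite_measure.finite_measure_mono[OF finite_unit])
        show "{t \<in> {0..1}. s < \<bar>y t\<bar>} \<in> sets unit_measure"
          using mem_measurable[OF yX] by (rule unit_sets_greater)
        show "{t \<in> {0..1}. 4 ^ p / 1024 \<le> block_chaos q t} \<subseteq> {t \<in> {0..1}. s < \<bar>y t\<bar>}"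
          using p(1) by (auto simp: y_def)
      qed
      finally show ?thesis .
    qed
  qed
  have "N x' \<le> N y"
    by (rule dominated_norm[OF yX x'm dom])
  also note Ny
  finally have "N x' \<le> C + N (\<lambda>_. 1) / 1024" .
  moreover have "N x' = N x / (K * l)"
    unfolding x'_def using norm_scale[OF xX, of "1 / (K * l)"] K l0 by simp
  ultimately show ?thesis
    using K l0 by (simp add: embedding_const_def K_def field_simps)
qed

text \<open>Bounded approximants in L_M are Cauchy in X by \<open>bounded_norm_le\<close>, and their
  limit in X is the given function because L_M convergence implies convergence in measure.\<close>

lemma block_chaos_bounded_imp_embedded:
  assumes C: "\<And>q. N (block_chaos q) \<le> C"
  shows "continuously_embedded H_space (orlicz_norm M_exp) X N"
proof -
  define D where "D = embedding_const C"
  have "0 \<le> C"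
    using C[of 0] norm_nonneg[OF simple_mem[OF block_chaos_simple[of 0]]] by linarith
  moreover have "0 < N (\<lambda>_. 1)"
  proof -
    have "{t \<in> {0..1::real}. (1::real) \<le> \<bar>1\<bar>} = {0..1}"
      by auto
    then have "1 \<le> prob (\<lambda>t. 1 \<le> \<bar>1::real\<bar>)"
      by (simp only: measure_unit_space)
    then have "1 * fundamental 1 \<le> N (\<lambda>_. 1)"
      by (intro fundamental_le_norm one_mem) auto
    then show ?thesis
      using fundamental_pos[of 1] by linarith
  qed
  ultimately have D: "0 < D"
    by (simp add: D_def embedding_const_def)
  have main: "x \<in> X \<and> N x \<le> D * orlicz_norm M_exp x" if x: "x \<in> H_space" for x
  proof -
    have xo: "x \<in> orlicz_space M_exp"
      using x by (simp add: H_space_def)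
    then have xm: "x \<in> borel_measurable unit_measure" and xb: "orlicz_bounds M_exp x \<noteq> {}"
      by (auto simp: orlicz_space_def)
    define r where "r n = 1 / real (Suc n)" for n
    have r: "0 < r n" for n
      by (simp add: r_def)
    have r0: "r \<longlonglongrightarrow> 0"
      unfolding r_def by (rule LIMSEQ_Suc[OF lim_1_over_n])
    have "\<exists>y\<in>L_infinity. orlicz_norm M_exp (\<lambda>t. x t - y t) < r n" for n
      using x r by (simp add: H_space_def)
    then obtain y where y: "\<And>n. y n \<in> L_infinity" "\<And>n. orlicz_norm M_exp (\<lambda>t. x t - y n t) < r n"
      by metis
    have yX: "y n \<in> X" for n
      using y L_infinity_subset by blast
    note ym = mem_measurable[OF yX]
    have rb: "r n \<in> orlicz_bounds M_exp (\<lambda>t. x t - y n t)" for n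
    proof (rule orlicz_norm_less_imp_bounds[OF _ y(2)])
      obtain B where "AE t in unit_measure. \<bar>y n t\<bar> \<le> B"
        using y(1)[of n] by (auto simp: L_infinity_def)
      then show "orlicz_bounds M_exp (\<lambda>t. x t - y n t) \<noteq> {}"
        using orlicz_bounds_bounded[of "y n" B] xb orlicz_bounds_diff[OF _ _ xm ym] by blast
    qed
    have diff: "N (\<lambda>t. y m t - y n t) \<le> D * (r m + r n)" for m n
      unfolding D_def
    proof (rule bounded_norm_le[OF C])
      obtain B where B: "AE t in unit_measure. \<bar>y n t\<bar> \<le> B"
        using y(1)[of n] by (auto simp: L_infinity_def)
      obtain B' where "AE t in unit_measure. \<bar>y m t\<bar> \<le> B'"
        using y(1)[of m] by (auto simp: L_infinity_def)
      with B have "AE t in unit_measure. \<bar>y m t - y n t\<bar> \<le> B' + B"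
        by eventually_elim linarith
      then show "(\<lambda>t. y m t - y n t) \<in> L_infinity"
        using ym by (auto simp: L_infinity_def intro!: borel_measurable_diff)
      have "r n + r m \<in> orlicz_bounds M_exp (\<lambda>t. (x t - y n t) - (x t - y m t))"
        by (intro orlicz_bounds_diff rb borel_measurable_diff xm ym)
      then show "r m + r n \<in> orlicz_bounds M_exp (\<lambda>t. y m t - y n t)"
        by (simp add: add.commute)
    qed
    have "\<exists>g\<in>X. (\<lambda>n. N (\<lambda>t. y n t - g t)) \<longlonglongrightarrow> 0"
    proof (rule complete[OF yX])
      fix e :: real assume e: "0 < e"
      have "\<forall>\<^sub>F n in sequentially. r n < e / (2 * D)"
        using r0 e D by (intro order_tendstoD(2)) auto
      then obtain K where K: "\<And>n. K \<le> n \<Longrightarrow> r n < e / (2 * D)"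
        by (auto simp: eventually_sequentially)
      have "N (\<lambda>t. y m t - y n t) < e" if "K \<le> m" "K \<le> n" for m n
      proof -
        have "D * (r m + r n) < D * (e / (2 * D) + e / (2 * D))"
          using K that D by (intro mult_strict_left_mono add_strict_mono) auto
        also have "\<dots> = e"
          using D by (simp add: field_simps)
        finally show ?thesis
          using diff[of m n] by linarith
      qed
      then show "\<exists>K. \<forall>m\<ge>K. \<forall>n\<ge>K. N (\<lambda>t. y m t - y n t) < e"
        by blast
    qed
    then obtain g where g: "g \<in> X" "(\<lambda>n. N (\<lambda>t. y n t - g t)) \<longlonglongrightarrow> 0"
      by blast
    have gx: "AE t in unit_measure. g t = x t"
    proof (rule convergence_limit_unique[OF g(1) yX xm g(2)])
      fix e :: real assume e: "0 < e"
      have bound: "distr_fun (\<lambda>t. x t - y n t) e \<le> 2 * exp (- (e * real (Suc n)))" for n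
        using orlicz_bounds_exp_tail[OF rb, of n "e * real (Suc n)"] e xm ym
        by (simp add: r_def borel_measurable_diff)
      have lim: "(\<lambda>n. 2 * exp (- (e * real (Suc n)))) \<longlonglongrightarrow> 0"
      proof -
        have "(\<lambda>n. 2 * exp (- e) ^ Suc n) \<longlonglongrightarrow> 2 * 0"
          using e by (intro tendsto_mult tendsto_const LIMSEQ_Suc[OF LIMSEQ_power_zero]) auto
        then show ?thesis
          by (simp only: exp_of_nat2_mult[symmetric]) simp
      qed
      show "(\<lambda>n. distr_fun (\<lambda>t. x t - y n t) e) \<longlonglongrightarrow> 0"
        by (rule tendsto_sandwich[OF _ _ tendsto_const lim])
           (rule always_eventually, rule allI, rule distr_fun_nonneg,
            rule always_eventually, rule allI, rule bound)
    qed
    have xX: "x \<in> X" and Nx: "N x = N g"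
      using AE_eq_norm[OF g(1) xm gx] by auto
    have "N x \<le> D * l" if l: "l \<in> orlicz_bounds M_exp x" for l
    proof -
      have "N x \<le> N (\<lambda>t. y n t - g t) + D * (l + r n)" for n
      proof -
        have "N x \<le> N (\<lambda>t. g t - y n t) + N (y n)"
          unfolding Nx by (rule norm_le_norm_diff[OF g(1) yX])
        also have "N (y n) \<le> D * (l + r n)"
          unfolding D_def
        proof (rule bounded_norm_le[OF C y(1)])
          have "l + r n \<in> orlicz_bounds M_exp (\<lambda>t. x t - (x t - y n t))"
            by (intro orlicz_bounds_diff l rb borel_measurable_diff xm ym)
          then show "l + r n \<in> orlicz_bounds M_exp (y n)"
            by simp
        qed
        finally show ?thesis
          using norm_diff_commute[OF g(1) yX] by simp
      qed
      moreover have "(\<lambda>n. N (\<lambda>t. y n t - g t) + D * (l + r n)) \<longlonglongrightarrow> 0 + D * (l + 0)"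
        by (intro tendsto_intros g r0)
      ultimately have "N x \<le> 0 + D * (l + 0)"
        by (intro LIMSEQ_le_const) auto
      then show ?thesis
        by simp
    qed
    then have "N x / D \<le> orlicz_norm M_exp x"
      unfolding orlicz_norm_def using xb D by (intro cInf_greatest) (auto simp: divide_le_eq mult.commute)
    then show ?thesis
      using xX D by (simp add: divide_le_eq mult.commute)
  qed
  then show ?thesis
    unfolding continuously_embedded_def using D by blast
qed

lemma embedded_imp_chaos_poly_upper:
  assumes "continuously_embedded H_space (orlicz_norm M_exp) X N"
  obtains C where "0 < C" "\<And>F a. finite F \<Longrightarrow> F \<subseteq> chaos_index \<Longrightarrow> N (chaos_poly F a) \<le> C * sqrt (\<Sum>p\<in>F. (a p)\<^sup>2)"
proof -
  obtain C where C: "0 < C" "\<And>x. x \<in> H_space \<Longrightarrow> N x \<le> C * orlicz_norm M_exp x"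
    using assms by (auto simp: continuously_embedded_def)
  have "N (chaos_poly F a) \<le> C * (4 * exp 1) * sqrt (\<Sum>p\<in>F. (a p)\<^sup>2)"
    if F: "finite F" "F \<subseteq> chaos_index" for F a
  proof -
    let ?s = "4 * exp 1 * sqrt (\<Sum>p\<in>F. (a p)\<^sup>2)"
    \<comment> \<open>An admissible factor has to be positive, whereas \<open>?s\<close> vanishes
      when all coefficients do.\<close>
    have "orlicz_norm M_exp (chaos_poly F a) \<le> ?s + e" if "0 < e" for e
    proof (intro orlicz_norm_le)
      have "0 < ?s + e"
        using that by (intro add_nonneg_pos mult_nonneg_nonneg) (auto simp: sum_nonneg)
      then show "?s + e \<in> orlicz_bounds M_exp (chaos_poly F a)"
        using chaos_poly_exp_integral[OF F, of "?s + e" a] that by (simp add: orlicz_bounds_def)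
    qed
    then have "orlicz_norm M_exp (chaos_poly F a) \<le> ?s"
      by (rule field_le_epsilon)
    then have "C * orlicz_norm M_exp (chaos_poly F a) \<le> C * ?s"
      using C by simp
    moreover have "chaos_poly F a \<in> H_space"
      using simple_L_infinity[OF chaos_poly_simple] L_infinity_subset_H by blast
    ultimately show ?thesis
      using C(2)[of "chaos_poly F a"] by simp
  qed
  moreover have "0 < C * (4 * exp 1)"
    using C by simp
  ultimately show ?thesis
    using that by blast
qed

end

section \<open>Infinite chaos sums\<close>

definition energy :: "(nat \<times> nat \<Rightarrow> real) \<Rightarrow> (nat \<times> nat) set \<Rightarrow> real" where
  "energy a F = (\<Sum>p\<in>F. (a p)\<^sup>2)"

definition total_energy :: "(nat \<times> nat \<Rightarrow> real) \<Rightarrow> real" where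
  "total_energy a = (\<Sum>\<^sub>\<infinity>p\<in>chaos_index. (a p)\<^sup>2)"

lemma energy_tendsto:
  assumes "a \<in> chaos_ell2"
  shows "(energy a \<longlongrightarrow> total_energy a) (finite_subsets_at_top chaos_index)"
proof -
  have "((\<lambda>p. (a p)\<^sup>2) has_sum total_energy a) chaos_index"
    using assms by (simp add: chaos_ell2_def total_energy_def)
  then show ?thesis
    by (simp add: has_sum_def energy_def[abs_def])
qed

lemma energy_le_total:
  assumes "a \<in> chaos_ell2" "finite F" "F \<subseteq> chaos_index"
  shows "energy a F \<le> total_energy a"
  unfolding energy_def total_energy_def
  using assms by (intro finite_sum_le_infsum) (auto simp: chaos_ell2_def)

text \<open>The sign is put into the coefficients, so that the moment and exponential estimates
  apply to a difference as to a single chaos.\<close>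

lemma chaos_poly_diff:
  assumes "finite F" "finite G"
  shows "chaos_poly F a t - chaos_poly G a t
    = chaos_poly ((F - G) \<union> (G - F)) (\<lambda>p. if p \<in> F then a p else - a p) t"
proof -
  have "chaos_poly F a t - chaos_poly G a t = chaos_poly (F - G) a t - chaos_poly (G - F) a t"
    using sum.Int_Diff[OF assms(1), of "\<lambda>p. a p * chaos_fun p t" G]
      sum.Int_Diff[OF assms(2), of "\<lambda>p. a p * chaos_fun p t" F]
    by (simp add: chaos_poly_def Int_commute)
  also have "\<dots> = chaos_poly ((F - G) \<union> (G - F)) (\<lambda>p. if p \<in> F then a p else - a p) t"
    unfolding chaos_poly_def using assms
    by (subst sum.union_disjoint) (auto simp: sum_negf intro!: sum.cong)
  finally show ?thesis .
qed

lemma energy_diff_le: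
  assumes a: "a \<in> chaos_ell2" and F: "finite F" "F \<subseteq> chaos_index" and G: "finite G" "G \<subseteq> chaos_index"
  shows "(\<Sum>p\<in>(F - G) \<union> (G - F). (if p \<in> F then a p else - a p)\<^sup>2)
    \<le> (total_energy a - energy a F) + (total_energy a - energy a G)"
proof -
  have "(\<Sum>p\<in>(F - G) \<union> (G - F). (if p \<in> F then a p else - a p)\<^sup>2) = energy a (F - G) + energy a (G - F)"
    unfolding energy_def using F G by (subst sum.union_disjoint) (auto intro!: sum.cong)
  moreover have "energy a (F \<union> G) = energy a G + energy a (F - G)" "energy a (F \<union> G) = energy a F + energy a (G - F)"
    unfolding energy_def using F G
    by (simp_all add: sum.union_disjoint[symmetric] Un_commute)
  moreover have "energy a (F \<union> G) \<le> total_energy a"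
    using a F G by (intro energy_le_total) auto
  ultimately show ?thesis
    by linarith
qed

lemma chaos_poly_diff_second_moment:
  assumes a: "a \<in> chaos_ell2" and F: "finite F" "F \<subseteq> chaos_index" and G: "finite G" "G \<subseteq> chaos_index"
  shows "(\<integral>\<^sup>+ t. ennreal ((chaos_poly F a t - chaos_poly G a t)\<^sup>2) \<partial>unit_measure)
    \<le> ennreal ((total_energy a - energy a F) + (total_energy a - energy a G))"
proof -
  let ?D = "(F - G) \<union> (G - F)" and ?b = "\<lambda>p. if p \<in> F then a p else - a p"
  have D: "finite ?D" "?D \<subseteq> chaos_index"
    using F G by auto
  have "(\<integral>\<^sup>+ t. ennreal ((chaos_poly F a t - chaos_poly G a t)\<^sup>2) \<partial>unit_measure)
      = (\<integral>\<^sup>+ t. ennreal ((chaos_poly ?D ?b t)\<^sup>2) \<partial>unit_measure)"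
    using chaos_poly_diff[OF F(1) G(1)] by simp
  also have "\<dots> = ennreal (expectation (\<lambda>t. (chaos_poly ?D ?b t)\<^sup>2))"
    by (intro nn_integral_eq_integral integrable_simple_unit simple_function_compose1[OF chaos_poly_simple]) auto
  also have "\<dots> \<le> ennreal ((total_energy a - energy a F) + (total_energy a - energy a G))"
    unfolding chaos_poly_second_moment[OF D] by (intro ennreal_leI energy_diff_le assms)
  finally show ?thesis .
qed

lemma chaos_poly_diff_exp_integral:
  assumes a: "a \<in> chaos_ell2" and F: "finite F" "F \<subseteq> chaos_index" and G: "finite G" "G \<subseteq> chaos_index"
    and l: "0 < l" "4 * exp 1 * sqrt ((total_energy a - energy a F) + (total_energy a - energy a G)) \<le> l"
  shows "(\<integral>\<^sup>+ t. ennreal (M_exp (\<bar>chaos_poly F a t - chaos_poly G a t\<bar> / l)) \<partial>unit_measure) \<le> 1"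
proof -
  let ?D = "(F - G) \<union> (G - F)" and ?b = "\<lambda>p. if p \<in> F then a p else - a p"
  have D: "finite ?D" "?D \<subseteq> chaos_index"
    using F G by auto
  have "4 * exp 1 * sqrt (\<Sum>p\<in>?D. (?b p)\<^sup>2) \<le> 4 * exp 1 * sqrt ((total_energy a - energy a F) + (total_energy a - energy a G))"
    by (intro mult_left_mono real_sqrt_le_mono energy_diff_le a F G) auto
  also note l(2)
  finally show ?thesis
    using chaos_poly_exp_integral[OF D l(1), of ?b] by (simp only: chaos_poly_diff[OF F(1) G(1)])
qed

lemma exhausting_sequence:
  assumes a: "a \<in> chaos_ell2" and r: "\<And>n. 0 < r n"
  obtains F :: "nat \<Rightarrow> (nat \<times> nat) set" where "\<And>n. finite (F n)" "\<And>n. F n \<subseteq> chaos_index"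
    "\<And>n. F n \<subseteq> F (Suc n)" "\<And>n. total_energy a - energy a (F n) \<le> r n"
proof -
  have "\<exists>F0. finite F0 \<and> F0 \<subseteq> chaos_index \<and>
      (\<forall>F. finite F \<and> F0 \<subseteq> F \<and> F \<subseteq> chaos_index \<longrightarrow> total_energy a - r n < energy a F)" for n
    using order_tendstoD(1)[OF energy_tendsto[OF a], of "total_energy a - r n"] r[of n]
    unfolding eventually_finite_subsets_at_top by auto
  then obtain F0 where F0: "\<And>n. finite (F0 n)" "\<And>n. F0 n \<subseteq> chaos_index"
    "\<And>n F. finite F \<Longrightarrow> F0 n \<subseteq> F \<Longrightarrow> F \<subseteq> chaos_index \<Longrightarrow> total_energy a - r n < energy a F"
    by metis
  show ?thesis
  proof (rule that[of "\<lambda>n. \<Union>i\<le>n. F0 i"])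
    fix n
    show fin: "finite (\<Union>i\<le>n. F0 i)" and sub: "(\<Union>i\<le>n. F0 i) \<subseteq> chaos_index"
      using F0 by auto
    show "(\<Union>i\<le>n. F0 i) \<subseteq> (\<Union>i\<le>Suc n. F0 i)"
      by (simp add: atMost_Suc)
    have "total_energy a - r n < energy a (\<Union>i\<le>n. F0 i)"
      by (rule F0(3)[OF fin _ sub]) auto
    then show "total_energy a - energy a (\<Union>i\<le>n. F0 i) \<le> r n"
      by simp
  qed
qed

text \<open>A pointwise limit is needed because Fatou's lemma is to carry both the L2 and the
  exponential estimates to the infinite sum.\<close>

lemma chaos_poly_AE_convergent:
  assumes a: "a \<in> chaos_ell2"
  obtains F f where "\<And>n. finite (F n)" "\<And>n. F n \<subseteq> chaos_index"
    "(\<lambda>n. total_energy a - energy a (F n)) \<longlonglongrightarrow> 0"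
    "f \<in> borel_measurable unit_measure"
    "AE t in unit_measure. (\<lambda>n. chaos_poly (F n) a t) \<longlonglongrightarrow> f t"
proof -
  \<comment> \<open>With this rate the increments have squared L2 norm at most 16^(-n). The weighted
    inequality \<open>ptw\<close> then bounds their L1 norm by 4^(-n), so the sum of their absolute
    values is finite almost everywhere.\<close>
  obtain F where F: "\<And>n. finite (F n)" "\<And>n. F n \<subseteq> chaos_index" "\<And>n. F n \<subseteq> F (Suc n)"
    "\<And>n. total_energy a - energy a (F n) \<le> (1 / 16) ^ n / 2"
    using exhausting_sequence[OF a, of "\<lambda>n. (1 / 16) ^ n / 2"] by auto
  have nonneg: "0 \<le> total_energy a - energy a (F n)" for n
    using energy_le_total[OF a F(1,2)] by simp
  have lim: "(\<lambda>n. total_energy a - energy a (F n)) \<longlonglongrightarrow> 0"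
  proof (rule tendsto_sandwich[OF _ _ tendsto_const])
    have "(\<lambda>n. (1 / 16 :: real) ^ n / 2) \<longlonglongrightarrow> 0 / 2"
      by (intro tendsto_divide LIMSEQ_power_zero tendsto_const) auto
    then show "(\<lambda>n. (1 / 16 :: real) ^ n / 2) \<longlonglongrightarrow> 0"
      by simp
  qed (use nonneg F(4) in \<open>auto intro!: always_eventually\<close>)
  define g where "g n t = chaos_poly (F n) a t" for n t
  have gm: "g n \<in> borel_measurable unit_measure" for n
    unfolding g_def by (rule simple_borel_unit[OF chaos_poly_simple])
  define u where "u n t = g (Suc n) t - g n t" for n t
  have um: "u n \<in> borel_measurable unit_measure" for n
    unfolding u_def by (intro borel_measurable_diff gm)
  have u1: "(\<integral>\<^sup>+ t. ennreal \<bar>u n t\<bar> \<partial>unit_measure) \<le> ennreal ((1 / 4) ^ n)" for n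
  proof -
    have ptw: "\<bar>x\<bar> \<le> 4 ^ n / 2 * x\<^sup>2 + (1 / 4) ^ n / 2" for x :: real
    proof -
      have "0 \<le> (2 ^ n * \<bar>x\<bar> - (1 / 2) ^ n)\<^sup>2"
        by simp
      also have "\<dots> = 4 ^ n * x\<^sup>2 + (1 / 4) ^ n - 2 * \<bar>x\<bar>"
        by (simp add: power2_eq_square algebra_simps power_divide flip: power_mult_distrib)
      finally show ?thesis
        by simp
    qed
    have "(\<integral>\<^sup>+ t. ennreal ((u n t)\<^sup>2) \<partial>unit_measure)
        \<le> ennreal ((total_energy a - energy a (F (Suc n))) + (total_energy a - energy a (F n)))"
      unfolding u_def g_def by (intro chaos_poly_diff_second_moment a F)
    also have "\<dots> \<le> ennreal ((1 / 16) ^ n)"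
    proof (intro ennreal_leI)
      have "(0::real) \<le> (1 / 16) ^ n"
        by simp
      with F(4)[of n] F(4)[of "Suc n"]
      show "(total_energy a - energy a (F (Suc n))) + (total_energy a - energy a (F n)) \<le> (1 / 16) ^ n"
        unfolding power_Suc by linarith
    qed
    finally have u2: "(\<integral>\<^sup>+ t. ennreal ((u n t)\<^sup>2) \<partial>unit_measure) \<le> ennreal ((1 / 16) ^ n)" .
    have "(\<integral>\<^sup>+ t. ennreal \<bar>u n t\<bar> \<partial>unit_measure)
        \<le> (\<integral>\<^sup>+ t. ennreal (4 ^ n / 2) * ennreal ((u n t)\<^sup>2) + ennreal ((1 / 4) ^ n / 2) \<partial>unit_measure)"
      using ptw by (intro nn_integral_mono) (simp flip: ennreal_mult ennreal_plus add: ennreal_leI)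
    also have "\<dots> = ennreal (4 ^ n / 2) * (\<integral>\<^sup>+ t. ennreal ((u n t)\<^sup>2) \<partial>unit_measure) + ennreal ((1 / 4) ^ n / 2)"
      using um[of n] by (subst nn_integral_add) (auto simp: nn_integral_cmult emeasure_restrict_space)
    also have "\<dots> \<le> ennreal (4 ^ n / 2) * ennreal ((1 / 16) ^ n) + ennreal ((1 / 4) ^ n / 2)"
      by (intro add_mono mult_left_mono u2) auto
    also have "\<dots> = ennreal ((1 / 4) ^ n)"
      by (simp flip: ennreal_mult ennreal_plus power_mult_distrib)
    finally show ?thesis .
  qed
  have "(\<integral>\<^sup>+ t. (\<Sum>n. ennreal \<bar>u n t\<bar>) \<partial>unit_measure) = (\<Sum>n. \<integral>\<^sup>+ t. ennreal \<bar>u n t\<bar> \<partial>unit_measure)"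
    using um by (intro nn_integral_suminf) auto
  also have "\<dots> \<le> (\<Sum>n. ennreal ((1 / 4) ^ n))"
    by (intro suminf_le u1 summableI)
  also have "\<dots> = ennreal (4 / 3)"
    using geometric_sums[of "1 / 4 :: real"] by (intro suminf_ennreal_eq) auto
  finally have "(\<integral>\<^sup>+ t. (\<Sum>n. ennreal \<bar>u n t\<bar>) \<partial>unit_measure) \<noteq> \<infinity>"
    by (auto simp: top_unique)
  moreover have "(\<lambda>t. \<Sum>n. ennreal \<bar>u n t\<bar>) \<in> borel_measurable unit_measure"
    using um by (intro borel_measurable_suminf_order) auto
  ultimately have "AE t in unit_measure. (\<Sum>n. ennreal \<bar>u n t\<bar>) \<noteq> \<infinity>"
    by (intro nn_integral_PInf_AE)
  then have conv: "AE t in unit_measure. convergent (\<lambda>n. g n t)"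
  proof (rule eventually_mono)
    fix t assume "(\<Sum>n. ennreal \<bar>u n t\<bar>) \<noteq> \<infinity>"
    then have "summable (\<lambda>n. \<bar>u n t\<bar>)"
      by (intro summable_suminf_not_top) auto
    then have "summable (\<lambda>n. u n t)"
      by (rule summable_rabs_cancel)
    then have "convergent (\<lambda>n. \<Sum>k<n. u k t)"
      by (simp add: summable_iff_convergent)
    moreover have "(\<Sum>k<n. u k t) = g n t - g 0 t" for n
      unfolding u_def by (rule sum_lessThan_telescope)
    ultimately have "convergent (\<lambda>n. (g n t - g 0 t) + g 0 t)"
      by (intro convergent_add convergent_const) simp
    then show "convergent (\<lambda>n. g n t)"
      by simp
  qed
  have fm: "(\<lambda>t. lim (\<lambda>n. g n t)) \<in> borel_measurable unit_measure"
    using gm by (rule borel_measurable_lim_metric)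
  have "AE t in unit_measure. (\<lambda>n. g n t) \<longlonglongrightarrow> lim (\<lambda>n. g n t)"
    using conv by (rule eventually_mono) (simp add: convergent_LIMSEQ_iff)
  then show ?thesis
    using that[OF F(1,2) lim fm] by (simp add: g_def)
qed

text \<open>Fatou's lemma. The bound is asked only eventually, since in the exponential case a fixed
  \<open>l\<close> becomes admissible only for late partial sums.\<close>

lemma nn_integral_liminf_le:
  fixes f :: "real \<Rightarrow> real" and g :: "nat \<Rightarrow> real \<Rightarrow> real"
  assumes G: "continuous_on UNIV G"
    and g: "\<And>n. g n \<in> borel_measurable unit_measure"
    and conv: "AE t in unit_measure. (\<lambda>n. g n t) \<longlonglongrightarrow> f t"
    and le: "\<forall>\<^sub>F n in sequentially. (\<integral>\<^sup>+ t. ennreal (G (g n t)) \<partial>unit_measure) \<le> c n" and c: "c \<longlonglongrightarrow> C"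
  shows "(\<integral>\<^sup>+ t. ennreal (G (f t)) \<partial>unit_measure) \<le> C"
proof -
  have Gm: "G \<in> borel_measurable borel"
    using G by (rule borel_measurable_continuous_onI)
  have "(\<integral>\<^sup>+ t. ennreal (G (f t)) \<partial>unit_measure)
      = (\<integral>\<^sup>+ t. liminf (\<lambda>n. ennreal (G (g n t))) \<partial>unit_measure)"
  proof (rule nn_integral_cong_AE)
    show "AE t in unit_measure. ennreal (G (f t)) = liminf (\<lambda>n. ennreal (G (g n t)))"
      using conv
    proof eventually_elim
      case (elim t)
      then have "(\<lambda>n. ennreal (G (g n t))) \<longlonglongrightarrow> ennreal (G (f t))"
        using G by (intro tendsto_ennrealI isCont_tendsto_compose[of _ G])
          (auto simp: continuous_on_eq_continuous_at)
      then show ?case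
        by (intro lim_imp_Liminf[symmetric]) auto
    qed
  qed
  also have "\<dots> \<le> liminf (\<lambda>n. \<integral>\<^sup>+ t. ennreal (G (g n t)) \<partial>unit_measure)"
    using measurable_compose[OF g Gm] by (intro nn_integral_liminf) auto
  also have "\<dots> \<le> liminf c"
    using le by (rule Liminf_mono)
  also have "\<dots> = C"
    using c by (intro lim_imp_Liminf) auto
  finally show ?thesis .
qed

text \<open>The inequality for \<open>l\<close> is strict because the partial sums satisfy it only
  with an error tending to 0; the slack lets the estimate hold from some point on.\<close>

lemma chaos_sum_exists:
  assumes a: "a \<in> chaos_ell2"
  obtains f where "f \<in> borel_measurable unit_measure"
    "\<And>F. finite F \<Longrightarrow> F \<subseteq> chaos_index \<Longrightarrow>
       (\<integral>\<^sup>+ t. ennreal ((chaos_poly F a t - f t)\<^sup>2) \<partial>unit_measure) \<le> ennreal (total_energy a - energy a F)"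
    "\<And>F l. finite F \<Longrightarrow> F \<subseteq> chaos_index \<Longrightarrow> 4 * exp 1 * sqrt (total_energy a - energy a F) < l \<Longrightarrow>
       l \<in> orlicz_bounds M_exp (\<lambda>t. f t - chaos_poly F a t)"
proof -
  obtain G f where G: "\<And>n. finite (G n)" "\<And>n. G n \<subseteq> chaos_index"
    and lim: "(\<lambda>n. total_energy a - energy a (G n)) \<longlonglongrightarrow> 0"
    and f: "f \<in> borel_measurable unit_measure" "AE t in unit_measure. (\<lambda>n. chaos_poly (G n) a t) \<longlonglongrightarrow> f t"
    by (rule chaos_poly_AE_convergent[OF a]) blast
  have pm: "chaos_poly F a \<in> borel_measurable unit_measure" for F
    by (rule simple_borel_unit[OF chaos_poly_simple])
  show ?thesis
  proof (rule that[OF f(1)])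
    fix F assume F: "finite F" "F \<subseteq> chaos_index"
    have conv: "AE t in unit_measure. (\<lambda>n. chaos_poly F a t - chaos_poly (G n) a t) \<longlonglongrightarrow> chaos_poly F a t - f t"
      using f(2) by eventually_elim (intro tendsto_intros)
    have lim2: "(\<lambda>n. (total_energy a - energy a F) + (total_energy a - energy a (G n)))
        \<longlonglongrightarrow> total_energy a - energy a F"
      using tendsto_add[OF tendsto_const[of "total_energy a - energy a F"] lim] by (simp only: add_0_right)
    show "(\<integral>\<^sup>+ t. ennreal ((chaos_poly F a t - f t)\<^sup>2) \<partial>unit_measure) \<le> ennreal (total_energy a - energy a F)"
    proof (rule nn_integral_liminf_le[where G = "\<lambda>x. x\<^sup>2", OF _ _ conv])
      show "(\<lambda>n. ennreal ((total_energy a - energy a F) + (total_energy a - energy a (G n))))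
          \<longlonglongrightarrow> ennreal (total_energy a - energy a F)"
        using lim2 by (rule tendsto_ennrealI)
      show "\<forall>\<^sub>F n in sequentially. (\<integral>\<^sup>+ t. ennreal ((chaos_poly F a t - chaos_poly (G n) a t)\<^sup>2) \<partial>unit_measure)
          \<le> ennreal ((total_energy a - energy a F) + (total_energy a - energy a (G n)))"
        by (intro always_eventually allI chaos_poly_diff_second_moment a F G)
    qed (auto intro!: continuous_intros borel_measurable_diff pm)
    fix l assume l: "4 * exp 1 * sqrt (total_energy a - energy a F) < l"
    have "0 \<le> total_energy a - energy a F"
      using energy_le_total[OF a F] by simp
    then have l0: "0 < l"
      using l by (intro order.strict_trans1[OF _ l]) auto
    have "(\<integral>\<^sup>+ t. ennreal (M_exp (\<bar>chaos_poly F a t - f t\<bar> / l)) \<partial>unit_measure) \<le> 1"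
    proof (rule nn_integral_liminf_le[where G = "\<lambda>x. M_exp (\<bar>x\<bar> / l)", OF _ _ conv])
      have "(\<lambda>n. 4 * exp 1 * sqrt ((total_energy a - energy a F) + (total_energy a - energy a (G n))))
          \<longlonglongrightarrow> 4 * exp 1 * sqrt (total_energy a - energy a F)"
        by (intro tendsto_intros lim2)
      then have "\<forall>\<^sub>F n in sequentially. 4 * exp 1 * sqrt ((total_energy a - energy a F) + (total_energy a - energy a (G n))) < l"
        using l by (rule order_tendstoD(2))
      then show "\<forall>\<^sub>F n in sequentially.
          (\<integral>\<^sup>+ t. ennreal (M_exp (\<bar>chaos_poly F a t - chaos_poly (G n) a t\<bar> / l)) \<partial>unit_measure) \<le> 1"
        by eventually_elim (intro chaos_poly_diff_exp_integral a F G l0 less_imp_le)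
    qed (use l0 in \<open>auto simp: M_exp_def intro!: continuous_intros borel_measurable_diff pm\<close>)
    then show "l \<in> orlicz_bounds M_exp (\<lambda>t. f t - chaos_poly F a t)"
      using l0 by (simp add: orlicz_bounds_def abs_minus_commute)
  qed
qed

text \<open>\<open>chaos_sum\<close> is an arbitrary choice. Any two L2 limits agree almost
  everywhere, so the estimates proved for the constructed limit pass to the chosen one.\<close>

lemma chaos_sum_props:
  assumes a: "a \<in> chaos_ell2"
  shows chaos_sum_measurable: "chaos_sum a \<in> borel_measurable unit_measure"
    and chaos_sum_orlicz_bounds: "\<And>F l. finite F \<Longrightarrow> F \<subseteq> chaos_index \<Longrightarrow>
       4 * exp 1 * sqrt (total_energy a - energy a F) < l \<Longrightarrow>
       l \<in> orlicz_bounds M_exp (\<lambda>t. chaos_sum a t - chaos_poly F a t)"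
proof -
  obtain f where f: "f \<in> borel_measurable unit_measure"
    and f2: "\<And>F. finite F \<Longrightarrow> F \<subseteq> chaos_index \<Longrightarrow>
       (\<integral>\<^sup>+ t. ennreal ((chaos_poly F a t - f t)\<^sup>2) \<partial>unit_measure) \<le> ennreal (total_energy a - energy a F)"
    and fM: "\<And>F l. finite F \<Longrightarrow> F \<subseteq> chaos_index \<Longrightarrow> 4 * exp 1 * sqrt (total_energy a - energy a F) < l \<Longrightarrow>
       l \<in> orlicz_bounds M_exp (\<lambda>t. f t - chaos_poly F a t)"
    using chaos_sum_exists[OF a] by blast
  let ?L2 = "\<lambda>f. ((\<lambda>F. \<integral>\<^sup>+ t. ennreal ((chaos_poly F a t - f t)\<^sup>2) \<partial>unit_measure) \<longlongrightarrow> 0)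
       (finite_subsets_at_top chaos_index)"
  let ?P = "\<lambda>f. f \<in> borel_measurable unit_measure \<and> ?L2 f"
  have pm: "chaos_poly F a \<in> borel_measurable unit_measure" for F
    by (rule simple_borel_unit[OF chaos_poly_simple])
  have "((\<lambda>F. ennreal (total_energy a - energy a F)) \<longlongrightarrow> ennreal (total_energy a - total_energy a))
      (finite_subsets_at_top chaos_index)"
    by (intro tendsto_ennrealI tendsto_diff tendsto_const energy_tendsto a)
  then have "((\<lambda>F. ennreal (total_energy a - energy a F)) \<longlongrightarrow> 0) (finite_subsets_at_top chaos_index)"
    by simp
  then have L2f: "?L2 f"
    by (rule tendsto_sandwich[OF _ _ tendsto_const, rotated 2])
       (auto intro!: always_eventually eventually_finite_subsets_at_top_weakI f2)
  then have "?P f"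
    using f by blast
  then have "?P (SOME f. ?P f)"
    by (rule someI[of ?P f])
  moreover have cs: "chaos_sum a = (SOME f. ?P f)"
    unfolding chaos_sum_def chaos_poly_def ..
  ultimately have m: "chaos_sum a \<in> borel_measurable unit_measure" and L2: "?L2 (chaos_sum a)"
    by simp_all
  show "chaos_sum a \<in> borel_measurable unit_measure"
    by (rule m)
  let ?d = "\<integral>\<^sup>+ t. ennreal ((f t - chaos_sum a t)\<^sup>2) \<partial>unit_measure"
  have "?d \<le> 2 * (\<integral>\<^sup>+ t. ennreal ((chaos_poly F a t - f t)\<^sup>2) \<partial>unit_measure)
      + 2 * (\<integral>\<^sup>+ t. ennreal ((chaos_poly F a t - chaos_sum a t)\<^sup>2) \<partial>unit_measure)" for F
  proof -
    have "(x - y)\<^sup>2 \<le> 2 * (z - x)\<^sup>2 + 2 * (z - y)\<^sup>2" for x y z :: real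
    proof -
      have "0 \<le> (2 * z - x - y)\<^sup>2"
        by simp
      then show ?thesis
        by (simp add: power2_eq_square algebra_simps)
    qed
    then have "?d \<le> (\<integral>\<^sup>+ t. 2 * ennreal ((chaos_poly F a t - f t)\<^sup>2) + 2 * ennreal ((chaos_poly F a t - chaos_sum a t)\<^sup>2) \<partial>unit_measure)"
      by (intro nn_integral_mono) (simp flip: ennreal_numeral ennreal_mult ennreal_plus add: ennreal_leI)
    also have "\<dots> = 2 * (\<integral>\<^sup>+ t. ennreal ((chaos_poly F a t - f t)\<^sup>2) \<partial>unit_measure)
      + 2 * (\<integral>\<^sup>+ t. ennreal ((chaos_poly F a t - chaos_sum a t)\<^sup>2) \<partial>unit_measure)"
      using f m pm[of F] by (subst nn_integral_add) (auto simp: nn_integral_cmult)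
    finally show ?thesis .
  qed
  moreover have "((\<lambda>F. 2 * (\<integral>\<^sup>+ t. ennreal ((chaos_poly F a t - f t)\<^sup>2) \<partial>unit_measure)
      + 2 * (\<integral>\<^sup>+ t. ennreal ((chaos_poly F a t - chaos_sum a t)\<^sup>2) \<partial>unit_measure)) \<longlongrightarrow> 2 * 0 + 2 * 0)
      (finite_subsets_at_top chaos_index)"
    using L2f L2 by (intro tendsto_add ennreal_tendsto_cmult) auto
  ultimately have "?d \<le> 2 * 0 + 2 * 0"
    by (intro tendsto_lowerbound[where F = "finite_subsets_at_top chaos_index"]) (auto intro!: always_eventually)
  then have "?d = 0"
    by simp
  then have "AE t in unit_measure. ennreal ((f t - chaos_sum a t)\<^sup>2) = 0"
    using f m by (subst (asm) nn_integral_0_iff_AE) auto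
  then have ae: "AE t in unit_measure. chaos_sum a t = f t"
    by (rule eventually_mono) (auto simp: ennreal_eq_0_iff)
  fix F l assume "finite F" "F \<subseteq> chaos_index" "4 * exp 1 * sqrt (total_energy a - energy a F) < l"
  then have l: "l \<in> orlicz_bounds M_exp (\<lambda>t. f t - chaos_poly F a t)"
    by (rule fM)
  have "(\<integral>\<^sup>+ t. ennreal (M_exp (\<bar>chaos_sum a t - chaos_poly F a t\<bar> / l)) \<partial>unit_measure)
      = (\<integral>\<^sup>+ t. ennreal (M_exp (\<bar>f t - chaos_poly F a t\<bar> / l)) \<partial>unit_measure)"
    by (rule nn_integral_cong_AE) (use ae in \<open>auto elim: eventually_mono\<close>)
  then show "l \<in> orlicz_bounds M_exp (\<lambda>t. chaos_sum a t - chaos_poly F a t)"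
    using l by (simp add: orlicz_bounds_def)
qed

lemma orlicz_norm_le_of_greater:
  assumes "\<And>l. s < l \<Longrightarrow> l \<in> orlicz_bounds M_exp x"
  shows "orlicz_norm M_exp x \<le> s"
  by (rule dense_ge) (intro orlicz_norm_le assms)

lemma ell2_norm_eq: "ell2_norm a = sqrt (total_energy a)"
  by (simp add: ell2_norm_def total_energy_def)

lemma total_energy_nonneg: "0 \<le> total_energy a"
  unfolding total_energy_def by (intro infsum_nonneg) auto

lemma H_space_diff_bounded:
  assumes x: "x \<in> H_space" and y: "y \<in> L_infinity"
  shows "(\<lambda>t. x t - y t) \<in> H_space"
proof -
  have ym: "y \<in> borel_measurable unit_measure"
    using y by (simp add: L_infinity_def)
  obtain B where "AE t in unit_measure. \<bar>y t\<bar> \<le> B"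
    using y by (auto simp: L_infinity_def)
  then obtain l' where l': "l' \<in> orlicz_bounds M_exp y"
    using orlicz_bounds_bounded by blast
  have xm: "x \<in> borel_measurable unit_measure"
    using x by (simp add: H_space_def orlicz_space_def)
  obtain l where l: "l \<in> orlicz_bounds M_exp x"
    using x by (auto simp: H_space_def orlicz_space_def)
  have "l + l' \<in> orlicz_bounds M_exp (\<lambda>t. x t - y t)"
    by (rule orlicz_bounds_diff[OF l l' xm ym])
  then have o: "(\<lambda>t. x t - y t) \<in> orlicz_space M_exp"
    using borel_measurable_diff[OF xm ym] by (auto simp: orlicz_space_def)
  have "\<exists>z\<in>L_infinity. orlicz_norm M_exp (\<lambda>t. (x t - y t) - z t) < e" if e: "0 < e" for e
  proof -
    obtain z where z: "z \<in> L_infinity" "orlicz_norm M_exp (\<lambda>t. x t - z t) < e"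
      using x e unfolding H_space_def by blast
    obtain B' where "AE t in unit_measure. \<bar>z t\<bar> \<le> B'"
      using z by (auto simp: L_infinity_def)
    with \<open>AE t in unit_measure. \<bar>y t\<bar> \<le> B\<close> have "AE t in unit_measure. \<bar>z t - y t\<bar> \<le> B' + B"
      by eventually_elim linarith
    then have "(\<lambda>t. z t - y t) \<in> L_infinity"
      using z ym by (auto simp: L_infinity_def)
    moreover have "orlicz_norm M_exp (\<lambda>t. (x t - y t) - (z t - y t)) < e"
      using z by simp
    ultimately show ?thesis
      by (intro bexI[of _ "\<lambda>t. z t - y t"])
  qed
  then show ?thesis
    using o unfolding H_space_def by blast
qed

text \<open>\<open>F = {}\<close> gives the norm estimate. For large \<open>F\<close> the remaining
  energy is small, so the bounded partial sums converge in L_M and not only in L2, which is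
  membership in H.\<close>

lemma chaos_sum_in_H:
  assumes a: "a \<in> chaos_ell2"
  shows "chaos_sum a \<in> H_space" "orlicz_norm M_exp (chaos_sum a) \<le> 4 * exp 1 * ell2_norm a"
proof -
  have b: "l \<in> orlicz_bounds M_exp (chaos_sum a)" if "4 * exp 1 * ell2_norm a < l" for l
    using chaos_sum_orlicz_bounds[OF a, of "{}" l] that by (simp add: ell2_norm_eq energy_def chaos_poly_def)
  then show "orlicz_norm M_exp (chaos_sum a) \<le> 4 * exp 1 * ell2_norm a"
    by (rule orlicz_norm_le_of_greater)
  have "chaos_sum a \<in> orlicz_space M_exp"
    using b gt_ex chaos_sum_measurable[OF a] by (fastforce simp: orlicz_space_def)
  moreover have "\<exists>y\<in>L_infinity. orlicz_norm M_exp (\<lambda>t. chaos_sum a t - y t) < e" if e: "0 < e" for e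
  proof -
    have "((\<lambda>F. 4 * exp 1 * sqrt (total_energy a - energy a F)) \<longlongrightarrow> 4 * exp 1 * sqrt (total_energy a - total_energy a))
        (finite_subsets_at_top chaos_index)"
      by (intro tendsto_intros energy_tendsto a)
    then have "\<forall>\<^sub>F F in finite_subsets_at_top chaos_index. 4 * exp 1 * sqrt (total_energy a - energy a F) < e"
      using e by (intro order_tendstoD(2)) auto
    then obtain F where F: "finite F" "F \<subseteq> chaos_index" "4 * exp 1 * sqrt (total_energy a - energy a F) < e"
      unfolding eventually_finite_subsets_at_top by blast
    have "orlicz_norm M_exp (\<lambda>t. chaos_sum a t - chaos_poly F a t) \<le> 4 * exp 1 * sqrt (total_energy a - energy a F)"
      by (intro orlicz_norm_le_of_greater chaos_sum_orlicz_bounds a F)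
    then show ?thesis
      using F(3) simple_L_infinity[OF chaos_poly_simple] by (meson le_less_trans)
  qed
  ultimately show "chaos_sum a \<in> H_space"
    by (simp add: H_space_def)
qed

lemma chaos_sum_finite_support:
  assumes F: "finite F" "F \<subseteq> chaos_index" and zero: "\<And>p. p \<in> chaos_index - F \<Longrightarrow> a p = 0"
  shows "a \<in> chaos_ell2" "ell2_norm a = sqrt (energy a F)"
    "AE t in unit_measure. chaos_sum a t = chaos_poly F a t"
proof -
  have "(\<lambda>p. (a p)\<^sup>2) summable_on F"
    using F(1) by (rule summable_on_finite)
  then show a: "a \<in> chaos_ell2"
    unfolding chaos_ell2_def mem_Collect_eq
    by (rule summable_on_cong_neutral[THEN iffD1, rotated 3]) (use F zero in auto)
  have "total_energy a = (\<Sum>\<^sub>\<infinity>p\<in>F. (a p)\<^sup>2)"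
    unfolding total_energy_def using F zero by (intro infsum_cong_neutral) auto
  then have E: "total_energy a = energy a F"
    using F(1) by (simp add: energy_def)
  then show "ell2_norm a = sqrt (energy a F)"
    by (simp add: ell2_norm_eq)
  let ?d = "\<lambda>t. chaos_sum a t - chaos_poly F a t"
  have dm: "?d \<in> borel_measurable unit_measure"
    by (intro borel_measurable_diff chaos_sum_measurable a simple_borel_unit chaos_poly_simple)
  have "distr_fun ?d e = 0" if e: "0 < e" for e
  proof -
    \<comment> \<open>No energy is left outside \<open>F\<close>, so every positive factor is
      admissible; the factor e/(n + 1) at s = n + 1 tests the fixed level \<open>e\<close>.\<close>
    have bound: "distr_fun ?d e \<le> 2 * exp (- real (Suc n))" for n
      using orlicz_bounds_exp_tail[OF chaos_sum_orlicz_bounds[OF a F, of "e / real (Suc n)"] dm, of "real (Suc n)"] e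
      by (simp add: E)
    have "(\<lambda>n. 2 * exp (- real (Suc n))) \<longlonglongrightarrow> 2 * 0"
      by (intro tendsto_mult tendsto_const filterlim_compose[OF exp_at_bot]
          filterlim_compose[OF filterlim_uminus_at_bot_at_top] filterlim_compose[OF filterlim_real_sequentially]
          filterlim_Suc)
    then have "distr_fun ?d e \<le> 2 * 0"
      by (rule LIMSEQ_le_const) (use bound in blast)
    then show ?thesis
      using distr_fun_nonneg[of ?d e] by simp
  qed
  then have "AE t in unit_measure. ?d t = 0"
    by (rule distr_fun_zero_imp_AE[OF dm])
  then show "AE t in unit_measure. chaos_sum a t = chaos_poly F a t"
    by (rule eventually_mono) simp
qed

definition ell2_equivalent :: "(real \<Rightarrow> real) set \<Rightarrow> ((real \<Rightarrow> real) \<Rightarrow> real) \<Rightarrow> bool" where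
  "ell2_equivalent X N \<longleftrightarrow> (\<exists>C>0. \<forall>a\<in>chaos_ell2.
     ennreal (inverse C * ell2_norm a) \<le> extended_norm X N (chaos_sum a) \<and>
     extended_norm X N (chaos_sum a) \<le> ennreal (C * ell2_norm a))"

section \<open>Equivalence of the embedding with the ell_2 estimates\<close>

context symmetric_space
begin

text \<open>Only the upper estimate is used, for the block chaoses: \<open>16 ^ q\<close>
  coefficients \<open>1 / 4 ^ q\<close> have ell_2 norm 1.\<close>

lemma ell2_equivalent_imp_embedded:
  assumes "ell2_equivalent X N"
  shows "continuously_embedded H_space (orlicz_norm M_exp) X N"
proof -
  obtain C where C: "0 < C" "\<And>a. a \<in> chaos_ell2 \<Longrightarrow> extended_norm X N (chaos_sum a) \<le> ennreal (C * ell2_norm a)"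
    using assms by (auto simp: ell2_equivalent_def)
  have "N (block_chaos q) \<le> C" for q
  proof -
    define a where "a p = (if p \<in> chaos_block q then 1 / 4 ^ q else (0::real))" for p
    have zero: "a p = 0" if "p \<in> chaos_index - chaos_block q" for p
      using that by (simp add: a_def)
    note a = chaos_sum_finite_support[of "chaos_block q" a, OF finite_chaos_block chaos_block_subset zero]
    have "energy a (chaos_block q) = 1"
      by (simp add: energy_def a_def card_chaos_block power2_eq_square)
    then have "extended_norm X N (chaos_sum a) \<le> ennreal C"
      using C(2)[OF a(1)] a(2) by simp
    then have s: "chaos_sum a \<in> X" "N (chaos_sum a) \<le> C"
      using C(1) by (auto simp: extended_norm_def top_unique split: if_splits)
    have "chaos_poly (chaos_block q) a = block_chaos q"
      by (auto simp: block_chaos_def chaos_poly_def a_def intro!: sum.cong)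
    then have "AE t in unit_measure. chaos_sum a t = block_chaos q t"
      using a(3) by simp
    then show ?thesis
      using AE_eq_norm_eq[OF s(1) simple_borel_unit[OF block_chaos_simple]] s(2) by simp
  qed
  then show ?thesis
    by (rule block_chaos_bounded_imp_embedded)
qed

lemma embedded_imp_ell2_equivalent:
  assumes emb: "continuously_embedded H_space (orlicz_norm M_exp) X N"
  shows "ell2_equivalent X N"
proof -
  obtain C where C: "0 < C" "H_space \<subseteq> X" "\<And>x. x \<in> H_space \<Longrightarrow> N x \<le> C * orlicz_norm M_exp x"
    using emb by (auto simp: continuously_embedded_def)
  define c where "c = fundamental (1 / 162) / 2"
  have c: "0 < c"
    using fundamental_pos[of "1 / 162"] by (simp add: c_def)
  define K where "K = max (C * (4 * exp 1)) (1 / c)"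
  have "1 / c \<le> K" "0 < 1 / c"
    using c by (auto simp: K_def)
  then have K: "0 < K" "C * (4 * exp 1) \<le> K" "inverse K \<le> c"
    using le_imp_inverse_le[of "1 / c" K] by (linarith, simp add: K_def, simp)
  have upper: "chaos_sum a \<in> X" "N (chaos_sum a) \<le> C * (4 * exp 1) * ell2_norm a"
    if a: "a \<in> chaos_ell2" for a
  proof -
    show "chaos_sum a \<in> X"
      using chaos_sum_in_H(1)[OF a] C(2) by blast
    have "N (chaos_sum a) \<le> C * orlicz_norm M_exp (chaos_sum a)"
      by (rule C(3)[OF chaos_sum_in_H(1)[OF a]])
    also have "\<dots> \<le> C * (4 * exp 1 * ell2_norm a)"
      using C(1) by (intro mult_left_mono chaos_sum_in_H(2) a) auto
    finally show "N (chaos_sum a) \<le> C * (4 * exp 1) * ell2_norm a"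
      by simp
  qed
  \<comment> \<open>The estimate for finite sums passes to the limit because the embedding makes the
    remainder small in X.\<close>
  have lower: "c * ell2_norm a \<le> N (chaos_sum a)" if a: "a \<in> chaos_ell2" for a
  proof -
    let ?s = "\<lambda>F. sqrt (total_energy a - energy a F)"
    have "c * sqrt (energy a F) - C * (4 * exp 1 * ?s F) \<le> N (chaos_sum a)"
      if F: "finite F" "F \<subseteq> chaos_index" for F
    proof -
      let ?d = "\<lambda>t. chaos_sum a t - chaos_poly F a t"
      have "?d \<in> H_space"
        by (rule H_space_diff_bounded[OF chaos_sum_in_H(1)[OF a] simple_L_infinity[OF chaos_poly_simple]])
      then have "N ?d \<le> C * orlicz_norm M_exp ?d"
        by (rule C(3))
      also have "\<dots> \<le> C * (4 * exp 1 * ?s F)"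
        using C(1) by (intro mult_left_mono orlicz_norm_le_of_greater chaos_sum_orlicz_bounds a F) auto
      finally have "N ?d \<le> C * (4 * exp 1 * ?s F)" .
      moreover have "c * sqrt (energy a F) \<le> N (chaos_poly F a)"
        using chaos_poly_lower[OF F, of a] by (simp add: c_def energy_def mult.commute)
      moreover have "N (chaos_poly F a) \<le> N ?d + N (chaos_sum a)"
        using norm_le_norm_diff[OF chaos_poly_mem upper(1)[OF a], of F a]
          norm_diff_commute[OF chaos_poly_mem upper(1)[OF a], of F a] by simp
      ultimately show ?thesis
        by linarith
    qed
    then have ev: "\<forall>\<^sub>F F in finite_subsets_at_top chaos_index.
        c * sqrt (energy a F) - C * (4 * exp 1 * ?s F) \<le> N (chaos_sum a)"
      by (intro eventually_finite_subsets_at_top_weakI)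
    have "((\<lambda>F. c * sqrt (energy a F) - C * (4 * exp 1 * ?s F))
        \<longlongrightarrow> c * sqrt (total_energy a) - C * (4 * exp 1 * sqrt (total_energy a - total_energy a)))
        (finite_subsets_at_top chaos_index)"
      by (intro tendsto_intros energy_tendsto a)
    from tendsto_upperbound[OF this ev] show ?thesis
      by (simp add: ell2_norm_eq)
  qed
  have "ennreal (inverse K * ell2_norm a) \<le> extended_norm X N (chaos_sum a) \<and>
      extended_norm X N (chaos_sum a) \<le> ennreal (K * ell2_norm a)" if a: "a \<in> chaos_ell2" for a
  proof -
    have n: "0 \<le> ell2_norm a"
      by (simp add: ell2_norm_eq total_energy_nonneg)
    have "inverse K * ell2_norm a \<le> N (chaos_sum a)"
      using mult_right_mono[OF K(3) n] lower[OF a] by linarith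
    moreover have "N (chaos_sum a) \<le> K * ell2_norm a"
      using mult_right_mono[OF K(2) n] upper(2)[OF a] by linarith
    ultimately show ?thesis
      using upper(1)[OF a] by (simp add: extended_norm_def ennreal_leI)
  qed
  then show ?thesis
    unfolding ell2_equivalent_def using K(1) by blast
qed

end

section \<open>Unconditionality\<close>

text \<open>Prescribes the sets filled by certain initial segments of an enumeration, while the
  order inside each difference \<open>H (Suc n) - H n\<close> is arbitrary. It produces the bad
  ordering in the gliding hump argument.\<close>

lemma bij_enumeration_of_chain:
  assumes fin: "\<And>n. finite (H n)" and mono: "\<And>n. H n \<subseteq> H (Suc n)" and empty: "H 0 = {}"
    and un: "(\<Union>n. H n) = S" and inf: "infinite S"
  obtains \<phi> :: "nat \<Rightarrow> 'a" where "bij_betw \<phi> UNIV S" "\<And>n. \<phi> ` {..<card (H n)} = H n"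
proof -
  have incr: "H m \<subseteq> H n" if "m \<le> n" for m n
    using lift_Suc_mono_le[of H, OF mono that] .
  have card_H: "card (H n) \<le> card (H (Suc n))" for n
    by (intro card_mono fin mono)
  have "\<exists>\<theta>. bij_betw \<theta> (H (Suc n) - H n) {card (H n)..<card (H (Suc n))}" for n
  proof (rule finite_same_card_bij)
    show "card (H (Suc n) - H n) = card {card (H n)..<card (H (Suc n))}"
      by (simp add: card_Diff_subset fin mono)
  qed (use fin in auto)
  then obtain \<theta> where \<theta>: "\<And>n. bij_betw (\<theta> n) (H (Suc n) - H n) {card (H n)..<card (H (Suc n))}"
    by metis
  \<comment> \<open>The least n selects the layer of p, and \<open>\<theta>\<close> gives its
    position among the indices reserved for that layer.\<close>
  define key where "key p = \<theta> (LEAST n. p \<in> H (Suc n)) p" for p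
  have level: "(LEAST k. p \<in> H (Suc k)) = n" if "p \<in> H (Suc n) - H n" for p n
  proof (rule Least_equality)
    show "n \<le> k" if k: "p \<in> H (Suc k)" for k
    proof (rule ccontr)
      assume "\<not> n \<le> k"
      then have "H (Suc k) \<subseteq> H n"
        by (intro incr) auto
      with k \<open>p \<in> H (Suc n) - H n\<close> show False
        by blast
    qed
  qed (use that in blast)
  have key: "bij_betw key (H n) {..<card (H n)}" for n
  proof (induction n)
    case 0
    then show ?case
      by (simp add: empty bij_betw_def)
  next
    case (Suc n)
    have "bij_betw key (H (Suc n) - H n) {card (H n)..<card (H (Suc n))}"
      using \<theta>[of n] by (rule bij_betw_cong[THEN iffD1, rotated]) (simp add: key_def level)
    moreover have "{..<card (H n)} \<inter> {card (H n)..<card (H (Suc n))} = {}"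
      by auto
    ultimately have "bij_betw key (H n \<union> (H (Suc n) - H n)) ({..<card (H n)} \<union> {card (H n)..<card (H (Suc n))})"
      by (rule bij_betw_combine[OF Suc.IH])
    moreover have "H n \<union> (H (Suc n) - H n) = H (Suc n)"
      using mono[of n] by auto
    moreover have "{..<card (H n)} \<union> {card (H n)..<card (H (Suc n))} = {..<card (H (Suc n))}"
      using card_H[of n] by auto
    ultimately show ?case
      by simp
  qed
  have "bij_betw key (\<Union>n. H n) (\<Union>n. {..<card (H n)})"
  proof (rule bij_betw_UNION_chain[OF _ key])
    show "H i \<subseteq> H j \<or> H j \<subseteq> H i" for i j
      using incr[of i j] incr[of j i] by linarith
  qed
  moreover have "(\<Union>n. {..<card (H n)}) = UNIV"
  proof (rule ccontr)
    assume "(\<Union>n. {..<card (H n)}) \<noteq> UNIV"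
    then obtain b where "b \<notin> (\<Union>n. {..<card (H n)})"
      by blast
    then have b: "card (H n) \<le> b" for n
      by (auto simp: not_less)
    have "\<exists>n. A \<subseteq> H n" if "finite A" "A \<subseteq> S" for A
      using that
    proof (induction A)
      case (insert p A)
      then obtain m n where "A \<subseteq> H m" "p \<in> H n"
        using un by blast
      then have "insert p A \<subseteq> H (max m n)"
        using incr[of m "max m n"] incr[of n "max m n"] by auto
      then show ?case ..
    qed auto
    moreover obtain A where "finite A" "A \<subseteq> S" "card A = Suc b"
      using infinite_arbitrarily_large[OF inf, of "Suc b"] by blast
    ultimately obtain n where "A \<subseteq> H n"
      by blast
    then have "Suc b \<le> card (H n)"
      using \<open>card A = Suc b\<close> by (metis card_mono fin)
    with b[of n] show False
      by simp
  qed
  ultimately have bij: "bij_betw key S UNIV"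
    using un by simp
  have "the_inv_into S key ` {..<card (H n)} = H n" for n
  proof -
    have "the_inv_into S key ` (key ` H n) = H n"
    proof -
      have "H n \<subseteq> S"
        using un by blast
      then show ?thesis
        using bij by (force simp: image_image bij_betw_def the_inv_into_f_f subset_iff)
    qed
    then show ?thesis
      using key[of n] by (simp add: bij_betw_def)
  qed
  then show ?thesis
    using that bij_betw_the_inv_into[OF bij] by blast
qed

lemma sum_eq_chaos_poly:
  fixes \<phi> :: "nat \<Rightarrow> nat \<times> nat"
  assumes "inj \<phi>"
  shows "(\<Sum>k<n. c k * chaos_fun (\<phi> k) t) = chaos_poly (\<phi> ` {..<n}) (\<lambda>p. c (inv \<phi> p)) t"
    and "(\<Sum>k<n. (c k)\<^sup>2) = (\<Sum>p\<in>\<phi> ` {..<n}. (c (inv \<phi> p))\<^sup>2)"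
proof -
  have "inj_on \<phi> {..<n}"
    using assms by (rule inj_on_subset) auto
  then show "(\<Sum>k<n. c k * chaos_fun (\<phi> k) t) = chaos_poly (\<phi> ` {..<n}) (\<lambda>p. c (inv \<phi> p)) t"
    "(\<Sum>k<n. (c k)\<^sup>2) = (\<Sum>p\<in>\<phi> ` {..<n}. (c (inv \<phi> p))\<^sup>2)"
    by (simp_all add: chaos_poly_def sum.reindex assms)
qed

section \<open>Coefficient bounds, basic sequences and the gliding hump\<close>

context symmetric_space
begin

definition chaos_lower :: real where
  "chaos_lower = fundamental (1 / 162) / 2"

lemma chaos_lower_pos: "0 < chaos_lower"
  using fundamental_pos[of "1 / 162"] by (simp add: chaos_lower_def)

lemma chaos_fun_mem: "chaos_fun p \<in> X"
  unfolding chaos_fun_def by (intro simple_mem simple_function_mult rademacher_simple)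

lemma partial_sum_mem:
  fixes \<phi> :: "nat \<Rightarrow> nat \<times> nat"
  shows "(\<lambda>t. \<Sum>k<n. c k * chaos_fun (\<phi> k) t) \<in> X"
  by (intro sum_mem scale_mem chaos_fun_mem)

lemma partial_sum_lower:
  fixes \<phi> :: "nat \<Rightarrow> nat \<times> nat"
  assumes "bij_betw \<phi> UNIV chaos_index"
  shows "chaos_lower * sqrt (\<Sum>k<n. (c k)\<^sup>2) \<le> N (\<lambda>t. \<Sum>k<n. c k * chaos_fun (\<phi> k) t)"
proof -
  have "inj \<phi>" "\<phi> ` {..<n} \<subseteq> chaos_index"
    using assms by (auto simp: bij_betw_def)
  then show ?thesis
    using chaos_poly_lower[of "\<phi> ` {..<n}" "\<lambda>p. c (inv \<phi> p)"]
    by (simp add: sum_eq_chaos_poly chaos_lower_def mult.commute[of "sqrt _"])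
qed

lemma coefficient_le_partial_sum_norm:
  fixes \<phi> :: "nat \<Rightarrow> nat \<times> nat"
  assumes "bij_betw \<phi> UNIV chaos_index" "k < n"
  shows "chaos_lower * \<bar>c k\<bar> \<le> N (\<lambda>t. \<Sum>k<n. c k * chaos_fun (\<phi> k) t)"
proof -
  have "(c k)\<^sup>2 \<le> (\<Sum>k<n. (c k)\<^sup>2)"
    using assms(2) by (intro member_le_sum) auto
  then have "chaos_lower * \<bar>c k\<bar> \<le> chaos_lower * sqrt (\<Sum>k<n. (c k)\<^sup>2)"
    using chaos_lower_pos by (intro mult_left_mono) (auto intro: real_le_rsqrt)
  also have "\<dots> \<le> N (\<lambda>t. \<Sum>k<n. c k * chaos_fun (\<phi> k) t)"
    by (rule partial_sum_lower[OF assms(1)])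
  finally show ?thesis .
qed

lemma partial_sum_diff:
  fixes \<phi> :: "nat \<Rightarrow> nat \<times> nat"
  shows "(\<lambda>t. (\<Sum>k<n. c k * chaos_fun (\<phi> k) t) - (\<Sum>k<n. d k * chaos_fun (\<phi> k) t))
    = (\<lambda>t. \<Sum>k<n. (c k - d k) * chaos_fun (\<phi> k) t)"
  by (simp add: sum_subtractf[symmetric] left_diff_distrib)

text \<open>The coefficients are continuous in the norm, so convergence along any cofinal sequence
  of partial sums determines them. The identity gives uniqueness of an expansion; the ends of the
  blocks are needed in the gliding hump.\<close>

lemma expansion_unique:
  fixes \<phi> :: "nat \<Rightarrow> nat \<times> nat"
  assumes \<phi>: "bij_betw \<phi> UNIV chaos_index" and x: "x \<in> X" and r: "filterlim r at_top sequentially"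
    and c: "(\<lambda>n. N (\<lambda>t. x t - (\<Sum>k<r n. c k * chaos_fun (\<phi> k) t))) \<longlonglongrightarrow> 0"
    and d: "(\<lambda>n. N (\<lambda>t. x t - (\<Sum>k<r n. d k * chaos_fun (\<phi> k) t))) \<longlonglongrightarrow> 0"
  shows "c = d"
proof
  fix k
  let ?p = "\<lambda>c n t. \<Sum>k<r n. c k * chaos_fun (\<phi> k) t"
  have "\<forall>\<^sub>F n in sequentially. chaos_lower * \<bar>c k - d k\<bar> \<le> N (\<lambda>t. x t - ?p c n t) + N (\<lambda>t. x t - ?p d n t)"
    using filterlim_at_top[THEN iffD1, OF r, rule_format, of "Suc k"]
  proof eventually_elim
    case (elim n)
    then have "chaos_lower * \<bar>c k - d k\<bar> \<le> N (\<lambda>t. ?p c n t - ?p d n t)"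
      unfolding partial_sum_diff
      by (intro coefficient_le_partial_sum_norm[OF \<phi>, where c = "\<lambda>k. c k - d k"]) simp
    also have "\<dots> \<le> N (\<lambda>t. ?p c n t - x t) + N (\<lambda>t. x t - ?p d n t)"
      by (intro norm_diff_triangle partial_sum_mem x)
    also have "N (\<lambda>t. ?p c n t - x t) = N (\<lambda>t. x t - ?p c n t)"
      by (intro norm_diff_commute partial_sum_mem x)
    finally show ?case .
  qed
  moreover have "(\<lambda>n. N (\<lambda>t. x t - ?p c n t) + N (\<lambda>t. x t - ?p d n t)) \<longlonglongrightarrow> 0 + 0"
    by (intro tendsto_add c d)
  ultimately have "chaos_lower * \<bar>c k - d k\<bar> \<le> 0 + 0"
    by (intro tendsto_lowerbound[where F = sequentially]) auto
  then show "c k = d k"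
    using chaos_lower_pos by (simp add: mult_le_0_iff)
qed

text \<open>With both ell_2 estimates the coefficients of finite approximants form a Cauchy
  sequence, and the limit coefficients expand the function. Neither estimate depends on the order of
  the terms, so every enumeration is covered.\<close>

lemma upper_estimate_imp_basic:
  fixes \<phi> :: "nat \<Rightarrow> nat \<times> nat"
  assumes \<phi>: "bij_betw \<phi> UNIV chaos_index" and C: "0 < C"
    and upper: "\<And>F a. finite F \<Longrightarrow> F \<subseteq> chaos_index \<Longrightarrow> N (chaos_poly F a) \<le> C * sqrt (\<Sum>p\<in>F. (a p)\<^sup>2)"
  shows "basic_sequence X N (\<lambda>n. chaos_fun (\<phi> n))"
proof -
  have inj: "inj \<phi>" and range: "\<And>k. \<phi> k \<in> chaos_index"
    using \<phi> by (auto simp: bij_betw_def)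
  define p where "p c n t = (\<Sum>k<n. c k * chaos_fun (\<phi> k) t)" for c n t
  have pX: "p c n \<in> X" for c n
    unfolding p_def by (rule partial_sum_mem)
  have p_diff: "(\<lambda>t. p c n t - p d n t) = p (\<lambda>k. c k - d k) n" for c d n
    unfolding p_def by (rule partial_sum_diff)
  have p_upper: "N (p c n) \<le> C * sqrt (\<Sum>k<n. (c k)\<^sup>2)" for c n
  proof -
    have "p c n = chaos_poly (\<phi> ` {..<n}) (\<lambda>q. c (inv \<phi> q))"
      by (simp add: p_def sum_eq_chaos_poly(1)[OF inj] fun_eq_iff)
    then show ?thesis
      using upper[of "\<phi> ` {..<n}" "\<lambda>q. c (inv \<phi> q)"] range
      by (simp add: sum_eq_chaos_poly(2)[OF inj] image_subset_iff)
  qed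
  have p_lower: "chaos_lower * sqrt (\<Sum>k<n. (c k)\<^sup>2) \<le> N (p c n)" for c n
    unfolding p_def by (rule partial_sum_lower[OF \<phi>])
  have "\<exists>!c. (\<lambda>n. N (\<lambda>t. x t - p c n t)) \<longlonglongrightarrow> 0" if x: "x \<in> closed_span X N (\<lambda>n. chaos_fun (\<phi> n))" for x
  proof -
    have xX: "x \<in> X"
      using x by (simp add: closed_span_def)
    define r where "r m = 1 / real (Suc m)" for m
    have r_pos: "0 < r m" for m
      by (simp add: r_def)
    have r0: "r \<longlonglongrightarrow> 0"
      unfolding r_def by (rule LIMSEQ_Suc[OF lim_1_over_n])
    have "\<exists>n c. N (\<lambda>t. x t - p c n t) < r m" for m
      using x r_pos[of m] unfolding closed_span_def p_def by blast
    then obtain l b where lb: "\<And>m. N (\<lambda>t. x t - p (b m) (l m) t) < r m"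
      by metis
    \<comment> \<open>Extension by zeros makes the approximation valid for all partial sums of
      length at least \<open>l m\<close>.\<close>
    define d where "d m k = (if k < l m then b m k else 0)" for m k
    have d: "N (\<lambda>t. x t - p (d m) n t) < r m" if "l m \<le> n" for m n
    proof -
      have "p (d m) n = p (b m) (l m)"
        unfolding p_def d_def using that by (intro ext sum.mono_neutral_cong_right) auto
      then show ?thesis
        using lb[of m] by simp
    qed
    have close: "chaos_lower * sqrt (\<Sum>k<n. (d m k - d m' k)\<^sup>2) \<le> r m + r m'" for m m' n
    proof -
      \<comment> \<open>Long enough to contain the first n coefficients and both approximants
        entirely.\<close>
      define n' where "n' = n + l m + l m'"
      have "chaos_lower * sqrt (\<Sum>k<n. (d m k - d m' k)\<^sup>2) \<le> chaos_lower * sqrt (\<Sum>k<n'. (d m k - d m' k)\<^sup>2)"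
        using chaos_lower_pos by (intro mult_left_mono real_sqrt_le_mono sum_mono2) (auto simp: n'_def)
      also have "\<dots> \<le> N (\<lambda>t. p (d m) n' t - p (d m') n' t)"
        unfolding p_diff by (rule p_lower)
      also have "\<dots> \<le> N (\<lambda>t. p (d m) n' t - x t) + N (\<lambda>t. x t - p (d m') n' t)"
        by (intro norm_diff_triangle pX xX)
      also have "N (\<lambda>t. p (d m) n' t - x t) = N (\<lambda>t. x t - p (d m) n' t)"
        by (intro norm_diff_commute pX xX)
      finally show ?thesis
        using d[of m n'] d[of m' n'] by (simp add: n'_def)
    qed
    have "convergent (\<lambda>m. d m k)" for k
    proof (rule Cauchy_convergent, rule CauchyI)
      fix e :: real assume e: "0 < e"
      have "\<forall>\<^sub>F m in sequentially. r m < chaos_lower * e / 2"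
        using r0 e chaos_lower_pos by (intro order_tendstoD(2)) auto
      then obtain M where M: "\<And>m. M \<le> m \<Longrightarrow> r m < chaos_lower * e / 2"
        by (auto simp: eventually_sequentially)
      have "norm (d m k - d m' k) < e" if "M \<le> m" "M \<le> m'" for m m'
      proof -
        have "(d m k - d m' k)\<^sup>2 \<le> (\<Sum>k<Suc k. (d m k - d m' k)\<^sup>2)"
          by (intro member_le_sum) auto
        then have "\<bar>d m k - d m' k\<bar> \<le> sqrt (\<Sum>k<Suc k. (d m k - d m' k)\<^sup>2)"
          by (intro real_le_rsqrt) simp
        then have "chaos_lower * \<bar>d m k - d m' k\<bar> \<le> chaos_lower * sqrt (\<Sum>k<Suc k. (d m k - d m' k)\<^sup>2)"
          using chaos_lower_pos by (intro mult_left_mono) auto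
        also have "\<dots> \<le> r m + r m'"
          by (rule close)
        also have "\<dots> < chaos_lower * e"
          using M[OF that(1)] M[OF that(2)] by simp
        finally show ?thesis
          using chaos_lower_pos by simp
      qed
      then show "\<exists>M. \<forall>m\<ge>M. \<forall>m'\<ge>M. norm (d m k - d m' k) < e"
        by blast
    qed
    then obtain c where c: "\<And>k. (\<lambda>m. d m k) \<longlonglongrightarrow> c k"
      unfolding convergent_def by metis
    have close': "chaos_lower * sqrt (\<Sum>k<n. (d m k - c k)\<^sup>2) \<le> r m" for m n
    proof -
      have "(\<lambda>m'. chaos_lower * sqrt (\<Sum>k<n. (d m k - d m' k)\<^sup>2)) \<longlonglongrightarrow> chaos_lower * sqrt (\<Sum>k<n. (d m k - c k)\<^sup>2)"
        by (intro tendsto_intros c)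
      moreover have "(\<lambda>m'. r m + r m') \<longlonglongrightarrow> r m + 0"
        by (intro tendsto_intros r0)
      ultimately have "chaos_lower * sqrt (\<Sum>k<n. (d m k - c k)\<^sup>2) \<le> r m + 0"
        by (rule LIMSEQ_le) (use close in blast)
      then show ?thesis
        by simp
    qed
    have bound: "N (\<lambda>t. x t - p c n t) \<le> (1 + C / chaos_lower) * r m" if n: "l m \<le> n" for m n
    proof -
      have "N (\<lambda>t. x t - p c n t) \<le> N (\<lambda>t. x t - p (d m) n t) + N (\<lambda>t. p (d m) n t - p c n t)"
        by (intro norm_diff_triangle pX xX)
      also have "N (\<lambda>t. p (d m) n t - p c n t) \<le> C * sqrt (\<Sum>k<n. (d m k - c k)\<^sup>2)"
        unfolding p_diff by (rule p_upper)
      also have "\<dots> \<le> C * (r m / chaos_lower)"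
        using close'[of m n] C chaos_lower_pos by (intro mult_left_mono) (auto simp: field_simps)
      also have "N (\<lambda>t. x t - p (d m) n t) \<le> r m"
        using d[OF n] by simp
      finally show ?thesis
        by (simp add: algebra_simps)
    qed
    have lim: "(\<lambda>n. N (\<lambda>t. x t - p c n t)) \<longlonglongrightarrow> 0"
    proof (rule LIMSEQ_I)
      fix e :: real assume e: "0 < e"
      have K: "0 < 1 + C / chaos_lower"
        using C chaos_lower_pos by (simp add: add_pos_pos)
      have "\<forall>\<^sub>F m in sequentially. r m < e / (1 + C / chaos_lower)"
        using r0 e K by (intro order_tendstoD(2)) auto
      then obtain m where "r m < e / (1 + C / chaos_lower)"
        by (auto simp: eventually_sequentially)
      then have "(1 + C / chaos_lower) * r m < e"
        using K by (simp add: pos_less_divide_eq mult.commute)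
      then have "norm (N (\<lambda>t. x t - p c n t) - 0) < e" if "l m \<le> n" for n
        using bound[OF that] norm_nonneg[OF diff_mem[OF xX pX], of c n] by simp
      then show "\<exists>no. \<forall>n\<ge>no. norm (N (\<lambda>t. x t - p c n t) - 0) < e"
        by blast
    qed
    moreover have "c' = c" if "(\<lambda>n. N (\<lambda>t. x t - p c' n t)) \<longlonglongrightarrow> 0" for c'
      by (rule expansion_unique[OF \<phi> xX filterlim_ident]) (use that lim in \<open>simp_all add: p_def\<close>)
    ultimately show ?thesis
      by blast
  qed
  then show ?thesis
    unfolding basic_sequence_def p_def by (simp add: chaos_fun_mem)
qed

lemma embedded_imp_unconditional:
  fixes \<phi> :: "nat \<Rightarrow> nat \<times> nat"
  assumes emb: "continuously_embedded H_space (orlicz_norm M_exp) X N" and \<phi>: "bij_betw \<phi> UNIV chaos_index"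
  shows "unconditional_basic_sequence X N (\<lambda>n. chaos_fun (\<phi> n))"
proof -
  obtain C where C: "0 < C"
    "\<And>F a. finite F \<Longrightarrow> F \<subseteq> chaos_index \<Longrightarrow> N (chaos_poly F a) \<le> C * sqrt (\<Sum>p\<in>F. (a p)\<^sup>2)"
    using embedded_imp_chaos_poly_upper[OF emb] by blast
  have "basic_sequence X N (\<lambda>n. chaos_fun (\<phi> (\<pi> n)))" if \<pi>: "bij \<pi>" for \<pi> :: "nat \<Rightarrow> nat"
    using upper_estimate_imp_basic[of "\<phi> \<circ> \<pi>", OF bij_betw_trans[OF \<pi> \<phi>] C] by simp
  then show ?thesis
    unfolding unconditional_basic_sequence_def by blast
qed

text \<open>The factor depends on \<open>D\<close> alone, so discarding finitely many indices costs
  a fixed multiple of the norm. The set \<open>G\<close> also allows the same deletion in a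
  subsum.\<close>

lemma norm_chaos_fun_sum_le:
  assumes D: "finite D" and F: "finite F" "F \<subseteq> chaos_index" and G: "G \<subseteq> F"
  shows "N (chaos_poly (G \<inter> D) a) \<le> (\<Sum>p\<in>D. N (chaos_fun p)) / chaos_lower * N (chaos_poly F a)"
proof -
  let ?s = "N (chaos_poly F a)"
  have coef: "\<bar>a p\<bar> \<le> ?s / chaos_lower" if "p \<in> F" for p
  proof -
    have "(a p)\<^sup>2 \<le> (\<Sum>p\<in>F. (a p)\<^sup>2)"
      using that F by (intro member_le_sum) auto
    then have "\<bar>a p\<bar> \<le> sqrt (\<Sum>p\<in>F. (a p)\<^sup>2)"
      by (intro real_le_rsqrt) simp
    also have "\<dots> \<le> ?s / chaos_lower"
      using chaos_poly_lower[OF F, of a] chaos_lower_pos by (simp add: chaos_lower_def field_simps)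
    finally show ?thesis .
  qed
  have "N (chaos_poly (G \<inter> D) a) \<le> (\<Sum>p\<in>G \<inter> D. N (\<lambda>t. a p * chaos_fun p t))"
    unfolding chaos_poly_def[abs_def] by (intro norm_sum_le scale_mem chaos_fun_mem)
  also have "\<dots> = (\<Sum>p\<in>G \<inter> D. \<bar>a p\<bar> * N (chaos_fun p))"
    by (simp add: norm_scale[OF chaos_fun_mem])
  also have "\<dots> \<le> (\<Sum>p\<in>G \<inter> D. ?s / chaos_lower * N (chaos_fun p))"
    using G by (intro sum_mono mult_right_mono coef norm_nonneg chaos_fun_mem) auto
  also have "\<dots> \<le> (\<Sum>p\<in>D. ?s / chaos_lower * N (chaos_fun p))"
    using D chaos_lower_pos
    by (intro sum_mono2 mult_nonneg_nonneg divide_nonneg_pos norm_nonneg chaos_fun_mem chaos_poly_mem) auto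
  also have "\<dots> = (\<Sum>p\<in>D. N (chaos_fun p)) / chaos_lower * ?s"
    by (simp add: sum_distrib_left sum_distrib_right sum_divide_distrib mult.commute)
  finally show ?thesis .
qed

lemma chaos_poly_Int_Diff: "finite F \<Longrightarrow> chaos_poly F a = (\<lambda>t. chaos_poly (F \<inter> D) a t + chaos_poly (F - D) a t)"
  unfolding chaos_poly_def by (intro ext sum.Int_Diff)

lemma chaos_poly_scale: "chaos_poly F (\<lambda>p. c * a p) = (\<lambda>t. c * chaos_poly F a t)"
  by (simp add: chaos_poly_def sum_distrib_left mult.assoc fun_eq_iff)

text \<open>A failure of the uniform bound can be pushed off any finite set of indices, because the
  coefficients are controlled by the norm of the sum.\<close>

lemma unbounded_tail:
  assumes unbounded: "\<And>K. \<exists>F G a. finite F \<and> F \<subseteq> chaos_index \<and> G \<subseteq> F \<and> K * N (chaos_poly F a) < N (chaos_poly G a)"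
    and D: "finite D" and e: "0 < e"
  obtains F G a where "finite F" "F \<subseteq> chaos_index" "F \<inter> D = {}" "G \<subseteq> F"
    "N (chaos_poly F a) < e" "1 \<le> N (chaos_poly G a)"
proof -
  define M where "M = (\<Sum>p\<in>D. N (chaos_fun p)) / chaos_lower"
  have M: "0 \<le> M"
    unfolding M_def using chaos_lower_pos by (intro divide_nonneg_pos sum_nonneg norm_nonneg chaos_fun_mem)
  \<comment> \<open>The summand \<open>M\<close> pays for the part of \<open>G\<close> inside
    \<open>D\<close>; \<open>(1 + M) / e\<close> leaves the required ratio after the norm over
    \<open>F - D\<close> has grown to at most \<open>1 + M\<close> times that over
    \<open>F\<close>.\<close>
  obtain F G a where F: "finite F" "F \<subseteq> chaos_index" "G \<subseteq> F"
    and big: "(M + (1 + M) / e) * N (chaos_poly F a) < N (chaos_poly G a)"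
    using unbounded[of "M + (1 + M) / e"] by blast
  define s where "s = N (chaos_poly F a)"
  define b where "b = N (chaos_poly (G - D) a)"
  have s: "0 \<le> s"
    unfolding s_def by (rule norm_nonneg[OF chaos_poly_mem])
  have "chaos_poly (F - D) a = (\<lambda>t. chaos_poly F a t - chaos_poly (F \<inter> D) a t)"
    using chaos_poly_Int_Diff[OF F(1), of a D] by (simp add: fun_eq_iff)
  then have "N (chaos_poly (F - D) a) \<le> s + N (chaos_poly (F \<inter> D) a)"
    unfolding s_def by (simp add: norm_diff_le chaos_poly_mem)
  also have "N (chaos_poly (F \<inter> D) a) \<le> M * s"
    unfolding M_def s_def by (rule norm_chaos_fun_sum_le[OF D F(1,2) order_refl])
  finally have small: "N (chaos_poly (F - D) a) \<le> (1 + M) * s"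
    by (simp add: algebra_simps)
  have "N (chaos_poly G a) \<le> N (chaos_poly (G \<inter> D) a) + b"
    unfolding b_def using chaos_poly_Int_Diff[OF finite_subset[OF F(3,1)], of a D]
      norm_triangle[OF chaos_poly_mem chaos_poly_mem, of "G \<inter> D" a "G - D" a] by simp
  also have "N (chaos_poly (G \<inter> D) a) \<le> M * s"
    unfolding M_def s_def by (rule norm_chaos_fun_sum_le[OF D F])
  finally have "(1 + M) / e * s < b"
    using big by (simp add: s_def algebra_simps)
  moreover have "0 \<le> (1 + M) / e * s"
    using M e s by simp
  ultimately have b: "0 < b" "(1 + M) * s < e * b"
    using e by (linarith, simp add: field_simps)
  have scale: "N (chaos_poly A (\<lambda>p. 1 / b * a p)) = N (chaos_poly A a) / b" for A
    unfolding chaos_poly_scale using b norm_scale[OF chaos_poly_mem, of "1 / b" A a] by simp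
  show ?thesis
  proof (rule that)
    show "N (chaos_poly (F - D) (\<lambda>p. 1 / b * a p)) < e"
      unfolding scale using small b by (simp add: divide_less_eq)
    show "1 \<le> N (chaos_poly (G - D) (\<lambda>p. 1 / b * a p))"
      unfolding scale using b by (simp add: b_def)
  qed (use F in auto)
qed


text \<open>Gliding hump: if the uniform bound fails, disjoint blocks \<open>F k\<close> of small norm containing subsets
  \<open>G k\<close> of large norm can be enumerated such that \<open>G k\<close> comes first within its block; the resulting series
  converges along the ends of the blocks but is not Cauchy.\<close>

lemma basic_imp_subset_bound:
  assumes basic: "\<And>\<phi> :: nat \<Rightarrow> nat \<times> nat. bij_betw \<phi> UNIV chaos_index \<Longrightarrow> basic_sequence X N (\<lambda>n. chaos_fun (\<phi> n))"
  shows "\<exists>K. \<forall>F G a. finite F \<longrightarrow> F \<subseteq> chaos_index \<longrightarrow> G \<subseteq> F \<longrightarrow> N (chaos_poly G a) \<le> K * N (chaos_poly F a)"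
proof (rule ccontr)
  assume "\<not> ?thesis"
  then have unbounded: "\<exists>F G a. finite F \<and> F \<subseteq> chaos_index \<and> G \<subseteq> F \<and> K * N (chaos_poly F a) < N (chaos_poly G a)" for K
    by (meson not_le)
  obtain \<psi> :: "nat \<Rightarrow> nat \<times> nat" where \<psi>: "bij_betw \<psi> UNIV chaos_index"
    using chaos_index_enumerable by blast
  define good where "good D k w \<longleftrightarrow> (case w of (F, G, a) \<Rightarrow> finite F \<and> F \<subseteq> chaos_index \<and> F \<inter> D = {} \<and> G \<subseteq> F
      \<and> N (chaos_poly F a) < (1 / 2) ^ k \<and> 1 \<le> N (chaos_poly G a))" for D k w
  \<comment> \<open>The premise inside the existential makes the choice of \<open>W\<close>
    total.\<close>
  have "\<exists>w. finite D \<longrightarrow> good D k w" for D k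
  proof (cases "finite D")
    case True
    show ?thesis
      by (rule unbounded_tail[OF unbounded True, of "(1 / 2) ^ k"]) (auto simp: good_def)
  qed simp
  then obtain W where W: "\<And>D k. finite D \<Longrightarrow> good D k (W D k)"
    by metis
  \<comment> \<open>Adding the next element of a fixed enumeration at each stage ensures that the
    stages exhaust all indices.\<close>
  define D where "D = rec_nat {} (\<lambda>k D. insert (\<psi> k) D \<union> fst (W D k))"
  define F where "F k = fst (W (D k) k)" for k
  define G where "G k = fst (snd (W (D k) k))" for k
  define a where "a k = snd (snd (W (D k) k))" for k
  have D0: "D 0 = {}" and DS: "D (Suc k) = insert (\<psi> k) (D k) \<union> F k" for k
    by (simp_all add: D_def F_def)
  have finD: "finite (D k)" for k
  proof (induction k)
    case (Suc k)
    then have "finite (F k)"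
      using W[OF Suc, of k] by (auto simp: good_def F_def split: prod.splits)
    with Suc show ?case
      by (simp add: DS)
  qed (simp add: D0)
  have w: "finite (F k)" "F k \<subseteq> chaos_index" "F k \<inter> D k = {}" "G k \<subseteq> F k"
    "N (chaos_poly (F k) (a k)) < (1 / 2) ^ k" "1 \<le> N (chaos_poly (G k) (a k))" for k
    using W[OF finD, of k k] by (auto simp: good_def F_def G_def a_def split: prod.splits)
  have D_mono: "D j \<subseteq> D k" if "j \<le> k" for j k
    using lift_Suc_mono_le[of D, OF _ that] by (auto simp: DS)
  have F_sub: "F j \<subseteq> D k" if "j < k" for j k
    using D_mono[of "Suc j" k] that by (auto simp: DS)
  have uniq: "j = k" if "p \<in> F j" "p \<in> F k" for j k p
    using F_sub[of j k] F_sub[of k j] w(3)[of j] w(3)[of k] that by (cases j k rule: linorder_cases) auto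
  \<comment> \<open>One coefficient family for all blocks, which are disjoint; it vanishes at the
    elements inserted only for exhaustion, so these do not affect the sums.\<close>
  define c where "c p = (if \<exists>k. p \<in> F k then a (THE k. p \<in> F k) p else 0)" for p
  have c_F: "c p = a k p" if "p \<in> F k" for p k
  proof -
    have "(THE k. p \<in> F k) = k"
      using that uniq by blast
    then show ?thesis
      using that by (auto simp: c_def)
  qed
  have c_sub: "chaos_poly A c = chaos_poly A (a k)" if "A \<subseteq> F k" for A k
    unfolding chaos_poly_def using that c_F by (intro ext sum.cong) auto
  have c_other: "c p = 0" if "p \<in> D (Suc k)" "p \<notin> D k" "p \<notin> F k" for p k
  proof -
    have "p \<notin> F j" for j
      using F_sub[of j k] D_mono[of "Suc k" j] w(3)[of j] that by (cases j k rule: linorder_cases) auto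
    then show ?thesis
      by (simp add: c_def)
  qed
  define u where "u k = chaos_poly (D k) c" for k
  have uX: "u k \<in> X" for k
    unfolding u_def by (rule chaos_poly_mem)
  have chaos_Un: "(\<lambda>t. chaos_poly (D k \<union> A) c t - chaos_poly (D k) c t) = chaos_poly A c"
    if "finite A" "A \<inter> D k = {}" for A k
    unfolding chaos_poly_def using that finD[of k]
    by (subst sum.union_disjoint) auto
  have step: "(\<lambda>t. u (Suc k) t - u k t) = chaos_poly (F k) (a k)" for k
  proof -
    have "u (Suc k) = chaos_poly (D k \<union> F k) c"
      unfolding u_def chaos_poly_def using finD[of "Suc k"] c_other
      by (intro ext sum.mono_neutral_right) (auto simp: DS)
    then show ?thesis
      using chaos_Un[of "F k" k] w(1,3)[of k] c_sub[of "F k" k] by (simp add: u_def)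
  qed
  have tail: "N (\<lambda>t. u (m + j) t - u m t) \<le> 2 * (1 / 2) ^ m - 2 * (1 / 2) ^ (m + j)" for m j
  proof (induction j)
    case 0
    then show ?case
      by (simp add: norm_zero)
  next
    case (Suc j)
    have "N (\<lambda>t. u (m + Suc j) t - u m t) \<le> N (\<lambda>t. u (m + Suc j) t - u (m + j) t) + N (\<lambda>t. u (m + j) t - u m t)"
      by (intro norm_diff_triangle uX)
    also have "N (\<lambda>t. u (m + Suc j) t - u (m + j) t) \<le> (1 / 2) ^ (m + j)"
      using step[of "m + j"] w(5)[of "m + j"] by simp
    finally show ?case
      using Suc.IH by simp
  qed
  have tail': "N (\<lambda>t. u n t - u m t) \<le> 2 * (1 / 2) ^ m" if "m \<le> n" for m n
  proof -
    have "(0::real) \<le> (1 / 2) ^ n"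
      by simp
    moreover have "N (\<lambda>t. u n t - u m t) \<le> 2 * (1 / 2) ^ m - 2 * (1 / 2) ^ n"
      using tail[of m "n - m"] that by simp
    ultimately show ?thesis
      by linarith
  qed
  have "\<exists>g\<in>X. (\<lambda>n. N (\<lambda>t. u n t - g t)) \<longlonglongrightarrow> 0"
  proof (rule complete[OF uX])
    fix e :: real assume e: "0 < e"
    obtain M where M: "(1 / 2) ^ M < e / 4"
      using real_arch_pow_inv[of "e / 4" "1 / 2"] e by auto
    have "N (\<lambda>t. u m t - u n t) < e" if "M \<le> m" "M \<le> n" for m n
    proof -
      have "N (\<lambda>t. u m t - u n t) \<le> N (\<lambda>t. u m t - u M t) + N (\<lambda>t. u M t - u n t)"
        by (intro norm_diff_triangle uX)
      also have "N (\<lambda>t. u M t - u n t) = N (\<lambda>t. u n t - u M t)"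
        by (intro norm_diff_commute uX)
      finally show ?thesis
        using tail'[OF that(1)] tail'[OF that(2)] M by linarith
    qed
    then show "\<exists>K. \<forall>m\<ge>K. \<forall>n\<ge>K. N (\<lambda>t. u m t - u n t) < e"
      by blast
  qed
  then obtain g where g: "g \<in> X" "(\<lambda>n. N (\<lambda>t. u n t - g t)) \<longlonglongrightarrow> 0"
    by blast
  have g': "(\<lambda>n. N (\<lambda>t. g t - u n t)) \<longlonglongrightarrow> 0"
    using g norm_diff_commute[OF g(1) uX] by simp
  \<comment> \<open>The odd stages stop inside block k, after \<open>G k\<close>; there the partial
    sum has just made a jump of norm at least 1.\<close>
  define H where "H n = (if even n then D (n div 2) else D (n div 2) \<union> G (n div 2))" for n
  have H_even: "H (2 * k) = D k" and H_odd: "H (Suc (2 * k)) = D k \<union> G k" for k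
    by (simp_all add: H_def)
  have finG: "finite (G k)" for k
    using w(1,4) by (rule finite_subset[rotated])
  have psi_D: "\<psi> ` {..<k} \<subseteq> D k" for k
    using D_mono[of "Suc _" k] by (force simp: DS Suc_le_eq)
  have DC: "D k \<subseteq> chaos_index" for k
    using w(2) \<psi> by (induction k) (auto simp: D0 DS bij_betw_def)
  have GC: "G k \<subseteq> chaos_index" for k
    using w(2,4) by (rule order_trans[rotated])
  have inj\<psi>: "inj \<psi>"
    using \<psi> by (simp add: bij_betw_def)
  obtain \<phi> :: "nat \<Rightarrow> nat \<times> nat" where \<phi>: "bij_betw \<phi> UNIV chaos_index" "\<And>n. \<phi> ` {..<card (H n)} = H n"
  proof (rule bij_enumeration_of_chain[of H chaos_index])
    show "finite (H n)" for n
      using finD finG by (simp add: H_def)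
    show "H n \<subseteq> H (Suc n)" for n
    proof (cases "even n")
      case True
      then show ?thesis
        by (auto simp: H_def)
    next
      case False
      then have "Suc n div 2 = Suc (n div 2)"
        by presburger
      then show ?thesis
        using False w(4)[of "n div 2"] by (auto simp: H_def DS)
    qed
    show "H 0 = {}"
      by (simp add: H_def D0)
    show "(\<Union>n. H n) = chaos_index"
    proof (intro equalityI subsetI)
      fix p assume "p \<in> (\<Union>n. H n)"
      then show "p \<in> chaos_index"
        using DC GC by (auto simp: H_def split: if_splits)
    next
      fix p assume "p \<in> chaos_index"
      then obtain k where "p = \<psi> k"
        using \<psi> by (auto simp: bij_betw_def)
      then have "p \<in> H (2 * Suc k)"
        unfolding H_even by (simp add: DS)
      then show "p \<in> (\<Union>n. H n)"
        by blast
    qed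
    show "infinite chaos_index"
      using \<psi> bij_betw_finite by blast
  qed blast
  have inj\<phi>: "inj \<phi>"
    using \<phi>(1) by (simp add: bij_betw_def)
  define s where "s n t = (\<Sum>k<n. c (\<phi> k) * chaos_fun (\<phi> k) t)" for n t
  have s: "s n = chaos_poly (\<phi> ` {..<n}) c" for n
    unfolding s_def chaos_poly_def using inj_on_subset[OF inj\<phi>, of "{..<n}"] by (simp add: sum.reindex)
  have s_even: "s (card (D k)) = u k" for k
    using \<phi>(2)[of "2 * k"] by (simp add: s u_def H_even)
  have card_D: "k \<le> card (D k)" for k
    using card_mono[OF finD psi_D, of k] card_image[OF inj_on_subset[OF inj\<psi>], of "{..<k}"] by simp
  then have r: "filterlim (\<lambda>k. card (D k)) at_top sequentially"
    by (intro filterlim_at_top_mono[OF filterlim_ident]) (auto intro: always_eventually)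
  have "g \<in> closed_span X N (\<lambda>n. chaos_fun (\<phi> n))"
    unfolding closed_span_def
  proof (intro CollectI conjI allI impI g(1))
    fix d :: real assume "0 < d"
    then have "\<forall>\<^sub>F n in sequentially. N (\<lambda>t. g t - u n t) < d"
      using g' by (intro order_tendstoD(2)) auto
    then obtain k where "N (\<lambda>t. g t - u k t) < d"
      by (auto simp: eventually_sequentially)
    then have "N (\<lambda>t. g t - (\<Sum>i<card (D k). c (\<phi> i) * chaos_fun (\<phi> i) t)) < d"
      using s_even[of k] by (simp add: s_def fun_eq_iff)
    then show "\<exists>n b. N (\<lambda>t. g t - (\<Sum>k<n. b k * chaos_fun (\<phi> k) t)) < d"
      by (intro exI[of _ "card (D k)"] exI[of _ "\<lambda>i. c (\<phi> i)"])
  qed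
  then obtain c' where c': "(\<lambda>n. N (\<lambda>t. g t - (\<Sum>k<n. c' k * chaos_fun (\<phi> k) t))) \<longlonglongrightarrow> 0"
    using basic[OF \<phi>(1)] unfolding basic_sequence_def by blast
  \<comment> \<open>The expansion given by the basic sequence also converges along the ends of the
    blocks, where the one with coefficients \<open>c\<close> is known to converge; hence the two
    coincide.\<close>
  have "c' = (\<lambda>k. c (\<phi> k))"
  proof (rule expansion_unique[OF \<phi>(1) g(1) r])
    show "(\<lambda>n. N (\<lambda>t. g t - (\<Sum>k<card (D n). c' k * chaos_fun (\<phi> k) t))) \<longlonglongrightarrow> 0"
      by (rule filterlim_compose[OF c' r])
    show "(\<lambda>n. N (\<lambda>t. g t - (\<Sum>k<card (D n). c (\<phi> k) * chaos_fun (\<phi> k) t))) \<longlonglongrightarrow> 0"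
      using g' unfolding s_even[symmetric] s_def .
  qed
  then have "(\<lambda>n. N (\<lambda>t. g t - s n t)) \<longlonglongrightarrow> 0"
    using c' by (simp add: s_def)
  then have "\<forall>\<^sub>F n in sequentially. N (\<lambda>t. g t - s n t) < 1 / 2"
    by (rule order_tendstoD(2)) simp
  then obtain n0 where n0: "\<And>n. n0 \<le> n \<Longrightarrow> N (\<lambda>t. g t - s n t) < 1 / 2"
    by (auto simp: eventually_sequentially)
  have sX: "s n \<in> X" for n
    unfolding s by (rule chaos_poly_mem)
  define n1 where "n1 = card (D n0)"
  define n2 where "n2 = card (D n0 \<union> G n0)"
  have n: "n0 \<le> n1" "n1 \<le> n2"
    unfolding n1_def n2_def using card_D finD finG by (auto intro: card_mono)
  have "s n2 = chaos_poly (D n0 \<union> G n0) c"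
    using \<phi>(2)[of "Suc (2 * n0)"] by (simp add: s n2_def H_odd)
  moreover have "s n1 = chaos_poly (D n0) c"
    using s_even[of n0] by (simp add: n1_def u_def)
  moreover have "G n0 \<inter> D n0 = {}"
    using w(3,4)[of n0] by blast
  ultimately have "(\<lambda>t. s n2 t - s n1 t) = chaos_poly (G n0) (a n0)"
    using chaos_Un[OF finG] c_sub[OF w(4)] by simp
  then have "1 \<le> N (\<lambda>t. s n2 t - s n1 t)"
    using w(6)[of n0] by simp
  also have "\<dots> \<le> N (\<lambda>t. s n2 t - g t) + N (\<lambda>t. g t - s n1 t)"
    by (intro norm_diff_triangle sX g(1))
  also have "N (\<lambda>t. s n2 t - g t) = N (\<lambda>t. g t - s n2 t)"
    by (intro norm_diff_commute sX g(1))
  finally show False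
    using n0[of n1] n0[of n2] n by simp
qed

text \<open>The positive and the negative entries form two subsums of the signed chaos, and the
  unsigned chaos is the first minus the second.\<close>

lemma block_chaos_le_signed:
  assumes K: "\<And>F G a. finite F \<Longrightarrow> F \<subseteq> chaos_index \<Longrightarrow> G \<subseteq> F \<Longrightarrow> N (chaos_poly G a) \<le> K * N (chaos_poly F a)"
  shows "N (block_chaos q) \<le> 2 * K * N (signed_block_chaos q)"
proof -
  let ?B = "chaos_block q" and ?a = "\<lambda>p. block_signs q p / 4 ^ q"
  let ?G = "{p \<in> ?B. block_signs q p = 1}"
  have "block_chaos q t = chaos_poly ?G ?a t - chaos_poly (?B - ?G) ?a t" for t
  proof -
    have "block_chaos q t = (\<Sum>p\<in>?B \<inter> ?G. 1 / 4 ^ q * chaos_fun p t) + (\<Sum>p\<in>?B - ?G. 1 / 4 ^ q * chaos_fun p t)"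
      unfolding block_chaos_def chaos_poly_def by (rule sum.Int_Diff) simp
    also have "(\<Sum>p\<in>?B \<inter> ?G. 1 / 4 ^ q * chaos_fun p t) = chaos_poly ?G ?a t"
      unfolding chaos_poly_def by (intro sum.cong) auto
    also have "(\<Sum>p\<in>?B - ?G. 1 / 4 ^ q * chaos_fun p t) = - chaos_poly (?B - ?G) ?a t"
      unfolding chaos_poly_def sum_negf[symmetric]
      using block_signs_sign[of q] by (intro sum.cong) (auto, metis minus_divide_left mult_minus_left minus_minus mult_1)
    finally show ?thesis
      by simp
  qed
  then have "N (block_chaos q) = N (\<lambda>t. chaos_poly ?G ?a t - chaos_poly (?B - ?G) ?a t)"
    by presburger
  also have "\<dots> \<le> N (chaos_poly ?G ?a) + N (chaos_poly (?B - ?G) ?a)"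
    by (intro norm_diff_le chaos_poly_mem)
  also have "\<dots> \<le> K * N (chaos_poly ?B ?a) + K * N (chaos_poly ?B ?a)"
    by (intro add_mono K finite_chaos_block chaos_block_subset) auto
  finally show ?thesis
    by (simp add: signed_block_chaos_def)
qed

text \<open>Dyadic layers: the constant takes care of values up to 4, and a larger value in the
  range from \<open>2 ^ k\<close> to \<open>2 ^ (k + 1)\<close> is covered by the summand of index
  k. The maximum \<open>2 ^ q\<close> ends the sum before k = q, which is what makes a recursion in
  q possible.\<close>

lemma signed_block_chaos_norm_le:
  "N (signed_block_chaos q) \<le> 4 * N (\<lambda>_. 1)
    + (\<Sum>k\<in>{2..<q}. 2 ^ (k + 1) * fundamental ((1 / 4) ^ 4 ^ (k - 1)))"
proof -
  let ?g = "signed_block_chaos q"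
  let ?E = "\<lambda>k. {t \<in> {0..1}. 2 ^ k \<le> \<bar>?g t\<bar>}"
  have gX: "?g \<in> X"
    by (rule simple_mem[OF signed_block_chaos_simple])
  have E: "?E k \<in> sets unit_measure" for k
    by (rule unit_sets_ge[OF mem_measurable[OF gX]])
  define y :: "real \<Rightarrow> real" where "y t = 4 * 1 + (\<Sum>k\<in>{2..<q}. 2 ^ (k + 1) * indicator (?E k) t)" for t :: real
  have sX: "(\<lambda>t. \<Sum>k\<in>{2..<q}. 2 ^ (k + 1) * indicator (?E k) t) \<in> X"
    by (intro sum_mem scale_mem indicator_mem E)
  have yX: "y \<in> X"
    unfolding y_def by (intro add_mem scale_mem one_mem sX)
  have "\<bar>?g t\<bar> \<le> \<bar>y t\<bar>" if t: "t \<in> {0..1}" for t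
  proof -
    have nonneg: "0 \<le> (\<Sum>k\<in>{2..<q}. 2 ^ (k + 1) * indicator (?E k) t :: real)"
      by (intro sum_nonneg) auto
    have "\<bar>?g t\<bar> \<le> y t"
    proof (cases "\<bar>?g t\<bar> \<le> 4")
      case True
      then show ?thesis
        using nonneg by (simp add: y_def)
    next
      case False
      \<comment> \<open>Minimality gives \<open>2 ^ k\<close> as a lower bound for the value, so the
        point lies in the set of layer k, whose weight is already sufficient.\<close>
      define k where "k = (LEAST k. \<bar>?g t\<bar> \<le> 2 ^ (k + 1))"
      have q: "\<bar>?g t\<bar> \<le> 2 ^ q"
        by (rule abs_signed_block_chaos_le)
      have "q \<noteq> 0"
        using q False by (intro notI) simp
      then have "\<bar>?g t\<bar> \<le> 2 ^ ((q - 1) + 1)"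
        using q by simp
      then have k: "\<bar>?g t\<bar> \<le> 2 ^ (k + 1)" "k \<le> q - 1"
        unfolding k_def by (rule LeastI, rule Least_le)
      have k2: "2 \<le> k"
      proof (rule ccontr)
        assume "\<not> 2 \<le> k"
        then have "(2::real) ^ (k + 1) \<le> 2 ^ 2"
          by (intro power_increasing) auto
        then show False
          using k(1) False by simp
      qed
      have "\<not> \<bar>?g t\<bar> \<le> 2 ^ ((k - 1) + 1)"
        using not_less_Least[of "k - 1" "\<lambda>k. \<bar>?g t\<bar> \<le> 2 ^ (k + 1)", folded k_def] k2 by simp
      then have "2 ^ k \<le> \<bar>?g t\<bar>"
        using k2 by simp
      then have "2 ^ (k + 1) = 2 ^ (k + 1) * (indicator (?E k) t :: real)"
        using t by simp
      also have "\<dots> \<le> (\<Sum>k\<in>{2..<q}. 2 ^ (k + 1) * indicator (?E k) t)"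
        using k k2 \<open>q \<noteq> 0\<close>
        by (intro member_le_sum[of k "{2..<q}" "\<lambda>k. 2 ^ (k + 1) * indicator (?E k) t"]) auto
      finally show ?thesis
        using k(1) by (simp add: y_def)
    qed
    then show ?thesis
      by linarith
  qed
  then have "AE t in unit_measure. \<bar>?g t\<bar> \<le> \<bar>y t\<bar>"
    by (intro AE_I2) simp
  then have "N ?g \<le> N y"
    using ideal_norm[OF yX mem_measurable[OF gX]] by blast
  also have "N y \<le> N (\<lambda>_. 4 * 1) + N (\<lambda>t. \<Sum>k\<in>{2..<q}. 2 ^ (k + 1) * indicator (?E k) t)"
    unfolding y_def by (intro norm_triangle scale_mem one_mem sX)
  also have "N (\<lambda>_. 4 * 1) = 4 * N (\<lambda>_. 1)"
    using norm_scale[OF one_mem, of 4] by simp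
  also have "N (\<lambda>t. \<Sum>k\<in>{2..<q}. 2 ^ (k + 1) * indicator (?E k) t)
      \<le> (\<Sum>k\<in>{2..<q}. N (\<lambda>t. 2 ^ (k + 1) * indicator (?E k) t))"
    by (intro norm_sum_le scale_mem indicator_mem E)
  also have "\<dots> = (\<Sum>k\<in>{2..<q}. 2 ^ (k + 1) * N (indicator (?E k)))"
    by (simp only: norm_scale[OF indicator_mem[OF E]]) simp
  also have "\<dots> \<le> (\<Sum>k\<in>{2..<q}. 2 ^ (k + 1) * fundamental ((1 / 4) ^ 4 ^ (k - 1)))"
  proof (intro sum_mono mult_left_mono)
    fix k assume "k \<in> {2..<q}"
    then show "N (indicator (?E k)) \<le> fundamental ((1 / 4) ^ 4 ^ (k - 1))"
      by (intro indicator_norm_le_fundamental E prob_signed_block_chaos_tail) (auto intro: power_le_one)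
  qed simp
  finally show ?thesis
    by simp
qed

lemma fundamental_le_block_chaos: "4 ^ q * fundamental ((1 / 4) ^ 4 ^ q) \<le> N (block_chaos q)"
proof (rule fundamental_le_norm)
  have "prob (\<lambda>t. 4 ^ q \<le> block_chaos q t) \<le> prob (\<lambda>t. 4 ^ q \<le> \<bar>block_chaos q t\<bar>)"
    by (rule prob_mono[OF block_chaos_simple]) simp
  then show "(1 / 4) ^ 4 ^ q \<le> prob (\<lambda>t. 4 ^ q \<le> \<bar>block_chaos q t\<bar>)"
    using prob_block_chaos_max[of q] by simp
qed (simp_all add: simple_mem[OF block_chaos_simple])

text \<open>The weights \<open>1 / 2 ^ j\<close> have total sum 2, hence a bound that does not
  depend on q.\<close>

lemma discrete_gronwall:
  fixes g :: "nat \<Rightarrow> real"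
  assumes A: "0 \<le> A" and L: "0 \<le> L" and g: "\<And>q. g q \<le> A + L * (\<Sum>j<q. g j / 2 ^ j)"
  shows "g q \<le> A * exp (2 * L)"
proof -
  define b where "b q = A + L * (\<Sum>j<q. g j / 2 ^ j)" for q
  have gb: "g q \<le> b q" for q
    using g by (simp add: b_def)
  \<comment> \<open>\<open>2 - 2 / 2 ^ q\<close> is the sum of \<open>1 / 2 ^ j\<close> over j <
    q.\<close>
  have b: "b q \<le> A * exp (L * (2 - 2 / 2 ^ q))" for q
  proof (induction q)
    case 0
    then show ?case
      by (simp add: b_def)
  next
    case (Suc q)
    have "b (Suc q) = b q + L / 2 ^ q * g q"
      by (simp add: b_def algebra_simps)
    also have "\<dots> \<le> b q + L / 2 ^ q * b q"
      using L gb by (intro add_left_mono mult_left_mono) auto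
    also have "\<dots> = b q * (1 + L / 2 ^ q)"
      by (simp add: algebra_simps)
    also have "\<dots> \<le> (A * exp (L * (2 - 2 / 2 ^ q))) * exp (L / 2 ^ q)"
    proof (rule mult_mono[OF Suc.IH exp_ge_add_one_self])
      show "0 \<le> A * exp (L * (2 - 2 / 2 ^ q))" "0 \<le> 1 + L / 2 ^ q"
        using A L by auto
    qed
    also have "\<dots> = A * exp (L * (2 - 2 / 2 ^ q) + L / 2 ^ q)"
      by (simp add: exp_add)
    also have "L * (2 - 2 / 2 ^ q) + L / 2 ^ q = L * (2 - 2 / 2 ^ Suc q)"
      by (simp add: field_simps)
    finally show ?case .
  qed
  have "g q \<le> A * exp (L * (2 - 2 / 2 ^ q))"
    using gb b by (rule order_trans)
  also have "\<dots> \<le> A * exp (2 * L)"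
    using A L by (intro mult_left_mono) (auto simp: algebra_simps)
  finally show ?thesis .
qed

text \<open>Each estimate of \<open>signed_block_chaos q\<close> only involves the fundamental function at the points reached
  by \<open>block_chaos j\<close> with \<open>j < q\<close>, which makes the argument close up on itself.\<close>

lemma subset_bound_imp_block_chaos_bounded:
  assumes K: "\<And>F G a. finite F \<Longrightarrow> F \<subseteq> chaos_index \<Longrightarrow> G \<subseteq> F \<Longrightarrow> N (chaos_poly G a) \<le> K * N (chaos_poly F a)"
  shows "\<exists>C. \<forall>q. N (block_chaos q) \<le> C"
proof -
  \<comment> \<open>The maximum secures a positive constant for the multiplications below.\<close>
  define K' where "K' = max K 1"
  have K'0: "0 < K'"
    by (simp add: K'_def)
  have K': "N (chaos_poly G a) \<le> K' * N (chaos_poly F a)"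
    if "finite F" "F \<subseteq> chaos_index" "G \<subseteq> F" for F G a
  proof -
    have "K * N (chaos_poly F a) \<le> K' * N (chaos_poly F a)"
      by (intro mult_right_mono norm_nonneg chaos_poly_mem) (simp add: K'_def)
    then show ?thesis
      using K[OF that, of a] by linarith
  qed
  define g where "g q = N (signed_block_chaos q)" for q
  define A where "A = 4 * N (\<lambda>_. 1)"
  have g_nonneg: "0 \<le> g q" for q
    unfolding g_def by (rule norm_nonneg[OF simple_mem[OF signed_block_chaos_simple]])
  have A: "0 \<le> A"
    unfolding A_def using norm_nonneg[OF one_mem] by simp
  have f: "N (block_chaos q) \<le> 2 * K' * g q" for q
    unfolding g_def by (rule block_chaos_le_signed[OF K'])
  \<comment> \<open>With j = k - 1 the height \<open>2 ^ (k + 1)\<close> is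
    \<open>4 * 2 ^ j\<close>, while the fundamental function carries the factor
    \<open>4 ^ j = 2 ^ j * 2 ^ j\<close> in its upper estimate; the quotient is the summable
    weight.\<close>
  have fund: "2 ^ (k + 1) * fundamental ((1 / 4) ^ 4 ^ (k - 1)) \<le> 8 * K' * (g (k - 1) / 2 ^ (k - 1))"
    if "2 \<le> k" for k
  proof -
    have "k \<noteq> 0"
      using that by simp
    then obtain j where j: "k = Suc j"
      using not0_implies_Suc by blast
    have "4 ^ j * fundamental ((1 / 4) ^ 4 ^ j) \<le> 2 * K' * g j"
      using fundamental_le_block_chaos[of j] f[of j] by linarith
    then have "4 / 2 ^ j * (4 ^ j * fundamental ((1 / 4) ^ 4 ^ j)) \<le> 4 / 2 ^ j * (2 * K' * g j)"
      by (intro mult_left_mono) auto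
    moreover have "(4::real) ^ j = 2 ^ j * 2 ^ j"
      by (simp flip: power_mult_distrib)
    ultimately show ?thesis
      by (simp add: j)
  qed
  have "g q \<le> A + 8 * K' * (\<Sum>j<q. g j / 2 ^ j)" for q
  proof -
    have "g q \<le> A + (\<Sum>k\<in>{2..<q}. 2 ^ (k + 1) * fundamental ((1 / 4) ^ 4 ^ (k - 1)))"
      unfolding g_def A_def by (rule signed_block_chaos_norm_le)
    also have "(\<Sum>k\<in>{2..<q}. 2 ^ (k + 1) * fundamental ((1 / 4) ^ 4 ^ (k - 1)))
        \<le> (\<Sum>k\<in>{2..<q}. 8 * K' * (g (k - 1) / 2 ^ (k - 1)))"
      by (intro sum_mono fund) auto
    also have "\<dots> = 8 * K' * (\<Sum>k\<in>{2..<q}. g (k - 1) / 2 ^ (k - 1))"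
      by (simp add: sum_distrib_left)
    also have "(\<Sum>k\<in>{2..<q}. g (k - 1) / 2 ^ (k - 1)) = (\<Sum>j\<in>(\<lambda>k. k - 1) ` {2..<q}. g j / 2 ^ j)"
      by (subst sum.reindex) (auto simp: inj_on_def)
    also have "\<dots> \<le> (\<Sum>j<q. g j / 2 ^ j)"
      using g_nonneg by (intro sum_mono2) auto
    finally show ?thesis
      using K'0 by (simp add: mult_left_mono)
  qed
  then have "g q \<le> A * exp (2 * (8 * K'))" for q
    using A K'0 by (intro discrete_gronwall) auto
  then have "2 * K' * g q \<le> 2 * K' * (A * exp (2 * (8 * K')))" for q
    using K'0 by (intro mult_left_mono) auto
  with f have "N (block_chaos q) \<le> 2 * K' * (A * exp (2 * (8 * K')))" for q
    by (rule order_trans)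
  then show ?thesis
    by (intro exI allI)
qed

text \<open>The permutations are already contained in the variation of \<open>\<phi>\<close>: the
  identity permutation turns the assumption into the statement that every enumeration yields a basic
  sequence.\<close>

lemma unconditional_imp_embedded:
  assumes "\<And>\<phi> :: nat \<Rightarrow> nat \<times> nat. bij_betw \<phi> UNIV chaos_index \<Longrightarrow> unconditional_basic_sequence X N (\<lambda>n. chaos_fun (\<phi> n))"
  shows "continuously_embedded H_space (orlicz_norm M_exp) X N"
proof -
  have "basic_sequence X N (\<lambda>n. chaos_fun (\<phi> n))" if "bij_betw \<phi> UNIV chaos_index" for \<phi> :: "nat \<Rightarrow> nat \<times> nat"
    using assms[OF that, unfolded unconditional_basic_sequence_def, rule_format, OF bij_id] by simp
  then have "\<exists>K. \<forall>F G a. finite F \<longrightarrow> F \<subseteq> chaos_index \<longrightarrow> G \<subseteq> F \<longrightarrow>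
      N (chaos_poly G a) \<le> K * N (chaos_poly F a)"
    by (rule basic_imp_subset_bound)
  then obtain K where K: "\<forall>F G a. finite F \<longrightarrow> F \<subseteq> chaos_index \<longrightarrow> G \<subseteq> F \<longrightarrow>
      N (chaos_poly G a) \<le> K * N (chaos_poly F a)"
    by (rule exE)
  have "\<exists>C. \<forall>q. N (block_chaos q) \<le> C"
    by (rule subset_bound_imp_block_chaos_bounded[of K]) (use K in blast)
  then obtain C where "\<forall>q. N (block_chaos q) \<le> C"
    by (rule exE)
  then show ?thesis
    by (intro block_chaos_bounded_imp_embedded[of C]) (rule spec)
qed

end

theorem theorem2:
  fixes X :: "(real \<Rightarrow> real) set" and N :: "(real \<Rightarrow> real) \<Rightarrow> real"
  assumes "symmetric_space X N"
  shows "((\<exists>C>0. \<forall>a\<in>chaos_ell2.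
             ennreal (inverse C * ell2_norm a) \<le> extended_norm X N (chaos_sum a) \<and>
             extended_norm X N (chaos_sum a) \<le> ennreal (C * ell2_norm a))
          \<longleftrightarrow> continuously_embedded H_space (orlicz_norm M_exp) X N)
       \<and> (continuously_embedded H_space (orlicz_norm M_exp) X N
          \<longleftrightarrow> (\<forall>\<phi> :: nat \<Rightarrow> nat \<times> nat. bij_betw \<phi> UNIV chaos_index \<longrightarrow>
                 unconditional_basic_sequence X N (\<lambda>n. chaos_fun (\<phi> n))))"
proof -
  interpret symmetric_space X N
    by (rule assms)
  show ?thesis
    unfolding ell2_equivalent_def[symmetric]
    using ell2_equivalent_imp_embedded embedded_imp_ell2_equivalent embedded_imp_unconditional
      unconditional_imp_embedded by blast
qed

end
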